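(* There exists an integer $n_0$ such that the following holds. If $H$ is a $4$-uniform hypergraph on $n \geq n_0$ vertices, where $n$ is divisible by $4$, and $$\delta_1(H) \geq \binom{n-1}{3} - \binom{3n/4}{3} + 1,$$ then $H$ has a perfect matching.
   Context: A $4$-uniform hypergraph ($4$-graph) $H$ consists of a vertex set $V(H)$ and a family $E(H)$ of $4$-element subsets of $V(H)$ (edges). The degree of a vertex $v$ is the number of edges containing $v$, and $\delta_1(H)$ is the minimum degree over all vertices. A perfect matching is a set of pairwise disjoint edges covering all vertices. *)

theory Defs
  imports Main
begin

definition uniform_hypergraph :: "nat \<Rightarrow> 'a set \<Rightarrow> 'a set set \<Rightarrow> bool" where
  "uniform_hypergraph k V E \<longleftrightarrow> finite V \<and> (\<forall>e\<in>E. e \<subseteq> V \<and> card e = k)"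

definition vertex_degree :: "'a set set \<Rightarrow> 'a \<Rightarrow> nat" where
  "vertex_degree E v = card {e \<in> E. v \<in> e}"

(* Unspecified when V is empty. *)
definition min_vertex_degree :: "'a set \<Rightarrow> 'a set set \<Rightarrow> nat" where
  "min_vertex_degree V E = Min (vertex_degree E ` V)"

definition perfect_matching :: "'a set \<Rightarrow> 'a set set \<Rightarrow> 'a set set \<Rightarrow> bool" where
  "perfect_matching V E M \<longleftrightarrow> M \<subseteq> E \<and> pairwise disjnt M \<and> \<Union>M = V"

end

theory Submission
  imports Defs "HOL-Analysis.Analysis"
begin

text \<open>
  Minimum vertex degree close to 37/64 of the maximum forces an almost perfect matching unless the hypergraph
  is close to the extremal one, in which a set B of 3/4 of the vertices spans no edge. To see this, minimise a convex
  quadratic function of vertex weights y. The stationarity condition turns the positive parts of the edge sums y(e)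
  into a bounded edge weighting whose weighted degree at v is 1 - y(v). If y is small in the mean square,
  this is an almost perfect fractional matching, which a greedily derandomised nibble rounds. Otherwise y is in effect a
  fractional cover of size below n/4, and a stability version of Samuels' inequality for three independent variables of
  mean 1/4, applied to the link of a vertex of minimum cover weight, exhibits B.

  In the first case an absorbing set, again chosen greedily with an exponential potential, completes the almost
  perfect matching. In the extremal case the exact degree condition supplies just enough edges inside B to
  balance the sizes of the two parts; after the few atypical vertices are covered, an augmentation argument
  yields a perfect matching by edges with exactly one vertex outside B.
\<close>

section \<open>Samuels inequality with stability\<close>

text \<open>The threshold comes from the hypergraph of all 4-sets meeting a fixed set of
  \<open>n/4 - 1\<close> vertices: it has no perfect matching, and its minimum degree is exactly one
  below the bound, asymptotically 1 - (3/4)^3 = 37/64 of the maximum. Near this example any estimate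
  with slack fails, so the exact bound is spent there alone. Elsewhere 37/64 - \<gamma> is enough,
  and absorption works with 9/16, since two links of density above 1/2 always overlap. Linear
  programming duality would also give a fractional matching or a cover, but the weights might sit on
  few edges, where a nibble fails. The quadratic penalty forces every weight to be O(n^-3), at the
  price of a cover that ignores a small proportion of the edges. The order of the constants shapes
  the statements: \<gamma> depends on \<eta> only, the absorbing set is small against \<gamma>, its
  capacity follows, and only then are the tolerance of the nibble and the bound on the weights
  fixed.\<close>

text \<open>The hypotheses say that the Bernstein coefficients on the unit interval are nonnegative. In this way polynomials in
  the densities are bounded below on six boxes, each rescaled to the unit square.\<close>

lemma cubic_nonneg:
  fixes t :: real
  assumes "0 \<le> t" "t \<le> 1" "0 \<le> c0" "0 \<le> 3*c0 + c1" "0 \<le> 3*c0 + 2*c1 + c2" "0 \<le> c0 + c1 + c2 + c3"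
  shows "0 \<le> c0 + c1*t + c2*t^2 + c3*t^3"
proof -
  have "c0 + c1*t + c2*t^2 + c3*t^3
    = c0*(1-t)^3 + (3*c0+c1)*t*(1-t)^2 + (3*c0+2*c1+c2)*t^2*(1-t) + (c0+c1+c2+c3)*t^3"
    by algebra
  then show ?thesis using assms by simp
qed

text \<open>Sixteen named coefficients instead of a doubly indexed family: once they are numerals,
  all hypotheses of \<open>bicubic_nonneg\<close> are closed arithmetic for the simplifier.\<close>

definition bicubic :: "real \<Rightarrow> real \<Rightarrow> real \<Rightarrow> real \<Rightarrow> real \<Rightarrow> real \<Rightarrow> real \<Rightarrow> real \<Rightarrow> real \<Rightarrow>
    real \<Rightarrow> real \<Rightarrow> real \<Rightarrow> real \<Rightarrow> real \<Rightarrow> real \<Rightarrow> real \<Rightarrow> real \<Rightarrow> real \<Rightarrow> real" where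
  "bicubic a0 a1 a2 a3 b0 b1 b2 b3 c0 c1 c2 c3 d0 d1 d2 d3 t s =
     (a0 + a1 * s + a2 * s^2 + a3 * s^3) + (b0 + b1 * s + b2 * s^2 + b3 * s^3) * t
     + (c0 + c1 * s + c2 * s^2 + c3 * s^3) * t^2 + (d0 + d1 * s + d2 * s^2 + d3 * s^3) * t^3"

text \<open>The one-variable criterion is used in \<open>t\<close>, and then in \<open>s\<close> for
  each of the four resulting coefficients; the hypothesis groups 0 to 3 are the coefficients with
  respect to the products of the two Bernstein bases.\<close>

lemma bicubic_nonneg:
  assumes ts: "0 \<le> t" "t \<le> 1" "0 \<le> s" "s \<le> 1"
    and 0: "0 \<le> a0" "0 \<le> 3*a0 + a1" "0 \<le> 3*a0 + 2*a1 + a2" "0 \<le> a0 + a1 + a2 + a3"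
    and 1: "0 \<le> 3*a0 + b0" "0 \<le> 3*(3*a0 + b0) + (3*a1 + b1)"
      "0 \<le> 3*(3*a0 + b0) + 2*(3*a1 + b1) + (3*a2 + b2)"
      "0 \<le> (3*a0 + b0) + (3*a1 + b1) + (3*a2 + b2) + (3*a3 + b3)"
    and 2: "0 \<le> 3*a0 + 2*b0 + c0" "0 \<le> 3*(3*a0 + 2*b0 + c0) + (3*a1 + 2*b1 + c1)"
      "0 \<le> 3*(3*a0 + 2*b0 + c0) + 2*(3*a1 + 2*b1 + c1) + (3*a2 + 2*b2 + c2)"
      "0 \<le> (3*a0 + 2*b0 + c0) + (3*a1 + 2*b1 + c1) + (3*a2 + 2*b2 + c2) + (3*a3 + 2*b3 + c3)"
    and 3: "0 \<le> a0 + b0 + c0 + d0" "0 \<le> 3*(a0 + b0 + c0 + d0) + (a1 + b1 + c1 + d1)"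
      "0 \<le> 3*(a0 + b0 + c0 + d0) + 2*(a1 + b1 + c1 + d1) + (a2 + b2 + c2 + d2)"
      "0 \<le> (a0 + b0 + c0 + d0) + (a1 + b1 + c1 + d1) + (a2 + b2 + c2 + d2) + (a3 + b3 + c3 + d3)"
  shows "0 \<le> bicubic a0 a1 a2 a3 b0 b1 b2 b3 c0 c1 c2 c3 d0 d1 d2 d3 t s"
  unfolding bicubic_def
proof (rule cubic_nonneg[OF ts(1,2)])
  show "0 \<le> a0 + a1 * s + a2 * s^2 + a3 * s^3" using 0 by (intro cubic_nonneg ts)
  show "0 \<le> 3 * (a0 + a1 * s + a2 * s^2 + a3 * s^3) + (b0 + b1 * s + b2 * s^2 + b3 * s^3)"
    using cubic_nonneg[OF ts(3,4) 1] by (simp add: algebra_simps)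
  show "0 \<le> 3 * (a0 + a1 * s + a2 * s^2 + a3 * s^3) + 2 * (b0 + b1 * s + b2 * s^2 + b3 * s^3)
      + (c0 + c1 * s + c2 * s^2 + c3 * s^3)"
    using cubic_nonneg[OF ts(3,4) 2] by (simp add: algebra_simps)
  show "0 \<le> (a0 + a1 * s + a2 * s^2 + a3 * s^3) + (b0 + b1 * s + b2 * s^2 + b3 * s^3)
      + (c0 + c1 * s + c2 * s^2 + c3 * s^3) + (d0 + d1 * s + d2 * s^2 + d3 * s^3)"
    using cubic_nonneg[OF ts(3,4) 3] by (simp add: algebra_simps)
qed

text \<open>The three conclusions are the worst cases in which the whole excess
  \<open>(a - b)/4\<close> lies in one of the three weight classes, and 423/250 is four times the
  target density 423/1000, which is slightly above 27/64. The coordinate \<open>r = b/a\<close>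
  turns the region \<open>b \<le> a\<close> into a rectangle. The other boxes differ in the
  rectangle and in the multipliers of \<open>a*m*b\<close> and \<open>m^3\<close>, here 12 and
  2.\<close>

lemma samuels_box1:
  fixes a b m r :: real
  assumes a: "0 \<le> a" "a \<le> 7/25" and r: "0 \<le> r" "r \<le> 1"
    and b: "b = a * r" and m: "m = 1 - a - b"
  shows "423 \<le> 250 * (4*a^3 + 12*a^2*m + 12*a^2*b + 12*a*m^2 + 12*a*m*b + 2*m^3 - (a - b) * (12*a*b + 6*m^2 + 12*m*b))"
    and "423 \<le> 250 * (4*a^3 + 12*a^2*m + 12*a^2*b + 12*a*m^2 + 12*a*m*b + 2*m^3 - (a - b) * (12*a*m + 12*a*b + 6*m^2))"
    and "423 \<le> 250 * (4*a^3 + 12*a^2*m + 12*a^2*b + 12*a*m^2 + 12*a*m*b + 2*m^3 - (a - b) * (6*a^2 + 12*a*m))"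
proof -
  define t s where "t = (100 * a) / 28" and "s = (100 * r) / 100"
  \<comment> \<open>The scaling by 10^4 makes \<open>a\<close> and \<open>b = a*r\<close>
    polynomials in \<open>t\<close> and \<open>s\<close> with integer coefficients, so the
    identities left to \<open>algebra\<close> are integral; the cubic expressions scale by
    10^12.\<close>
  define X Y Z where "X = 10000 * a" and "Y = 10000 * b" and "Z = 10000 * m"
  have ts: "0 \<le> t" "t \<le> 1" "0 \<le> s" "s \<le> 1"
    using a r by (simp_all add: t_def s_def)
  have ar: "100 * a = 28 * t" "100 * r = 100 * s"
    unfolding t_def s_def by (simp_all add: field_simps)
  have X: "X = 100 * (28 * t)" unfolding X_def ar[symmetric] by simp
  have Y: "Y = (28 * t) * (100 * s)" unfolding Y_def b ar[symmetric] by simp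
  have Z: "Z = 10000 - X - Y" unfolding X_def Y_def Z_def m by simp
  have "0 \<le> bicubic 77000000000000 0 0 0 0 0 0 0 117600000000000 (-235200000000000) 117600000000000 0 (-21952000000000) 0 65856000000000 (-43904000000000) t s"
    by (rule bicubic_nonneg[OF ts]) simp_all
  also have "\<dots> = 250 * (4*X^3 + 12*X^2*Z + 12*X^2*Y + 12*X*Z^2 + 12*X*Z*Y + 2*Z^3 - (X - Y) * (12*X*Y + 6*Z^2 + 12*Z*Y)) - 423000000000000"
    unfolding Z X Y bicubic_def by algebra
  also have "\<dots> = 1000000000000 * (250 * (4*a^3 + 12*a^2*m + 12*a^2*b + 12*a*m^2 + 12*a*m*b + 2*m^3 - (a - b) * (12*a*b + 6*m^2 + 12*m*b)) - 423)"
    unfolding X_def Y_def Z_def by algebra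
  finally show "423 \<le> 250 * (4*a^3 + 12*a^2*m + 12*a^2*b + 12*a*m^2 + 12*a*m*b + 2*m^3 - (a - b) * (12*a*b + 6*m^2 + 12*m*b))" by simp
  have "0 \<le> bicubic 77000000000000 0 0 0 0 0 0 0 (-117600000000000) 235200000000000 (-117600000000000) 0 43904000000000 (-65856000000000) 0 21952000000000 t s"
    by (rule bicubic_nonneg[OF ts]) simp_all
  also have "\<dots> = 250 * (4*X^3 + 12*X^2*Z + 12*X^2*Y + 12*X*Z^2 + 12*X*Z*Y + 2*Z^3 - (X - Y) * (12*X*Z + 12*X*Y + 6*Z^2)) - 423000000000000"
    unfolding Z X Y bicubic_def by algebra
  also have "\<dots> = 1000000000000 * (250 * (4*a^3 + 12*a^2*m + 12*a^2*b + 12*a*m^2 + 12*a*m*b + 2*m^3 - (a - b) * (12*a*m + 12*a*b + 6*m^2)) - 423)"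
    unfolding X_def Y_def Z_def by algebra
  finally show "423 \<le> 250 * (4*a^3 + 12*a^2*m + 12*a^2*b + 12*a*m^2 + 12*a*m*b + 2*m^3 - (a - b) * (12*a*m + 12*a*b + 6*m^2))" by simp
  have "0 \<le> bicubic 77000000000000 0 0 0 420000000000000 (-420000000000000) 0 0 (-352800000000000) 235200000000000 117600000000000 0 43904000000000 65856000000000 (-98784000000000) (-10976000000000) t s"
    by (rule bicubic_nonneg[OF ts]) simp_all
  also have "\<dots> = 250 * (4*X^3 + 12*X^2*Z + 12*X^2*Y + 12*X*Z^2 + 12*X*Z*Y + 2*Z^3 - (X - Y) * (6*X^2 + 12*X*Z)) - 423000000000000"
    unfolding Z X Y bicubic_def by algebra
  also have "\<dots> = 1000000000000 * (250 * (4*a^3 + 12*a^2*m + 12*a^2*b + 12*a*m^2 + 12*a*m*b + 2*m^3 - (a - b) * (6*a^2 + 12*a*m)) - 423)"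
    unfolding X_def Y_def Z_def by algebra
  finally show "423 \<le> 250 * (4*a^3 + 12*a^2*m + 12*a^2*b + 12*a*m^2 + 12*a*m*b + 2*m^3 - (a - b) * (6*a^2 + 12*a*m))" by simp
qed

lemma samuels_box2:
  fixes a b m r :: real
  assumes a: "7/25 \<le> a" "a \<le> 43/100" and r: "0 \<le> r" "r \<le> 1/2"
    and b: "b = a * r" and m: "m = 1 - a - b"
  shows "423 \<le> 250 * (4*a^3 + 12*a^2*m + 12*a^2*b + 12*a*m^2 + 12*a*m*b + 1*m^3 - (a - b) * (12*a*b + 6*m^2 + 12*m*b))"
    and "423 \<le> 250 * (4*a^3 + 12*a^2*m + 12*a^2*b + 12*a*m^2 + 12*a*m*b + 1*m^3 - (a - b) * (12*a*m + 12*a*b + 3*m^2))"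
    and "423 \<le> 250 * (4*a^3 + 12*a^2*m + 12*a^2*b + 12*a*m^2 + 12*a*m*b + 1*m^3 - (a - b) * (6*a^2 + 12*a*m))"
proof -
  define t s where "t = (100 * a - 28) / 15" and "s = (100 * r) / 50"
  define X Y Z where "X = 10000 * a" and "Y = 10000 * b" and "Z = 10000 * m"
  have ts: "0 \<le> t" "t \<le> 1" "0 \<le> s" "s \<le> 1"
    using a r by (simp_all add: t_def s_def)
  have ar: "100 * a = 28 + 15 * t" "100 * r = 50 * s"
    unfolding t_def s_def by (simp_all add: field_simps)
  have X: "X = 100 * (28 + 15 * t)" unfolding X_def ar[symmetric] by simp
  have Y: "Y = (28 + 15 * t) * (50 * s)" unfolding Y_def b ar[symmetric] by simp
  have Z: "Z = 10000 - X - Y" unfolding X_def Y_def Z_def m by simp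
  have "0 \<le> bicubic 79336000000000 (-63168000000000) 35280000000000 (-4802000000000) 149040000000000 (-119520000000000) 48825000000000 (-7717500000000) 2700000000000 (-43537500000000) 21937500000000 (-4134375000000) (-2531250000000) 1265625000000 3164062500000 (-738281250000) t s"
    by (rule bicubic_nonneg[OF ts]) simp_all
  also have "\<dots> = 250 * (4*X^3 + 12*X^2*Z + 12*X^2*Y + 12*X*Z^2 + 12*X*Z*Y + 1*Z^3 - (X - Y) * (12*X*Y + 6*Z^2 + 12*Z*Y)) - 423000000000000"
    unfolding Z X Y bicubic_def by algebra
  also have "\<dots> = 1000000000000 * (250 * (4*a^3 + 12*a^2*m + 12*a^2*b + 12*a*m^2 + 12*a*m*b + 1*m^3 - (a - b) * (12*a*b + 6*m^2 + 12*m*b)) - 423)"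
    unfolding X_def Y_def Z_def by algebra
  finally show "423 \<le> 250 * (4*a^3 + 12*a^2*m + 12*a^2*b + 12*a*m^2 + 12*a*m*b + 1*m^3 - (a - b) * (12*a*b + 6*m^2 + 12*m*b))" by simp
  have "0 \<le> bicubic 18856000000000 42336000000000 (-14700000000000) 1372000000000 15840000000000 36540000000000 (-15750000000000) 2205000000000 (-27675000000000) 2700000000000 (-4218750000000) 1181250000000 10125000000000 (-2531250000000) 0 210937500000 t s"
    by (rule bicubic_nonneg[OF ts]) simp_all
  also have "\<dots> = 250 * (4*X^3 + 12*X^2*Z + 12*X^2*Y + 12*X*Z^2 + 12*X*Z*Y + 1*Z^3 - (X - Y) * (12*X*Z + 12*X*Y + 3*Z^2)) - 423000000000000"
    unfolding Z X Y bicubic_def by algebra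
  also have "\<dots> = 1000000000000 * (250 * (4*a^3 + 12*a^2*m + 12*a^2*b + 12*a*m^2 + 12*a*m*b + 1*m^3 - (a - b) * (12*a*m + 12*a*b + 3*m^2)) - 423)"
    unfolding X_def Y_def Z_def by algebra
  finally show "423 \<le> 250 * (4*a^3 + 12*a^2*m + 12*a^2*b + 12*a*m^2 + 12*a*m*b + 1*m^3 - (a - b) * (12*a*m + 12*a*b + 3*m^2))" by simp
  have "0 \<le> bicubic 94792000000000 (-5040000000000) (-5880000000000) (-686000000000) (-24120000000000) 72900000000000 (-17325000000000) (-1102500000000) (-75600000000000) 52312500000000 (-13500000000000) (-590625000000) 7593750000000 6328125000000 (-3164062500000) (-105468750000) t s"
    by (rule bicubic_nonneg[OF ts]) simp_all
  also have "\<dots> = 250 * (4*X^3 + 12*X^2*Z + 12*X^2*Y + 12*X*Z^2 + 12*X*Z*Y + 1*Z^3 - (X - Y) * (6*X^2 + 12*X*Z)) - 423000000000000"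
    unfolding Z X Y bicubic_def by algebra
  also have "\<dots> = 1000000000000 * (250 * (4*a^3 + 12*a^2*m + 12*a^2*b + 12*a*m^2 + 12*a*m*b + 1*m^3 - (a - b) * (6*a^2 + 12*a*m)) - 423)"
    unfolding X_def Y_def Z_def by algebra
  finally show "423 \<le> 250 * (4*a^3 + 12*a^2*m + 12*a^2*b + 12*a*m^2 + 12*a*m*b + 1*m^3 - (a - b) * (6*a^2 + 12*a*m))" by simp
qed

lemma samuels_box3:
  fixes a b m r :: real
  assumes a: "43/100 \<le> a" "a \<le> 1/2" and r: "0 \<le> r" "r \<le> 1/2"
    and b: "b = a * r" and m: "m = 1 - a - b"
  shows "423 \<le> 250 * (4*a^3 + 12*a^2*m + 12*a^2*b + 12*a*m^2 - (a - b) * (12*a*b + 6*m^2))"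
    and "423 \<le> 250 * (4*a^3 + 12*a^2*m + 12*a^2*b + 12*a*m^2 - (a - b) * (12*a*m))"
    and "423 \<le> 250 * (4*a^3 + 12*a^2*m + 12*a^2*b + 12*a*m^2 - (a - b) * (6*a^2))"
proof -
  define t s where "t = (100 * a - 43) / 7" and "s = (100 * r) / 50"
  define X Y Z where "X = 10000 * a" and "Y = 10000 * b" and "Z = 10000 * m"
  have ts: "0 \<le> t" "t \<le> 1" "0 \<le> s" "s \<le> 1"
    using a r by (simp_all add: t_def s_def)
  have ar: "100 * a = 43 + 7 * t" "100 * r = 50 * s"
    unfolding t_def s_def by (simp_all add: field_simps)
  have X: "X = 100 * (43 + 7 * t)" unfolding X_def ar[symmetric] by simp
  have Y: "Y = (43 + 7 * t) * (50 * s)" unfolding Y_def b ar[symmetric] by simp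
  have Z: "Z = 10000 - X - Y" unfolding X_def Y_def Z_def m by simp
  have "0 \<le> bicubic 182246500000000 (-172569750000000) 10400625000000 14907562500000 85585500000000 (-98978250000000) 27654375000000 7280437500000 (-3160500000000) (-9959250000000) 8176875000000 1185187500000 (-171500000000) 257250000000 643125000000 64312500000 t s"
    by (rule bicubic_nonneg[OF ts]) simp_all
  also have "\<dots> = 250 * (4*X^3 + 12*X^2*Z + 12*X^2*Y + 12*X*Z^2 - (X - Y) * (12*X*Y + 6*Z^2)) - 423000000000000"
    unfolding Z X Y bicubic_def by algebra
  also have "\<dots> = 1000000000000 * (250 * (4*a^3 + 12*a^2*m + 12*a^2*b + 12*a*m^2 - (a - b) * (12*a*b + 6*m^2)) - 423)"
    unfolding X_def Y_def Z_def by algebra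
  finally show "423 \<le> 250 * (4*a^3 + 12*a^2*m + 12*a^2*b + 12*a*m^2 - (a - b) * (12*a*b + 6*m^2))" by simp
  have "0 \<le> bicubic 75628000000000 (-38829000000000) 0 0 4116000000000 26187000000000 0 0 (-4116000000000) 11613000000000 0 0 1372000000000 1029000000000 0 0 t s"
    by (rule bicubic_nonneg[OF ts]) simp_all
  also have "\<dots> = 250 * (4*X^3 + 12*X^2*Z + 12*X^2*Y + 12*X*Z^2 - (X - Y) * (12*X*Z)) - 423000000000000"
    unfolding Z X Y bicubic_def by algebra
  also have "\<dots> = 1000000000000 * (250 * (4*a^3 + 12*a^2*m + 12*a^2*b + 12*a*m^2 - (a - b) * (12*a*m)) - 423)"
    unfolding X_def Y_def Z_def by algebra
  finally show "423 \<le> 250 * (4*a^3 + 12*a^2*m + 12*a^2*b + 12*a*m^2 - (a - b) * (12*a*m))" by simp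
  have "0 \<le> bicubic 272546500000000 (-256548750000000) 59630250000000 0 9985500000000 (-34991250000000) 29121750000000 0 (-17860500000000) 9003750000000 4740750000000 0 (-171500000000) 1286250000000 257250000000 0 t s"
    by (rule bicubic_nonneg[OF ts]) simp_all
  also have "\<dots> = 250 * (4*X^3 + 12*X^2*Z + 12*X^2*Y + 12*X*Z^2 - (X - Y) * (6*X^2)) - 423000000000000"
    unfolding Z X Y bicubic_def by algebra
  also have "\<dots> = 1000000000000 * (250 * (4*a^3 + 12*a^2*m + 12*a^2*b + 12*a*m^2 - (a - b) * (6*a^2)) - 423)"
    unfolding X_def Y_def Z_def by algebra
  finally show "423 \<le> 250 * (4*a^3 + 12*a^2*m + 12*a^2*b + 12*a*m^2 - (a - b) * (6*a^2))" by simp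
qed

lemma samuels_box4:
  fixes a b m r :: real
  assumes a: "7/25 \<le> a" "a \<le> 1/2" and r: "1/2 \<le> r" "r \<le> 1"
    and b: "b = a * r" and m: "m = 1 - a - b"
  shows "423 \<le> 250 * (4*a^3 + 12*a^2*m + 12*a^2*b + 12*a*m^2 + 12*a*m*b + 2*m^3 - (a - b) * (12*a*b + 6*m^2 + 12*m*b))"
    and "423 \<le> 250 * (4*a^3 + 12*a^2*m + 12*a^2*b + 12*a*m^2 + 12*a*m*b + 2*m^3 - (a - b) * (12*a*m + 12*a*b + 6*m^2))"
    and "423 \<le> 250 * (4*a^3 + 12*a^2*m + 12*a^2*b + 12*a*m^2 + 12*a*m*b + 2*m^3 - (a - b) * (6*a^2 + 12*a*m))"
proof -
  define t s where "t = (100 * a - 28) / 22" and "s = (100 * r - 50) / 50"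
  define X Y Z where "X = 10000 * a" and "Y = 10000 * b" and "Z = 10000 * m"
  have ts: "0 \<le> t" "t \<le> 1" "0 \<le> s" "s \<le> 1"
    using a r by (simp_all add: t_def s_def)
  have ar: "100 * a = 28 + 22 * t" "100 * r = 50 + 50 * s"
    unfolding t_def s_def by (simp_all add: field_simps)
  have X: "X = 100 * (28 + 22 * t)" unfolding X_def ar[symmetric] by simp
  have Y: "Y = (28 + 22 * t) * (50 + 50 * s)" unfolding Y_def b ar[symmetric] by simp
  have Z: "Z = 10000 - X - Y" unfolding X_def Y_def Z_def m by simp
  have "0 \<le> bicubic 95424000000000 (-42336000000000) 29400000000000 (-5488000000000) 20328000000000 (-53592000000000) 46200000000000 (-12936000000000) (-2178000000000) (-5808000000000) 18150000000000 (-10164000000000) (-5324000000000) 7986000000000 0 (-2662000000000) t s"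
    by (rule bicubic_nonneg[OF ts]) simp_all
  also have "\<dots> = 250 * (4*X^3 + 12*X^2*Z + 12*X^2*Y + 12*X*Z^2 + 12*X*Z*Y + 2*Z^3 - (X - Y) * (12*X*Y + 6*Z^2 + 12*Z*Y)) - 423000000000000"
    unfolding Z X Y bicubic_def by algebra
  also have "\<dots> = 1000000000000 * (250 * (4*a^3 + 12*a^2*m + 12*a^2*b + 12*a*m^2 + 12*a*m*b + 2*m^3 - (a - b) * (12*a*b + 6*m^2 + 12*m*b)) - 423)"
    unfolding X_def Y_def Z_def by algebra
  finally show "423 \<le> 250 * (4*a^3 + 12*a^2*m + 12*a^2*b + 12*a*m^2 + 12*a*m*b + 2*m^3 - (a - b) * (12*a*b + 6*m^2 + 12*m*b))" by simp
  have "0 \<le> bicubic 61320000000000 34104000000000 (-21168000000000) 2744000000000 (-13860000000000) 34188000000000 (-26796000000000) 6468000000000 7260000000000 (-9438000000000) (-2904000000000) 5082000000000 6655000000000 (-11979000000000) 3993000000000 1331000000000 t s"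
    by (rule bicubic_nonneg[OF ts]) simp_all
  also have "\<dots> = 250 * (4*X^3 + 12*X^2*Z + 12*X^2*Y + 12*X*Z^2 + 12*X*Z*Y + 2*Z^3 - (X - Y) * (12*X*Z + 12*X*Y + 6*Z^2)) - 423000000000000"
    unfolding Z X Y bicubic_def by algebra
  also have "\<dots> = 1000000000000 * (250 * (4*a^3 + 12*a^2*m + 12*a^2*b + 12*a*m^2 + 12*a*m*b + 2*m^3 - (a - b) * (12*a*m + 12*a*b + 6*m^2)) - 423)"
    unfolding X_def Y_def Z_def by algebra
  finally show "423 \<le> 250 * (4*a^3 + 12*a^2*m + 12*a^2*b + 12*a*m^2 + 12*a*m*b + 2*m^3 - (a - b) * (12*a*m + 12*a*b + 6*m^2))" by simp
  have "0 \<le> bicubic 131964000000000 (-54180000000000) 588000000000 (-1372000000000) (-38742000000000) 63690000000000 (-21714000000000) (-3234000000000) (-33033000000000) 70785000000000 (-35211000000000) (-2541000000000) 24623500000000 (-9982500000000) (-13975500000000) (-665500000000) t s"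
    by (rule bicubic_nonneg[OF ts]) simp_all
  also have "\<dots> = 250 * (4*X^3 + 12*X^2*Z + 12*X^2*Y + 12*X*Z^2 + 12*X*Z*Y + 2*Z^3 - (X - Y) * (6*X^2 + 12*X*Z)) - 423000000000000"
    unfolding Z X Y bicubic_def by algebra
  also have "\<dots> = 1000000000000 * (250 * (4*a^3 + 12*a^2*m + 12*a^2*b + 12*a*m^2 + 12*a*m*b + 2*m^3 - (a - b) * (6*a^2 + 12*a*m)) - 423)"
    unfolding X_def Y_def Z_def by algebra
  finally show "423 \<le> 250 * (4*a^3 + 12*a^2*m + 12*a^2*b + 12*a*m^2 + 12*a*m*b + 2*m^3 - (a - b) * (6*a^2 + 12*a*m))" by simp
qed

text \<open>For \<open>a \<ge> 1/2\<close> the binding constraint on \<open>b\<close> is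
  \<open>b \<le> 1 - a\<close>, so the second coordinate becomes
  \<open>r = b/(1 - a)\<close>.\<close>

lemma samuels_box5:
  fixes a b m r :: real
  assumes a: "1/2 \<le> a" "a \<le> 7/10" and r: "0 \<le> r" "r \<le> 1/2"
    and b: "b = (1 - a) * r" and m: "m = 1 - a - b"
  shows "423 \<le> 250 * (4*a^3 + 12*a^2*m + 12*a^2*b + 12*a*m^2 + 1*m^3 - (a - b) * (12*a*b + 6*m^2))"
    and "423 \<le> 250 * (4*a^3 + 12*a^2*m + 12*a^2*b + 12*a*m^2 + 1*m^3 - (a - b) * (12*a*m + 3*m^2))"
    and "423 \<le> 250 * (4*a^3 + 12*a^2*m + 12*a^2*b + 12*a*m^2 + 1*m^3 - (a - b) * (6*a^2))"
proof -
  define t s where "t = (100 * a - 50) / 20" and "s = (100 * r) / 50"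
  define X Y Z where "X = 10000 * a" and "Y = 10000 * b" and "Z = 10000 * m"
  have ts: "0 \<le> t" "t \<le> 1" "0 \<le> s" "s \<le> 1"
    using a r by (simp_all add: t_def s_def)
  have ar: "100 * a = 50 + 20 * t" "100 * r = 50 * s"
    unfolding t_def s_def by (simp_all add: field_simps)
  have X: "X = 100 * (50 + 20 * t)" unfolding X_def ar[symmetric] by simp
  have Y: "Y = (100 - (50 + 20 * t)) * (50 * s)" unfolding Y_def b ar[symmetric] by (simp add: algebra_simps)
  have Z: "Z = 10000 - X - Y" unfolding X_def Y_def Z_def m by simp
  have "0 \<le> bicubic 295750000000000 (-328125000000000) 70312500000000 19531250000000 187500000000000 (-56250000000000) 28125000000000 (-23437500000000) (-15000000000000) 82500000000000 (-56250000000000) 9375000000000 (-6000000000000) (-3000000000000) 13500000000000 (-1250000000000) t s"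
    by (rule bicubic_nonneg[OF ts]) simp_all
  also have "\<dots> = 250 * (4*X^3 + 12*X^2*Z + 12*X^2*Y + 12*X*Z^2 + 1*Z^3 - (X - Y) * (12*X*Y + 6*Z^2)) - 423000000000000"
    unfolding Z X Y bicubic_def by algebra
  also have "\<dots> = 1000000000000 * (250 * (4*a^3 + 12*a^2*m + 12*a^2*b + 12*a*m^2 + 1*m^3 - (a - b) * (12*a*b + 6*m^2)) - 423)"
    unfolding X_def Y_def Z_def by algebra
  finally show "423 \<le> 250 * (4*a^3 + 12*a^2*m + 12*a^2*b + 12*a*m^2 + 1*m^3 - (a - b) * (12*a*b + 6*m^2))" by simp
  have "0 \<le> bicubic 14500000000000 93750000000000 (-46875000000000) 7812500000000 0 112500000000000 37500000000000 (-9375000000000) 30000000000000 (-15000000000000) (-7500000000000) 3750000000000 24000000000000 (-18000000000000) 0 (-500000000000) t s"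
    by (rule bicubic_nonneg[OF ts]) simp_all
  also have "\<dots> = 250 * (4*X^3 + 12*X^2*Z + 12*X^2*Y + 12*X*Z^2 + 1*Z^3 - (X - Y) * (12*X*Z + 3*Z^2)) - 423000000000000"
    unfolding Z X Y bicubic_def by algebra
  also have "\<dots> = 1000000000000 * (250 * (4*a^3 + 12*a^2*m + 12*a^2*b + 12*a*m^2 + 1*m^3 - (a - b) * (12*a*m + 3*m^2)) - 423)"
    unfolding X_def Y_def Z_def by algebra
  finally show "423 \<le> 250 * (4*a^3 + 12*a^2*m + 12*a^2*b + 12*a*m^2 + 1*m^3 - (a - b) * (12*a*m + 3*m^2))" by simp
  have "0 \<le> bicubic 295750000000000 (-328125000000000) 117187500000000 (-3906250000000) (-112500000000000) 243750000000000 (-65625000000000) 4687500000000 (-135000000000000) 22500000000000 (-3750000000000) (-1875000000000) (-6000000000000) (-27000000000000) 4500000000000 250000000000 t s"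
    by (rule bicubic_nonneg[OF ts]) simp_all
  also have "\<dots> = 250 * (4*X^3 + 12*X^2*Z + 12*X^2*Y + 12*X*Z^2 + 1*Z^3 - (X - Y) * (6*X^2)) - 423000000000000"
    unfolding Z X Y bicubic_def by algebra
  also have "\<dots> = 1000000000000 * (250 * (4*a^3 + 12*a^2*m + 12*a^2*b + 12*a*m^2 + 1*m^3 - (a - b) * (6*a^2)) - 423)"
    unfolding X_def Y_def Z_def by algebra
  finally show "423 \<le> 250 * (4*a^3 + 12*a^2*m + 12*a^2*b + 12*a*m^2 + 1*m^3 - (a - b) * (6*a^2))" by simp
qed

lemma samuels_box6:
  fixes a b m r :: real
  assumes a: "1/2 \<le> a" "a \<le> 7/10" and r: "1/2 \<le> r" "r \<le> 1"
    and b: "b = (1 - a) * r" and m: "m = 1 - a - b"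
  shows "423 \<le> 250 * (4*a^3 + 12*a^2*m + 12*a^2*b + 12*a*m^2 - (a - b) * (12*a*b + 6*m^2))"
    and "423 \<le> 250 * (4*a^3 + 12*a^2*m + 12*a^2*b + 12*a*m^2 - (a - b) * (12*a*m))"
    and "423 \<le> 250 * (4*a^3 + 12*a^2*m + 12*a^2*b + 12*a*m^2 - (a - b) * (6*a^2))"
proof -
  define t s where "t = (100 * a - 50) / 20" and "s = (100 * r - 50) / 50"
  define X Y Z where "X = 10000 * a" and "Y = 10000 * b" and "Z = 10000 * m"
  have ts: "0 \<le> t" "t \<le> 1" "0 \<le> s" "s \<le> 1"
    using a r by (simp_all add: t_def s_def)
  have ar: "100 * a = 50 + 20 * t" "100 * r = 50 + 50 * s"
    unfolding t_def s_def by (simp_all add: field_simps)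
  have X: "X = 100 * (50 + 20 * t)" unfolding X_def ar[symmetric] by simp
  have Y: "Y = (100 - (50 + 20 * t)) * (50 + 50 * s)" unfolding Y_def b ar[symmetric] by (simp add: algebra_simps)
  have Z: "Z = 10000 - X - Y" unfolding X_def Y_def Z_def m by simp
  have "0 \<le> bicubic 53562500000000 (-117187500000000) 117187500000000 23437500000000 140625000000000 (-84375000000000) (-28125000000000) (-28125000000000) 18750000000000 3750000000000 (-33750000000000) 11250000000000 3500000000000 19500000000000 10500000000000 (-1500000000000) t s"
    by (rule bicubic_nonneg[OF ts]) simp_all
  also have "\<dots> = 250 * (4*X^3 + 12*X^2*Z + 12*X^2*Y + 12*X*Z^2 - (X - Y) * (12*X*Y + 6*Z^2)) - 423000000000000"
    unfolding Z X Y bicubic_def by algebra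
  also have "\<dots> = 1000000000000 * (250 * (4*a^3 + 12*a^2*m + 12*a^2*b + 12*a*m^2 - (a - b) * (12*a*b + 6*m^2)) - 423)"
    unfolding X_def Y_def Z_def by algebra
  finally show "423 \<le> 250 * (4*a^3 + 12*a^2*m + 12*a^2*b + 12*a*m^2 - (a - b) * (12*a*b + 6*m^2))" by simp
  have "0 \<le> bicubic 77000000000000 0 0 0 150000000000000 150000000000000 0 0 0 0 0 0 8000000000000 (-24000000000000) 0 0 t s"
    by (rule bicubic_nonneg[OF ts]) simp_all
  also have "\<dots> = 250 * (4*X^3 + 12*X^2*Z + 12*X^2*Y + 12*X*Z^2 - (X - Y) * (12*X*Z)) - 423000000000000"
    unfolding Z X Y bicubic_def by algebra
  also have "\<dots> = 1000000000000 * (250 * (4*a^3 + 12*a^2*m + 12*a^2*b + 12*a*m^2 - (a - b) * (12*a*m)) - 423)"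
    unfolding X_def Y_def Z_def by algebra
  finally show "423 \<le> 250 * (4*a^3 + 12*a^2*m + 12*a^2*b + 12*a*m^2 - (a - b) * (12*a*m))" by simp
  have "0 \<le> bicubic 77000000000000 (-93750000000000) 93750000000000 0 75000000000000 112500000000000 (-37500000000000) 0 (-120000000000000) 15000000000000 (-15000000000000) 0 (-28000000000000) (-18000000000000) 6000000000000 0 t s"
    by (rule bicubic_nonneg[OF ts]) simp_all
  also have "\<dots> = 250 * (4*X^3 + 12*X^2*Z + 12*X^2*Y + 12*X*Z^2 - (X - Y) * (6*X^2)) - 423000000000000"
    unfolding Z X Y bicubic_def by algebra
  also have "\<dots> = 1000000000000 * (250 * (4*a^3 + 12*a^2*m + 12*a^2*b + 12*a*m^2 - (a - b) * (6*a^2)) - 423)"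
    unfolding X_def Y_def Z_def by algebra
  finally show "423 \<le> 250 * (4*a^3 + 12*a^2*m + 12*a^2*b + 12*a*m^2 - (a - b) * (6*a^2))" by simp
qed

text \<open>A linear function with nonnegative slopes on the simplex
  \<open>S + P + Q \<le> R\<close> is largest where a single variable equals \<open>R\<close>. This
  reduces the unknown excesses to the three conclusions of each box lemma.\<close>

lemma convex_comb_ge:
  fixes c :: real
  assumes "c \<le> B - R * u" "c \<le> B - R * v" "c \<le> B - R * w"
    and "0 \<le> S" "0 \<le> P" "0 \<le> Q" "S + P + Q \<le> R" "0 \<le> u" "0 \<le> v" "0 \<le> w"
  shows "c \<le> B - (S * u + P * v + Q * w)"
proof -
  define z where "z = max u (max v w)"
  have "S * u + P * v + Q * w \<le> S * z + P * z + Q * z"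
    unfolding z_def by (intro add_mono mult_left_mono) (use assms in auto)
  also have "\<dots> = (S + P + Q) * z" by (simp add: algebra_simps)
  also have "\<dots> \<le> R * z" using assms by (intro mult_right_mono) (auto simp: z_def)
  finally show ?thesis using assms by (auto simp: z_def max_def split: if_splits)
qed

text \<open>Here a, m, b are the densities of the vertices of weight below 1/4, between 1/4 and 1/2, and above 1/2; S, P, Q are
  the excesses of their total weights over the minimal ones; t1, ..., t4 are the densities of the light triples of
  the types aab, amm, amb, mmm.\<close>

lemma samuels_polynomial:
  fixes a m b S P Q :: real
  assumes nn: "0 \<le> a" "0 \<le> m" "0 \<le> b" "0 \<le> S" "0 \<le> P" "0 \<le> Q"
    and sum: "a + m + b = 1" and ex: "S + P + Q \<le> (a - b)/4" and a7: "a \<le> 7/10"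
    and t1: "3*a^2*b - 12*a*b*S - 6*a^2*Q \<le> t1"
    and t2: "3*a*m^2 - 6*m^2*S - 12*a*m*P \<le> t2"
    and t3: "0 \<le> t3" "6*a*m*b - 24*m*b*S - 24*a*b*P - 24*a*m*Q \<le> t3"
    and t4: "0 \<le> t4" "m^3 - 12*m^2*P \<le> t4"
  shows "423/1000 \<le> a^3 + 3*a^2*m + t1 + t2 + t3 + t4"
proof -
  have mab: "m = 1 - a - b" and ba: "b \<le> a" "b \<le> 1 - a" using nn sum ex by simp_all
  \<comment> \<open>\<open>t3\<close> and \<open>t4\<close> are bounded below both by 0 and by a
    Markov bound that may be negative, so any fraction of the Markov bound is valid as well. With
    everything multiplied by 4, \<open>k3/24\<close> and \<open>k4/4\<close> are these fractions;
    each box gets a fixed choice, 0 dropping the term.\<close>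
  have red: "423/1000 \<le> a^3 + 3*a^2*m + t1 + t2 + t3 + t4"
    if l: "0 \<le> k3" "k3 \<le> 24" "0 \<le> k4" "k4 \<le> 4"
    and "423 \<le> 250 * (4*a^3 + 12*a^2*m + 12*a^2*b + 12*a*m^2 + k3*a*m*b + k4*m^3 - (a - b) * (12*a*b + 6*m^2 + k3*m*b))"
        "423 \<le> 250 * (4*a^3 + 12*a^2*m + 12*a^2*b + 12*a*m^2 + k3*a*m*b + k4*m^3 - (a - b) * (12*a*m + k3*a*b + 3*k4*m^2))"
        "423 \<le> 250 * (4*a^3 + 12*a^2*m + 12*a^2*b + 12*a*m^2 + k3*a*m*b + k4*m^3 - (a - b) * (6*a^2 + k3*a*m))" for k3 k4
  proof -
    define B where "B = 4*a^3 + 12*a^2*m + 12*a^2*b + 12*a*m^2 + k3*a*m*b + k4*m^3"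
    have "423/250 \<le> B - ((4*S) * (12*a*b + 6*m^2 + k3*m*b)
        + (4*P) * (12*a*m + k3*a*b + 3*k4*m^2) + (4*Q) * (6*a^2 + k3*a*m))"
      by (rule convex_comb_ge[where R = "a - b"]) (use that nn ex in \<open>simp_all add: B_def\<close>)
    also have "\<dots> = 4*(a^3 + 3*a^2*m) + 4*(3*a^2*b - 12*a*b*S - 6*a^2*Q) + 4*(3*a*m^2 - 6*m^2*S - 12*a*m*P)
        + k3*(a*m*b - 4*m*b*S - 4*a*b*P - 4*a*m*Q) + k4*(m^3 - 12*m^2*P)"
      unfolding B_def by algebra
    also have "\<dots> \<le> 4*(a^3 + 3*a^2*m) + 4*t1 + 4*t2 + k3*(t3/6) + k4*t4"
      by (intro add_mono mult_left_mono t1 t2 t4 l order.refl) (use t3 in auto)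
    also have "\<dots> \<le> 4*(a^3 + 3*a^2*m) + 4*t1 + 4*t2 + 24*(t3/6) + 4*t4"
      by (intro add_mono mult_right_mono t4 l order.refl) (use t3 in auto)
    finally show ?thesis by simp
  qed
  show ?thesis
  proof (cases "a \<le> 1/2")
    case True
    \<comment> \<open>The value 0 at \<open>a = 0\<close> is consistent, because
      \<open>b \<le> a\<close> forces \<open>b = 0\<close> there.\<close>
    define r where "r = (if a = 0 then 0 else b / a)"
    have r: "b = a*r" "0 \<le> r" "r \<le> 1" using nn ba by (auto simp: r_def)
    consider "a \<le> 7/25" | "7/25 \<le> a" "1/2 \<le> r" | "7/25 \<le> a" "a \<le> 43/100" "r \<le> 1/2" | "43/100 \<le> a" "r \<le> 1/2"
      by linarith
    then show ?thesis
    proof cases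
      case 1 show ?thesis
        by (rule red[of 12 2])
          (use samuels_box1[OF nn(1) 1 r(2,3,1) mab] in simp_all)
    next
      case 2 show ?thesis
        by (rule red[of 12 2])
          (use samuels_box4[OF 2(1) True 2(2) r(3,1) mab] in simp_all)
    next
      case 3 show ?thesis
        by (rule red[of 12 1])
          (use samuels_box2[OF 3(1,2) r(2) 3(3) r(1) mab] in simp_all)
    next
      case 4 show ?thesis
        by (rule red[of 0 0])
          (use samuels_box3[OF 4(1) True r(2) 4(2) r(1) mab] in simp_all)
    qed
  next
    case False
    then have a5: "1/2 \<le> a" by simp
    define r where "r = b / (1 - a)"
    have r: "b = (1 - a)*r" "0 \<le> r" "r \<le> 1" using nn ba a7 by (auto simp: r_def divide_simps)
    show ?thesis
    proof (cases "r \<le> 1/2")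
      case True show ?thesis
        by (rule red[of 0 1])
          (use samuels_box5[OF a5 a7 r(2) True r(1) mab] in simp_all)
    next
      case False
      then have "1/2 \<le> r" by simp
      then show ?thesis
        by (intro red[of 0 0])
          (use samuels_box6[OF a5 a7 _ r(3,1) mab] in simp_all)
    qed
  qed
qed

section \<open>Counting light ordered triples by weight class\<close>

definition light_triples :: "('a \<Rightarrow> real) \<Rightarrow> 'a set \<Rightarrow> 'a set \<Rightarrow> 'a set \<Rightarrow> real" where
  "light_triples x A B C = (\<Sum>u\<in>A. \<Sum>v\<in>B. \<Sum>w\<in>C. of_bool (x u + x v + x w < 1))"

lemma light_triples_nonneg: "0 \<le> light_triples x A B C"
  unfolding light_triples_def by (intro sum_nonneg) auto

lemma light_triples_swap12: "light_triples x A B C = light_triples x B A C"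
  unfolding light_triples_def by (subst sum.swap) (simp add: add.commute)

lemma light_triples_swap23: "light_triples x A B C = light_triples x A C B"
  unfolding light_triples_def by (subst sum.swap) (simp add: add.assoc add.commute add.left_commute)

lemma light_triples_perm:
  "light_triples x A C B = light_triples x A B C" "light_triples x B A C = light_triples x A B C"
  "light_triples x B C A = light_triples x A B C" "light_triples x C A B = light_triples x A B C"
  "light_triples x C B A = light_triples x A B C"
proof -
  show 1: "light_triples x A C B = light_triples x A B C" by (rule light_triples_swap23)
  show 2: "light_triples x B A C = light_triples x A B C" by (rule light_triples_swap12)
  show 3: "light_triples x B C A = light_triples x A B C"
    unfolding light_triples_swap23[of x B C A] by (rule 2)
  show 4: "light_triples x C A B = light_triples x A B C"
    unfolding light_triples_swap12[of x C A B] by (rule 1)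
  show "light_triples x C B A = light_triples x A B C"
    unfolding light_triples_swap12[of x C B A] by (rule 3)
qed

lemma light_triples_Un:
  assumes "finite A" "finite A'" "A \<inter> A' = {}"
  shows "light_triples x (A \<union> A') B C = light_triples x A B C + light_triples x A' B C"
  unfolding light_triples_def using assms by (rule sum.union_disjoint)

lemma light_triples_all:
  assumes "\<And>u v w. u \<in> A \<Longrightarrow> v \<in> B \<Longrightarrow> w \<in> C \<Longrightarrow> x u + x v + x w < 1"
  shows "light_triples x A B C = real (card A) * card B * card C"
proof -
  have "light_triples x A B C = (\<Sum>u\<in>A. \<Sum>v\<in>B. \<Sum>w\<in>C. 1)"
    unfolding light_triples_def using assms by (intro sum.cong) auto
  then show ?thesis by simp
qed

lemma triple_sum_distrib:
  fixes f g h :: "'a \<Rightarrow> real"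
  shows "(\<Sum>u\<in>A. \<Sum>v\<in>B. \<Sum>w\<in>C. f u + g v + h w)
    = real (card B) * card C * sum f A + real (card A) * card C * sum g B + real (card A) * card B * sum h C"
proof -
  have "(\<Sum>u\<in>A. \<Sum>v\<in>B. \<Sum>w\<in>C. f u + g v + h w)
    = (\<Sum>u\<in>A. \<Sum>v\<in>B. real (card C) * f u + real (card C) * g v + sum h C)"
    by (simp add: sum.distrib algebra_simps)
  also have "\<dots> = (\<Sum>u\<in>A. (real (card B) * card C) * f u + (real (card C) * sum g B + card B * sum h C))"
    by (simp only: sum.distrib sum_distrib_left[symmetric] sum_constant) (simp add: algebra_simps)
  also have "\<dots> = real (card B) * card C * sum f A + real (card A) * card C * sum g B + real (card A) * card B * sum h C"
    by (simp only: sum.distrib sum_distrib_left[symmetric] sum_constant) (simp add: algebra_simps)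
  finally show ?thesis .
qed

text \<open>Markov's inequality for the excess of the three weights over the lower bounds p, q, r.\<close>

lemma light_triples_ge:
  assumes "\<And>u. u \<in> A \<Longrightarrow> p \<le> x u" "\<And>v. v \<in> B \<Longrightarrow> q \<le> x v" "\<And>w. w \<in> C \<Longrightarrow> r \<le> x w"
    and l: "l = 1 - p - q - r" "0 < l"
  shows "real (card A) * card B * card C
    - (real (card B) * card C * (\<Sum>u\<in>A. x u - p) + real (card A) * card C * (\<Sum>v\<in>B. x v - q)
       + real (card A) * card B * (\<Sum>w\<in>C. x w - r)) / l \<le> light_triples x A B C"
proof -
  have "(\<Sum>u\<in>A. \<Sum>v\<in>B. \<Sum>w\<in>C. 1 - ((x u - p) + (x v - q) + (x w - r)) / l) \<le> light_triples x A B C"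
    unfolding light_triples_def
  proof (intro sum_mono)
    fix u v w assume "u \<in> A" "v \<in> B" "w \<in> C"
    then have "p \<le> x u" "q \<le> x v" "r \<le> x w" using assms by auto
    then show "1 - ((x u - p) + (x v - q) + (x w - r)) / l \<le> of_bool (x u + x v + x w < 1)"
      using l by (auto simp: divide_simps)
  qed
  also have "(\<Sum>u\<in>A. \<Sum>v\<in>B. \<Sum>w\<in>C. 1 - ((x u - p) + (x v - q) + (x w - r)) / l)
    = real (card A) * card B * card C
    - (real (card B) * card C * (\<Sum>u\<in>A. x u - p) + real (card A) * card C * (\<Sum>v\<in>B. x v - q)
       + real (card A) * card B * (\<Sum>w\<in>C. x w - r)) / l"
    by (simp only: sum_subtractf sum_divide_distrib[symmetric] triple_sum_distrib) simp
  finally show ?thesis .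
qed

text \<open>Only triples with at least two vertices below 1/4 are counted. The total excess is at
  most \<open>a*n/4\<close>, and for \<open>a \<ge> 2/3\<close> it hurts most when it lies on the
  vertices of weight at least 1/4. That leaves \<open>a^2*(1-a) - a^3/3\<close> for each of the
  three positions of such a vertex, and the three losses cancel exactly the \<open>a^3\<close> of
  the triples inside \<open>s\<close>. At \<open>a = 3/4\<close> the bound is 27/64.\<close>

lemma samuels_heavy:
  assumes V: "finite V" "V \<noteq> {}" and x0: "\<And>v. v \<in> V \<Longrightarrow> 0 \<le> x v"
    and sx: "(\<Sum>v\<in>V. x v) \<le> real (card V) / 4"
    and a: "a = card {v\<in>V. x v < 1/4} / real (card V)" "2/3 \<le> a"
  shows "3*a^2*(1-a) * real (card V)^3 \<le> light_triples x V V V"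
proof -
  define s L n where "s = {v\<in>V. x v < 1/4}" and "L = {v\<in>V. 1/4 \<le> x v}" and "n = real (card V)"
  have n0: "n > 0" using V by (simp add: n_def card_gt_0_iff)
  have fin: "finite s" "finite L" and VU: "V = s \<union> L" and disj: "s \<inter> L = {}"
    using V by (auto simp: s_def L_def)
  have cs: "real (card s) = a * n" using a n0 by (simp add: s_def n_def)
  have "n = real (card s) + card L"
    unfolding n_def using VU card_Un_disjoint[OF fin disj] by simp
  then have cL: "real (card L) = (1 - a) * n" using cs by (simp add: algebra_simps)
  have a1: "0 \<le> a" "0 \<le> 1 - a" using a n0
    using of_nat_0_le_iff[of "card L", where 'a = real] unfolding cL by (auto simp: zero_le_mult_iff)
  define S Q where "S = (\<Sum>v\<in>s. x v - 0) / n" and "Q = (\<Sum>v\<in>L. x v - 1/4) / n"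
  have S0: "0 \<le> S" "0 \<le> Q" unfolding S_def Q_def
    using n0 x0 by (auto intro!: sum_nonneg divide_nonneg_nonneg simp: s_def L_def)
  have "(\<Sum>v\<in>V. x v) = (\<Sum>v\<in>s. x v) + (\<Sum>v\<in>L. x v)"
    unfolding VU using fin disj by (rule sum.union_disjoint)
  also have "\<dots> = n * S + (n * Q + card L / 4)"
    using n0 by (simp add: S_def Q_def sum_subtractf)
  finally have "n * (S + Q) \<le> n * (a / 4)" using sx unfolding cL n_def[symmetric] by (simp add: field_simps)
  then have SQ: "S + Q \<le> a/4" using n0 by simp
  have Nsss: "light_triples x s s s = a^3 * n^3"
  proof -
    have "light_triples x s s s = real (card s) * card s * card s"
      by (rule light_triples_all) (auto simp: s_def)
    then show ?thesis by (simp add: cs power3_eq_cube algebra_simps)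
  qed
  have "real (card s) * card s * card L
    - (real (card s) * card L * (\<Sum>u\<in>s. x u - 0) + real (card s) * card L * (\<Sum>v\<in>s. x v - 0)
       + real (card s) * card s * (\<Sum>w\<in>L. x w - 1/4)) / (3/4) \<le> light_triples x s s L"
    by (rule light_triples_ge) (use x0 in \<open>auto simp: s_def L_def\<close>)
  also have "real (card s) * card s * card L
    - (real (card s) * card L * (\<Sum>u\<in>s. x u - 0) + real (card s) * card L * (\<Sum>v\<in>s. x v - 0)
       + real (card s) * card s * (\<Sum>w\<in>L. x w - 1/4)) / (3/4)
     = n^3 * (a^2*(1-a) - 4/3 * (2*a*(1-a)*S + a^2*Q))"
  proof -
    have "(\<Sum>v\<in>s. x v - 0) = n * S" "(\<Sum>v\<in>L. x v - 1/4) = n * Q"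
      using n0 by (simp_all add: S_def Q_def)
    then show ?thesis unfolding cs cL by (simp add: power2_eq_square power3_eq_cube field_simps)
  qed
  finally have NssL: "n^3 * (a^2*(1-a) - 4/3 * (2*a*(1-a)*S + a^2*Q)) \<le> light_triples x s s L" .
  have "2*a*(1-a)*S \<le> a^2*S"
  proof -
    have "2*(1-a) \<le> a" using a(2) by (simp add: field_simps)
    then have "a * (2*(1-a)) \<le> a * a" using a1(1) by (rule mult_left_mono)
    then show ?thesis using S0 by (intro mult_right_mono) (auto simp: power2_eq_square algebra_simps)
  qed
  then have "2*a*(1-a)*S + a^2*Q \<le> a^2*(S+Q)" by (simp add: algebra_simps)
  also have "\<dots> \<le> a^2*(a/4)" by (intro mult_left_mono SQ) simp
  finally have "a^2*(1-a) - a^3/3 \<le> a^2*(1-a) - 4/3 * (2*a*(1-a)*S + a^2*Q)"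
    by (simp add: power2_eq_square power3_eq_cube)
  then have "n^3*(a^2*(1-a) - a^3/3) \<le> n^3*(a^2*(1-a) - 4/3 * (2*a*(1-a)*S + a^2*Q))"
    using n0 by (intro mult_left_mono) auto
  with NssL have ssL: "n^3*(a^2*(1-a) - a^3/3) \<le> light_triples x s s L" by linarith
  let ?N = "light_triples x"
  have add1: "?N V B C = ?N s B C + ?N L B C" for B C
    unfolding VU by (rule light_triples_Un) (use fin disj in auto)
  have add2: "?N B V C = ?N B s C + ?N B L C" for B C
    using add1[of B C] by (simp only: light_triples_perm(2)[of x B])
  have add3: "?N B C V = ?N B C s + ?N B C L" for B C
    using add2[of B C] by (simp only: light_triples_perm(1)[of x B C])
  have sym: "?N s s L = ?N s L s" "?N s s L = ?N L s s"
    by (rule light_triples_perm[symmetric])+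
  have "?N V V V \<ge> ?N s s s + 3 * ?N s s L"
    unfolding add1 add2 add3 using sym
      light_triples_nonneg[of x s L L] light_triples_nonneg[of x L s L] light_triples_nonneg[of x L L s]
      light_triples_nonneg[of x L L L] by linarith
  moreover have "3*a^2*(1-a) * n^3 = a^3*n^3 + 3 * (n^3*(a^2*(1-a) - a^3/3))" by algebra
  ultimately show ?thesis using ssL Nsss unfolding n_def by linarith
qed

text \<open>Cutting the weights at 1/4 and 1/2 makes the types \<open>sss\<close> and
  \<open>ssM\<close> light outright, leaves room 1/2 for Markov's inequality in \<open>ssB\<close>
  and \<open>sMM\<close> and room 1/4 in \<open>sMB\<close> and \<open>MMM\<close>; all other types
  are bounded below by 0. The condition on the mean becomes
  \<open>S + P + Q \<le> (a - b)/4\<close>, and the factors 3 and 6 count the orders of a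
  type.\<close>

lemma samuels_light:
  assumes V: "finite V" "V \<noteq> {}" and x0: "\<And>v. v \<in> V \<Longrightarrow> 0 \<le> x v"
    and sx: "(\<Sum>v\<in>V. x v) \<le> real (card V) / 4"
    and a: "a = card {v\<in>V. x v < 1/4} / real (card V)" "a \<le> 7/10"
  shows "423/1000 * real (card V)^3 \<le> light_triples x V V V"
proof -
  define s M B n where "s = {v\<in>V. x v < 1/4}" and "M = {v\<in>V. 1/4 \<le> x v \<and> x v \<le> 1/2}"
    and "B = {v\<in>V. 1/2 < x v}" and "n = real (card V)"
  have n0: "n > 0" using V by (simp add: n_def card_gt_0_iff)
  have fin: "finite s" "finite M" "finite B" and VU: "V = s \<union> (M \<union> B)"
    and disj: "s \<inter> (M \<union> B) = {}" "M \<inter> B = {}"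
    using V by (auto simp: s_def M_def B_def)
  define m b where "m = card M / n" and "b = card B / n"
  have cs: "real (card s) = a * n" using a n0 by (simp add: s_def n_def)
  have cm: "real (card M) = m * n" and cb: "real (card B) = b * n" using n0 by (simp_all add: m_def b_def)
  have nn: "0 \<le> a" "0 \<le> m" "0 \<le> b" using n0 a by (simp_all add: m_def b_def)
  have "n = real (card s) + (card M + card B)"
    unfolding n_def VU using fin disj by (simp add: card_Un_disjoint)
  then have "n * 1 = n * (a + m + b)" using cs cm cb by (simp add: algebra_simps)
  then have amb: "a + m + b = 1" using n0 by simp
  define S P Q where "S = (\<Sum>v\<in>s. x v - 0) / n" and "P = (\<Sum>v\<in>M. x v - 1/4) / n" and "Q = (\<Sum>v\<in>B. x v - 1/2) / n"
  have S0: "0 \<le> S" "0 \<le> P" "0 \<le> Q" unfolding S_def P_def Q_def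
    using n0 x0 by (auto intro!: sum_nonneg divide_nonneg_nonneg simp: s_def M_def B_def)
  have sums: "(\<Sum>v\<in>s. x v - 0) = n * S" "(\<Sum>v\<in>M. x v - 1/4) = n * P" "(\<Sum>v\<in>B. x v - 1/2) = n * Q"
    using n0 by (simp_all add: S_def P_def Q_def)
  have "(\<Sum>v\<in>V. x v) = (\<Sum>v\<in>s. x v) + ((\<Sum>v\<in>M. x v) + (\<Sum>v\<in>B. x v))"
    unfolding VU using fin disj by (simp add: sum.union_disjoint)
  also have "\<dots> = n * S + ((n * P + card M / 4) + (n * Q + card B / 2))"
    using n0 by (simp add: S_def P_def Q_def sum_subtractf)
  finally have "n * (S + P + Q + m / 4 + b / 2) \<le> n * (1 / 4)" using sx unfolding cm cb n_def[symmetric] by (simp add: algebra_simps)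
  then have "S + P + Q + m / 4 + b / 2 \<le> 1 / 4" using n0 by simp
  then have ex: "S + P + Q \<le> (a - b) / 4" using amb by simp
  let ?N = "light_triples x"
  have Nsss: "?N s s s = n^3 * a^3"
  proof -
    have "light_triples x s s s = real (card s) * card s * card s"
      by (rule light_triples_all) (auto simp: s_def)
    then show ?thesis by (simp add: cs power3_eq_cube algebra_simps)
  qed
  \<comment> \<open>The class \<open>M\<close> includes weight exactly 1/2, but weights in
    \<open>s\<close> are strictly below 1/4, so the sum stays below 1.\<close>
  have NssM: "?N s s M = n^3 * (a^2*m)"
  proof -
    have "?N s s M = real (card s) * card s * card M"
      by (rule light_triples_all) (auto simp: s_def M_def)
    then show ?thesis by (simp add: cs cm power3_eq_cube power2_eq_square algebra_simps)
  qed
  have NssB: "n^3 * (3*a^2*b - 12*a*b*S - 6*a^2*Q) \<le> 3 * ?N s s B"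
  proof -
    have "real (card s) * card s * card B - (real (card s) * card B * (n * S) + real (card s) * card B * (n * S)
       + real (card s) * card s * (n * Q)) / (1/2) \<le> ?N s s B"
      unfolding sums[symmetric] by (rule light_triples_ge) (use x0 in \<open>auto simp: s_def B_def\<close>)
    then show ?thesis unfolding cs cb by (simp add: power3_eq_cube power2_eq_square algebra_simps)
  qed
  have NsMM: "n^3 * (3*a*m^2 - 6*m^2*S - 12*a*m*P) \<le> 3 * ?N s M M"
  proof -
    have "real (card s) * card M * card M - (real (card M) * card M * (n * S) + real (card s) * card M * (n * P)
       + real (card s) * card M * (n * P)) / (1/2) \<le> ?N s M M"
      unfolding sums[symmetric] by (rule light_triples_ge) (use x0 in \<open>auto simp: s_def M_def\<close>)
    then show ?thesis unfolding cs cm by (simp add: power3_eq_cube power2_eq_square algebra_simps)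
  qed
  have NsMB: "n^3 * (6*a*m*b - 24*m*b*S - 24*a*b*P - 24*a*m*Q) \<le> 6 * ?N s M B"
  proof -
    have "real (card s) * card M * card B - (real (card M) * card B * (n * S) + real (card s) * card B * (n * P)
       + real (card s) * card M * (n * Q)) / (1/4) \<le> ?N s M B"
      unfolding sums[symmetric] by (rule light_triples_ge) (use x0 in \<open>auto simp: s_def M_def B_def\<close>)
    then show ?thesis unfolding cs cm cb by (simp add: power3_eq_cube power2_eq_square algebra_simps)
  qed
  have NMMM: "n^3 * (m^3 - 12*m^2*P) \<le> ?N M M M"
  proof -
    have "real (card M) * card M * card M - (real (card M) * card M * (n * P) + real (card M) * card M * (n * P)
       + real (card M) * card M * (n * P)) / (1/4) \<le> ?N M M M"
      unfolding sums[symmetric] by (rule light_triples_ge) (use x0 in \<open>auto simp: s_def M_def B_def\<close>)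
    then show ?thesis unfolding cm by (simp add: power3_eq_cube power2_eq_square algebra_simps)
  qed
  have n3: "n^3 > 0" using n0 by simp
  have divI: "y \<le> z / n^3" if "n^3 * y \<le> z" for y z
    using that n3 by (simp add: pos_le_divide_eq mult.commute)
  have c: "z / n^3 * n^3 = z" for z using n3 by simp
  have "423/1000 \<le> a^3 + 3*a^2*m + 3 * ?N s s B / n^3 + 3 * ?N s M M / n^3 + 6 * ?N s M B / n^3 + ?N M M M / n^3"
    by (rule samuels_polynomial[OF nn S0 amb ex a(2) divI[OF NssB] divI[OF NsMM] _ divI[OF NsMB] _ divI[OF NMMM]])
      (use n3 light_triples_nonneg[of x] in \<open>simp_all add: less_imp_le\<close>)
  then have "423/1000 * n^3 \<le> (a^3 + 3*a^2*m + 3 * ?N s s B / n^3 + 3 * ?N s M M / n^3 + 6 * ?N s M B / n^3 + ?N M M M / n^3) * n^3"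
    using n3 by (intro mult_right_mono) auto
  also have "\<dots> = ?N s s s + 3 * ?N s s M + 3 * ?N s s B + 3 * ?N s M M + 6 * ?N s M B + ?N M M M"
    unfolding Nsss NssM by (simp only: distrib_right c) simp
  also have "\<dots> \<le> ?N V V V"
  proof -
    have add1: "?N V Y C = ?N s Y C + (?N M Y C + ?N B Y C)" for Y C
      unfolding VU using fin disj by (simp add: light_triples_Un)
    have add2: "?N Y V C = ?N Y s C + (?N Y M C + ?N Y B C)" for Y C
      using add1[of Y C] by (simp only: light_triples_perm(2)[of x Y])
    have add3: "?N Y C V = ?N Y C s + (?N Y C M + ?N Y C B)" for Y C
      using add2[of Y C] by (simp only: light_triples_perm(1)[of x Y C])
    have s: "?N s M s = ?N s s M" "?N M s s = ?N s s M" "?N s B s = ?N s s B" "?N B s s = ?N s s B"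
      "?N M s M = ?N s M M" "?N M M s = ?N s M M" "?N s B M = ?N s M B" "?N M s B = ?N s M B"
      "?N M B s = ?N s M B" "?N B s M = ?N s M B" "?N B M s = ?N s M B"
      by (rule light_triples_perm)+
    note nn = light_triples_nonneg[of x]
    show ?thesis unfolding add1 add2 add3 s
      using nn[of s B B] nn[of B s B] nn[of B B s] nn[of M M B] nn[of M B M] nn[of B M M]
        nn[of M B B] nn[of B M B] nn[of B B M] nn[of B B B] by linarith
  qed
  finally show ?thesis by (simp add: n_def)
qed

text \<open>The bound 27/64 is attained by weight 1 on a quarter of the vertices and 0 elsewhere,
  where the vertices below 1/4 have density 3/4. If this density \<open>a\<close> is smaller by
  \<eta>, there is a gain: up to 7/10 the fixed margin between 423/1000 and 27/64, above 7/10 the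
  negative slope of \<open>3*a^2*(1-a)\<close> at 3/4.\<close>

lemma samuels_stability:
  fixes \<eta> :: real
  assumes "\<eta> > 0"
  shows "\<exists>g>0. \<forall>(V :: 'a set) x. finite V \<and> V \<noteq> {} \<and> (\<forall>v\<in>V. 0 \<le> x v) \<and> (\<Sum>v\<in>V. x v) \<le> real (card V) / 4
     \<and> real (card {v\<in>V. x v < 1/4}) \<le> (3/4 - \<eta>) * card V
     \<longrightarrow> (27/64 + g) * real (card V)^3 \<le> light_triples x V V V"
proof -
  define g where "g = min (1/1000) (\<eta> * 3 / 8)"
  have "(27/64 + g) * real (card V)^3 \<le> light_triples x V V V"
    if *: "finite V" "V \<noteq> {}" "\<And>v. v\<in>V \<Longrightarrow> 0 \<le> x v" "(\<Sum>v\<in>V. x v) \<le> real (card V) / 4"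
      and small: "real (card {v\<in>V. x v < 1/4}) \<le> (3/4 - \<eta>) * card V" for V :: "'a set" and x
  proof -
    define a where "a = card {v\<in>V. x v < 1/4} / real (card V)"
    have n: "real (card V) > 0" using * by (simp add: card_gt_0_iff)
    have a: "a \<le> 3/4 - \<eta>" using small n by (simp add: a_def pos_divide_le_eq)
    show ?thesis
    proof (cases "a \<le> 7/10")
      case True
      have "(27/64 + g) * real (card V)^3 \<le> 423/1000 * real (card V)^3"
        by (intro mult_right_mono) (auto simp: g_def)
      also have "\<dots> \<le> light_triples x V V V" by (rule samuels_light[OF * a_def True])
      finally show ?thesis .
    next
      case False
      \<comment> \<open>With \<open>a = 3/4 - t\<close> the heavy bound is
        \<open>27/64 + 9/16*t - 15/4*t^2 + 3*t^3\<close>; since \<open>t \<le> 1/20\<close>, the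
        quadratic term costs at most \<open>3/16*t\<close>, which leaves the slope 3/8 used in
        \<open>g\<close>.\<close>
      define t where "t = 3/4 - a"
      have a23: "2/3 \<le> a" using False by (simp add: field_simps)
      have t: "\<eta> \<le> t" "0 < t" "t \<le> 1/20" using a False assms by (auto simp: t_def)
      have a4: "4 * a = 3 - 4 * t" by (simp add: t_def)
      have "64 * (3*a^2*(1-a)) = 3 * (4*a)^2 * (4 - 4*a)" by algebra
      also have "\<dots> = 27 + 36*t - 240*t^2 + 192*t^3" unfolding a4 by algebra
      finally have "64 * (3*a^2*(1-a)) = 27 + 36*t - 240*t^2 + 192*t^3" .
      moreover have "t^2 \<le> t / 20" using t by (simp add: power2_eq_square)
      moreover have "0 \<le> t^3" using t by simp
      ultimately have "27/64 + 3/8 * t \<le> 3*a^2*(1-a)" by linarith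
      moreover have "g \<le> 3/8 * t" using t(1) by (simp add: g_def min_le_iff_disj)
      ultimately have "27/64 + g \<le> 3*a^2*(1-a)" by linarith
      then have "(27/64 + g) * real (card V)^3 \<le> 3*a^2*(1-a) * real (card V)^3"
        by (intro mult_right_mono) auto
      also have "\<dots> \<le> light_triples x V V V"
        by (rule samuels_heavy[OF * a_def a23])
      finally show ?thesis .
    qed
  qed
  then show ?thesis using assms by (intro exI[of _ g] conjI allI impI) (simp_all add: g_def)
qed

section \<open>Fractional matchings\<close>

text \<open>The type \<open>'a\<close> may be infinite, so compactness is taken from the product
  topology (Tychonoff), with functions fixed to 0 outside \<open>V\<close>.\<close>

lemma compact_box_functions:
  fixes V :: "'a set" and l u :: real
  shows "compact {f :: 'a \<Rightarrow> real. \<forall>v. f v \<in> (if v \<in> V then {l..u} else {0})}"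
proof -
  have "compactin (product_topology (\<lambda>_. euclidean) UNIV) (PiE UNIV (\<lambda>v::'a. if v \<in> V then {l..u} else {0::real}))"
    by (subst compactin_PiE) (auto simp: compactin_euclidean_iff)
  moreover have "PiE UNIV (\<lambda>v. if v \<in> V then {l..u} else {0::real})
      = {f. \<forall>v. f v \<in> (if v \<in> V then {l..u} else {0})}"
    by (auto simp: PiE_def Pi_def)
  ultimately show ?thesis
    by (simp add: euclidean_product_topology compactin_euclidean_iff)
qed

text \<open>A second-order upper bound for the squared positive part. Together with
  \<open>nonneg_of_quadratic_nonneg\<close> it replaces differentiation in the optimality conditions
  of the quadratic programme.\<close>

lemma square_pos_part_add_le: "(max 0 (s + t))\<^sup>2 \<le> (max 0 s)\<^sup>2 + 2 * max 0 s * t + t\<^sup>2" for s t :: real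
proof -
  have "(max 0 (s + t))\<^sup>2 \<le> (max 0 s + t)\<^sup>2"
  proof (cases "s + t \<le> 0")
    case False
    then have "max 0 (s + t) \<le> max 0 s + t" by auto
    then show ?thesis by (intro power_mono) auto
  qed (simp add: max_def)
  then show ?thesis by (simp add: power2_sum algebra_simps)
qed

lemma nonneg_of_quadratic_nonneg:
  fixes g c h :: real
  assumes "0 < c" "0 < h" "\<And>t. 0 < t \<Longrightarrow> t \<le> h \<Longrightarrow> 0 \<le> t * g + t\<^sup>2 * c"
  shows "0 \<le> g"
proof (rule ccontr)
  assume g: "\<not> 0 \<le> g"
  define t where "t = min h (- g / (2 * c))"
  have t: "0 < t" "t \<le> h" using assms g by (auto simp: t_def divide_simps)
  have "t * c \<le> - g / (2*c) * c" using assms by (intro mult_right_mono) (auto simp: t_def)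
  also have "\<dots> = - g / 2" using assms by simp
  finally have "t * (g + t * c) < 0" using g t by (intro mult_pos_neg) auto
  with assms(3)[OF t] show False by (simp add: algebra_simps power2_eq_square)
qed

text \<open>The weights w(e) = max 0 (y(e)) / k come from a convex quadratic programme: y minimises
  the function F below, and the displayed equation says that its gradient vanishes.\<close>

lemma quadratic_programme:
  fixes V :: "'a set" and k :: real
  assumes V: "finite V" and k: "0 < k" and E: "\<And>e. e \<in> E \<Longrightarrow> e \<subseteq> V \<and> card e = 4"
  shows "\<exists>y. \<forall>v\<in>V. - 3 \<le> y v \<and> y v \<le> 1 \<and> (\<Sum>e | e \<in> E \<and> v \<in> e. max 0 (sum y e) / k) = 1 - y v"
proof -
  have "E \<subseteq> Pow V" using E by auto
  then have fE: "finite E" using V by (meson finite_Pow_iff finite_subset)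
  define F where "F y = (\<Sum>v\<in>V. (y v)\<^sup>2 / 2 - y v) + (\<Sum>e\<in>E. (max 0 (sum y e))\<^sup>2) / (2 * k)" for y
  define K where "K = {f :: 'a \<Rightarrow> real. \<forall>v. f v \<in> (if v \<in> V then {- 3..1} else {0})}"
  have "continuous_on K F"
    unfolding F_def using k
    by (intro continuous_intros continuous_on_subset[OF continuous_on_product_coordinates]) auto
  moreover have "(\<lambda>v. 0) \<in> K" by (auto simp: K_def)
  moreover have "compact K" unfolding K_def by (rule compact_box_functions)
  ultimately obtain y where yK: "y \<in> K" and ymin: "\<And>z. z \<in> K \<Longrightarrow> F y \<le> F z"
    using continuous_attains_inf[of K F] by blast
  have yb: "- 3 \<le> y v" "y v \<le> 1" if "v \<in> V" for v
    using yK that by (auto simp: K_def dest: spec[of _ v])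
  \<comment> \<open>\<open>g v\<close> is the partial derivative of \<open>F\<close> at the
    minimiser, and \<open>2 * c\<close> bounds the second derivative in one coordinate. Below,
    \<open>up\<close> and \<open>down\<close> are the one-sided optimality conditions away from the
    upper and the lower face of the box.\<close>
  define g where "g v = y v - 1 + (\<Sum>e | e \<in> E \<and> v \<in> e. max 0 (sum y e) / k)" for v
  define c where "c = 1/2 + real (card E) / (2 * k)"
  have c: "c > 0" using k by (simp add: c_def add_pos_nonneg)
  have var: "0 \<le> t * g v + t\<^sup>2 * c" if v: "v \<in> V" and t: "- 3 \<le> y v + t" "y v + t \<le> 1" for v t
  proof -
    define z where "z = y(v := y v + t)"
    have yKu: "y u \<in> (if u \<in> V then {- 3..1} else {0})" for u
      using yK unfolding K_def by blast
    have "z u \<in> (if u \<in> V then {- 3..1} else {0})" for u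
      using yKu[of u] v t by (cases "u = v") (simp_all add: z_def)
    then have zK: "z \<in> K" by (simp only: K_def mem_Collect_eq) blast
    have "(\<Sum>u\<in>V. (z u)\<^sup>2 / 2 - z u) = ((y v + t)\<^sup>2 / 2 - (y v + t)) + (\<Sum>u\<in>V - {v}. (y u)\<^sup>2 / 2 - y u)"
      by (subst sum.remove[OF V v]) (simp add: z_def)
    also have "\<dots> = (\<Sum>u\<in>V. (y u)\<^sup>2 / 2 - y u) + t * (y v - 1) + t\<^sup>2 / 2"
      using sum.remove[OF V v, of "\<lambda>u. (y u)\<^sup>2 / 2 - y u"] by (simp add: power2_sum field_simps)
    finally have vpart: "(\<Sum>u\<in>V. (z u)\<^sup>2 / 2 - z u) = (\<Sum>u\<in>V. (y u)\<^sup>2 / 2 - y u) + t * (y v - 1) + t\<^sup>2 / 2" .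
    have "(\<Sum>e\<in>E. (max 0 (sum z e))\<^sup>2)
        \<le> (\<Sum>e\<in>E. (max 0 (sum y e))\<^sup>2 + (if v \<in> e then 2 * t * max 0 (sum y e) + t\<^sup>2 else 0))"
    proof (rule sum_mono)
      fix e assume e: "e \<in> E"
      then have fe: "finite e" using E V finite_subset by blast
      show "(max 0 (sum z e))\<^sup>2 \<le> (max 0 (sum y e))\<^sup>2 + (if v \<in> e then 2 * t * max 0 (sum y e) + t\<^sup>2 else 0)"
      proof (cases "v \<in> e")
        case True
        have "sum z e = z v + sum z (e - {v})" using fe True by (rule sum.remove)
        also have "sum z (e - {v}) = sum y (e - {v})" by (rule sum.cong) (auto simp: z_def)
        finally have "sum z e = sum y e + t" using sum.remove[OF fe True, of y] by (simp add: z_def)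
        then show ?thesis using square_pos_part_add_le[of "sum y e" t] True by (simp add: algebra_simps)
      next
        case False
        then have "sum z e = sum y e" by (intro sum.cong) (auto simp: z_def)
        with False show ?thesis by simp
      qed
    qed
    also have "\<dots> = (\<Sum>e\<in>E. (max 0 (sum y e))\<^sup>2)
        + (\<Sum>e | e \<in> E \<and> v \<in> e. 2 * t * max 0 (sum y e) + t\<^sup>2)"
      using fE by (simp add: sum.distrib sum.If_cases Int_def)
    also have "(\<Sum>e | e \<in> E \<and> v \<in> e. 2 * t * max 0 (sum y e) + t\<^sup>2)
        = 2 * t * (\<Sum>e | e \<in> E \<and> v \<in> e. max 0 (sum y e)) + card {e \<in> E. v \<in> e} * t\<^sup>2"
      by (simp add: sum.distrib sum_distrib_left)
    also have "real (card {e \<in> E. v \<in> e}) * t\<^sup>2 \<le> card E * t\<^sup>2"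
      using fE by (intro mult_right_mono) (auto intro: card_mono)
    finally have "(\<Sum>e\<in>E. (max 0 (sum z e))\<^sup>2) / (2 * k) \<le> ((\<Sum>e\<in>E. (max 0 (sum y e))\<^sup>2)
        + (2 * t * (\<Sum>e | e \<in> E \<and> v \<in> e. max 0 (sum y e)) + card E * t\<^sup>2)) / (2 * k)"
      using k by (intro divide_right_mono) auto
    also have "\<dots> = (\<Sum>e\<in>E. (max 0 (sum y e))\<^sup>2) / (2 * k)
        + (t * ((\<Sum>e | e \<in> E \<and> v \<in> e. max 0 (sum y e)) / k) + t\<^sup>2 * (card E / (2 * k)))"
      by (simp add: add_divide_distrib)
    finally have epart: "(\<Sum>e\<in>E. (max 0 (sum z e))\<^sup>2) / (2 * k) \<le> \<dots>" .
    have "t * g v = t * (y v - 1) + t * ((\<Sum>e | e \<in> E \<and> v \<in> e. max 0 (sum y e)) / k)"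
      unfolding g_def sum_divide_distrib by (rule distrib_left)
    moreover have "t\<^sup>2 * c = t\<^sup>2 / 2 + t\<^sup>2 * (card E / (2 * k))"
      unfolding c_def by (simp add: distrib_left)
    ultimately have "F z \<le> F y + (t * g v + t\<^sup>2 * c)"
      using epart unfolding F_def vpart by linarith
    with ymin[OF zK] show ?thesis by simp
  qed
  have up: "0 \<le> g v" if "v \<in> V" "y v < 1" for v
  proof (rule nonneg_of_quadratic_nonneg[OF c, of "1 - y v"])
    fix t assume "0 < t" "t \<le> 1 - y v"
    then show "0 \<le> t * g v + t\<^sup>2 * c" using yb[OF that(1)] by (intro var[OF that(1)]) simp_all
  qed (use that in simp)
  have down: "g v \<le> 0" if "v \<in> V" "- 3 < y v" for v
  proof -
    have "0 \<le> - g v"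
    proof (rule nonneg_of_quadratic_nonneg[OF c, of "y v + 3"])
      fix t assume "0 < t" "t \<le> y v + 3"
      then have "0 \<le> - t * g v + (- t)\<^sup>2 * c" using yb[OF that(1)] by (intro var[OF that(1)]) simp_all
      then show "0 \<le> t * - g v + t\<^sup>2 * c" by simp
    qed (use that in simp)
    then show ?thesis by simp
  qed
  have sum_nn: "0 \<le> (\<Sum>e | e \<in> E \<and> v \<in> e. max 0 (sum y e) / k)" for v
    using k by (intro sum_nonneg) auto
  \<comment> \<open>The box exists for compactness only and must not interfere with stationarity. At
    \<open>y v = -3\<close> every edge through \<open>v\<close> has sum at most 0, as the other
    three values are at most 1, so the derivative would be -4, against \<open>up\<close>. At
    \<open>y v = 1\<close> the derivative is a sum of nonnegative terms, so \<open>down\<close>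
    makes it 0.\<close>
  have low: "- 3 < y v" if v: "v \<in> V" for v
  proof (rule ccontr)
    assume "\<not> - 3 < y v"
    then have y3: "y v = - 3" using yb[OF v] by simp
    have "max 0 (sum y e) = 0" if e: "e \<in> E" "v \<in> e" for e
    proof -
      have fe: "finite e" using E V finite_subset e by blast
      have "sum y e = y v + sum y (e - {v})" using fe e(2) by (rule sum.remove)
      also have "sum y (e - {v}) \<le> real (card (e - {v})) * 1"
        using E[OF e(1)] yb by (intro sum_bounded_above) auto
      also have "card (e - {v}) = 3" using E[OF e(1)] e fe by simp
      finally show ?thesis using y3 by simp
    qed
    then have "(\<Sum>e | e \<in> E \<and> v \<in> e. max 0 (sum y e) / k) = 0" by (intro sum.neutral) auto
    then have "g v = - 4" by (simp add: g_def y3)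
    with up[OF v] y3 show False by simp
  qed
  have "g v = 0" if v: "v \<in> V" for v
  proof (cases "y v < 1")
    case True then show ?thesis using up[OF v] down[OF v low[OF v]] by simp
  next
    case False
    then have "y v = 1" using yb[OF v] by simp
    then have "0 \<le> g v" using sum_nn[of v] by (simp add: g_def)
    then show ?thesis using down[OF v low[OF v]] by simp
  qed
  then have "(\<Sum>e | e \<in> E \<and> v \<in> e. max 0 (sum y e) / k) = 1 - y v" if "v \<in> V" for v
    using that unfolding g_def by (simp add: algebra_simps)
  then show ?thesis using yb by blast
qed

section \<open>Double counting, and the dichotomy for the quadratic programme\<close>

lemma uniform_hypergraphD:
  assumes "uniform_hypergraph k V E"
  shows "finite V" "finite E" "\<And>e. e \<in> E \<Longrightarrow> e \<subseteq> V" "\<And>e. e \<in> E \<Longrightarrow> card e = k" "\<And>e. e \<in> E \<Longrightarrow> finite e"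
proof -
  show V: "finite V" and "\<And>e. e \<in> E \<Longrightarrow> e \<subseteq> V" "\<And>e. e \<in> E \<Longrightarrow> card e = k"
    using assms by (auto simp: uniform_hypergraph_def)
  then show "finite E" "\<And>e. e \<in> E \<Longrightarrow> finite e"
    by (meson Pow_iff finite_Pow_iff finite_subset subsetI)+
qed

lemma sum_incidence_swap:
  assumes "finite V" "finite D" "\<And>e. e \<in> D \<Longrightarrow> e \<subseteq> V"
  shows "(\<Sum>v\<in>V. \<Sum>e | e \<in> D \<and> v \<in> e. f v e) = (\<Sum>e\<in>D. \<Sum>v\<in>e. f v e)"
proof -
  have "(\<Sum>v\<in>V. \<Sum>e | e \<in> D \<and> v \<in> e. f v e) = (\<Sum>e\<in>D. \<Sum>v | v \<in> V \<and> v \<in> e. f v e)"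
    using assms(1,2) by (rule sum.swap_restrict)
  also have "\<dots> = (\<Sum>e\<in>D. \<Sum>v\<in>e. f v e)"
    using assms(3) by (intro sum.cong) auto
  finally show ?thesis .
qed

lemma sum_degrees:
  assumes "uniform_hypergraph k V E" "D \<subseteq> E"
  shows "(\<Sum>v\<in>V. card {e \<in> D. v \<in> e}) = k * card D"
proof -
  note * = uniform_hypergraphD[OF assms(1)]
  have "finite D" using * assms(2) finite_subset by blast
  then have "(\<Sum>v\<in>V. \<Sum>e | e \<in> D \<and> v \<in> e. 1) = (\<Sum>e\<in>D. \<Sum>v\<in>e. 1)"
    using * assms(2) by (intro sum_incidence_swap) auto
  also have "\<dots> = (\<Sum>e\<in>D. k)" using * assms(2) by (intro sum.cong) auto
  finally show ?thesis by simp
qed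

lemma card_ordered_triple:
  assumes "card T = 3"
  shows "finite {(u,v,w). {u,v,w} = T}" "card {(u,v,w). {u,v,w} = T} = 6"
proof -
  obtain p q r where T: "T = {p,q,r}" "p \<noteq> q" "p \<noteq> r" "q \<noteq> r"
    using assms by (auto simp: card_3_iff)
  have "{(u,v,w). {u,v,w} = T} = {(p,q,r), (p,r,q), (q,p,r), (q,r,p), (r,p,q), (r,q,p)}"
  proof (intro equalityI subsetI)
    fix t assume t: "t \<in> {(u,v,w). {u,v,w} = T}"
    obtain u v w where uvw: "t = (u,v,w)" by (cases t)
    with t have uT: "{u,v,w} = T" by simp
    then have "card {u,v,w} = 3" using assms by simp
    then have "u \<noteq> v" "u \<noteq> w" "v \<noteq> w" by (auto simp: card_insert_if split: if_splits)
    moreover have "u \<in> {p,q,r}" "v \<in> {p,q,r}" "w \<in> {p,q,r}" using uT T(1) by auto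
    ultimately show "t \<in> {(p,q,r), (p,r,q), (q,p,r), (q,r,p), (r,p,q), (r,q,p)}"
      unfolding uvw by auto
  qed (auto simp: T(1))
  then show "finite {(u,v,w). {u,v,w} = T}" "card {(u,v,w). {u,v,w} = T} = 6"
    using T(2-) by simp_all
qed

lemma card_ordered_triples:
  assumes "finite F" "\<And>T. T \<in> F \<Longrightarrow> card T = 3"
  shows "card {(u,v,w). {u,v,w} \<in> F} = 6 * card F"
proof -
  have "{(u,v,w). {u,v,w} \<in> F} = (\<Union>T\<in>F. {(u,v,w). {u,v,w} = T})" by auto
  also have "card \<dots> = (\<Sum>T\<in>F. card {(u,v,w). {u,v,w} = T})"
    using assms card_ordered_triple by (intro card_UN_disjoint) auto
  also have "\<dots> = (\<Sum>T\<in>F. 6)" by (intro sum.cong refl card_ordered_triple assms)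
  finally show ?thesis by simp
qed

lemma light_triples_eq_card:
  assumes "finite V"
  shows "light_triples x V V V = card {(u,v,w) \<in> V \<times> V \<times> V. x u + x v + x w < 1}"
proof -
  have "light_triples x V V V = (\<Sum>(u,v,w)\<in>V \<times> V \<times> V. of_bool (x u + x v + x w < 1))"
    unfolding light_triples_def by (simp add: sum.cartesian_product split_def)
  also have "\<dots> = (\<Sum>t\<in>{(u,v,w) \<in> V \<times> V \<times> V. x u + x v + x w < 1}. 1)"
    using assms by (intro sum.mono_neutral_cong_right) auto
  finally show ?thesis by simp
qed

text \<open>Here x is a fractional cover obtained from y by LP duality, with x(v0) = 0; hence almost all triples
  in the link of v0 are heavy.\<close>

lemma extremal_of_dual:
  fixes V :: "'a set" and g \<epsilon> \<eta> \<beta> :: real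
  assumes H: "uniform_hypergraph 4 V E" and "V \<noteq> {}" and n: "n = real (card V)" and g: "0 < g"
    and SP: "\<And>x. (\<And>v. v \<in> V \<Longrightarrow> 0 \<le> x v) \<Longrightarrow> sum x V \<le> n / 4 \<Longrightarrow>
        card {v\<in>V. x v < 1/4} \<le> (3/4 - \<eta>) * n \<Longrightarrow> (27/64 + g) * n^3 \<le> light_triples x V V V"
    and deg: "\<And>v. v \<in> V \<Longrightarrow> (37/64 - g/2) * n^3 / 6 \<le> vertex_degree E v"
    and y1: "\<And>v. v \<in> V \<Longrightarrow> y v \<le> 1" and \<epsilon>: "0 < \<epsilon>" and sy: "\<epsilon> * n \<le> sum y V"
    and \<beta>: "0 \<le> \<beta>" "\<beta> \<le> \<eta>" "\<beta> \<le> \<epsilon> * g / 384" and D: "card {e\<in>E. \<epsilon> < sum y e} \<le> \<beta> * n^4"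
  shows "\<exists>B\<subseteq>V. (3/4 - \<eta>) * n \<le> card B \<and> card {e\<in>E. e \<subseteq> B} \<le> \<eta> * n^4"
proof -
  note HD = uniform_hypergraphD[OF H]
  have n0: "n > 0" using HD(1) \<open>V \<noteq> {}\<close> by (simp add: n card_gt_0_iff)
  define D where "D = {e\<in>E. \<epsilon> < sum y e}"
  have DE: "D \<subseteq> E" "finite D" using HD by (auto simp: D_def)
  \<comment> \<open>With this threshold the bound on \<open>D\<close> leaves at most
    \<open>\<epsilon>*n/4\<close> bad vertices, while a good vertex loses at most
    \<open>g/24*n^3\<close> edges to \<open>D\<close>, that is \<open>g/4*n^3\<close> ordered
    triples of its link.\<close>
  define \<tau> where "\<tau> = g / 24"
  have \<tau>: "\<tau> > 0" using g by (simp add: \<tau>_def)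
  define Bad where "Bad = {v\<in>V. \<tau> * n^3 < card {e\<in>D. v \<in> e}}"
  have Bad: "Bad \<subseteq> V" "finite Bad" using HD by (auto simp: Bad_def)
  have "card Bad * (\<tau> * n^3) = (\<Sum>v\<in>Bad. \<tau> * n^3)" by simp
  also have "\<dots> \<le> (\<Sum>v\<in>Bad. real (card {e\<in>D. v \<in> e}))" by (intro sum_mono) (auto simp: Bad_def)
  also have "\<dots> \<le> (\<Sum>v\<in>V. real (card {e\<in>D. v \<in> e}))" using Bad HD by (intro sum_mono2) auto
  also have "\<dots> = 4 * card D" using sum_degrees[OF H DE(1)] by (metis of_nat_mult of_nat_numeral of_nat_sum)
  also have "\<dots> \<le> 4 * (\<beta> * n^4)" using D by (simp add: D_def)
  also have "\<dots> \<le> 4 * (\<epsilon> * g / 384 * n^4)" using \<beta> n0 by (intro mult_left_mono mult_right_mono) auto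
  also have "\<dots> = (\<epsilon> * n / 4) * (\<tau> * n^3)" by (simp add: \<tau>_def power3_eq_cube power4_eq_xxxx)
  finally have cBad: "card Bad \<le> \<epsilon> * n / 4" using \<tau> n0 by (simp add: mult_le_cancel_right)
  define Good where "Good = V - Bad"
  have "sum y V = sum y Good + sum y Bad"
    unfolding Good_def using HD(1) Bad by (metis sum.subset_diff)
  moreover have "sum y Bad \<le> real (card Bad) * 1" using y1 Bad by (intro sum_bounded_above) auto
  ultimately have sG: "3/4 * (\<epsilon> * n) \<le> sum y Good" using cBad sy by simp
  have \<epsilon>n: "0 < \<epsilon> * n" using \<epsilon> n0 by simp
  with sG have "Good \<noteq> {}" by auto
  moreover have fG: "finite Good" using HD by (simp add: Good_def)
  ultimately have "Max (y ` Good) \<in> y ` Good" by (intro Max_in) auto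
  then obtain v0 where "v0 \<in> Good" "y v0 = Max (y ` Good)" by (metis imageE)
  then have v0: "v0 \<in> Good" "\<And>v. v \<in> Good \<Longrightarrow> y v \<le> y v0"
    using fG by simp_all
  define M where "M = y v0"
  have sGM: "sum y Good \<le> card Good * M" using v0 by (intro sum_bounded_above) (auto simp: M_def)
  have M0: "M > 0"
  proof (rule ccontr)
    assume "\<not> M > 0"
    then have "card Good * M \<le> 0" by (simp add: mult_nonneg_nonpos)
    moreover have "0 < 3/4 * (\<epsilon> * n)" using \<epsilon> n0 by simp
    ultimately show False using sGM sG by linarith
  qed
  have "card Good \<le> card V" using HD(1) by (intro card_mono) (auto simp: Good_def)
  then have "card Good * M \<le> n * M" using M0 n by (intro mult_right_mono) auto
  then have "n * (3/4 * \<epsilon>) \<le> n * M" using sG sGM by (simp add: algebra_simps)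
  then have M: "3/4 * \<epsilon> \<le> M" using n0 by simp
  \<comment> \<open>For an edge outside \<open>D\<close> the values \<open>M - y v\<close> add up to
    at least \<open>4*M - \<epsilon> = d\<close>, so after division by \<open>d\<close> it is
    covered. A bad vertex may have \<open>y v > M\<close>; truncation at 0 then costs at most 1,
    because \<open>y v \<le> 1\<close> and \<open>M > 0\<close>, and the surplus of
    \<open>sum y V\<close> pays for all bad vertices.\<close>
  define d where "d = 4 * M - \<epsilon>"
  have d: "d > 0" using M \<epsilon> by (simp add: d_def)
  define x where "x v = max 0 (M - y v) / d" for v
  have x0: "0 \<le> x v" for v using d by (simp add: x_def)
  have "(\<Sum>v\<in>V. max 0 (M - y v)) \<le> (\<Sum>v\<in>V. M - y v + of_bool (v \<in> Bad))"
    using v0 y1 M0 by (intro sum_mono) (force simp: Good_def M_def)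
  also have "\<dots> = n * M - sum y V + card Bad"
    using Bad HD(1) by (simp add: sum.distrib sum_subtractf n Int_absorb1 Int_absorb2 flip: Int_def)
  also have "\<dots> \<le> n * d / 4" using cBad sy \<epsilon> n0 by (simp add: d_def algebra_simps)
  finally have sx: "sum x V \<le> n / 4"
    unfolding x_def sum_divide_distrib[symmetric] using d by (simp add: divide_le_eq)
  have cover: "1 \<le> sum x e" if e: "e \<in> E" "e \<notin> D" for e
  proof -
    have "d \<le> (\<Sum>v\<in>e. M - y v)" using e HD by (simp add: D_def d_def sum_subtractf)
    also have "\<dots> \<le> (\<Sum>v\<in>e. max 0 (M - y v))" by (intro sum_mono) auto
    finally show ?thesis unfolding x_def sum_divide_distrib[symmetric] using d by simp
  qed
  have xv0: "x v0 = 0" by (simp add: x_def M_def)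
  have v0V: "v0 \<in> V" using v0 by (simp add: Good_def)
  define B where "B = {v\<in>V. x v < 1/4}"
  \<comment> \<open>Otherwise stability gives at least \<open>(27/64 + g)*n^3\<close> light ordered
    triples. But every member of \<open>F\<close>, the link of \<open>v0\<close> without
    \<open>D\<close>, is heavy because \<open>x v0 = 0\<close>, and these contribute at least
    \<open>(37/64 - 3/4*g)*n^3\<close> ordered triples: more than \<open>n^3\<close>
    altogether.\<close>
  have big: "(3/4 - \<eta>) * n < card B"
  proof (rule ccontr)
    assume "\<not> (3/4 - \<eta>) * n < card B"
    then have light: "(27/64 + g) * n^3 \<le> card {(u,v,w) \<in> V \<times> V \<times> V. x u + x v + x w < 1}"
      using SP[of x] x0 sx by (simp add: B_def light_triples_eq_card HD(1))
    define L where "L = {e\<in>E. v0 \<in> e} - D"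
    define F where "F = (\<lambda>e. e - {v0}) ` L"
    have L: "finite L" "\<And>e. e \<in> L \<Longrightarrow> v0 \<in> e \<and> e \<in> E \<and> e \<notin> D" using HD by (auto simp: L_def)
    have inj: "inj_on (\<lambda>e. e - {v0}) L" using L(2) by (intro inj_onI) blast
    have cF: "card F = card L" unfolding F_def by (rule card_image[OF inj])
    have F3: "card T = 3 \<and> T \<subseteq> V \<and> 1 \<le> sum x T" if "T \<in> F" for T
    proof -
      from that obtain e where e: "e \<in> L" "T = e - {v0}" unfolding F_def by blast
      have eE: "v0 \<in> e" "e \<in> E" "e \<notin> D" using L(2)[OF e(1)] by auto
      have "sum x e = x v0 + sum x T" unfolding e(2) using HD eE by (intro sum.remove) auto
      then show ?thesis using cover[OF eE(2,3)] xv0 HD eE e(2) by auto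
    qed
    have "real (vertex_degree E v0) \<le> card L + card {e\<in>D. v0 \<in> e}"
    proof -
      have "{e\<in>E. v0 \<in> e} \<subseteq> L \<union> {e\<in>D. v0 \<in> e}" by (auto simp: L_def)
      then have "vertex_degree E v0 \<le> card (L \<union> {e\<in>D. v0 \<in> e})"
        unfolding vertex_degree_def using L DE by (intro card_mono) auto
      also have "\<dots> \<le> card L + card {e\<in>D. v0 \<in> e}" by (rule card_Un_le)
      finally show ?thesis by simp
    qed
    moreover have "card {e\<in>D. v0 \<in> e} \<le> \<tau> * n^3" using v0(1) v0V by (auto simp: Good_def Bad_def)
    ultimately have "(37/64 - g/2) * n^3 / 6 - \<tau> * n^3 \<le> card L" using deg[OF v0V] by linarith
    then have "(37/64 - 3/4 * g) * n^3 \<le> 6 * card L" by (simp add: \<tau>_def algebra_simps)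
    also have "6 * card L = card {(u,v,w). {u,v,w} \<in> F}"
      using card_ordered_triples[of F] F3 L cF by (simp add: F_def)
    also have "\<dots> \<le> card (V \<times> V \<times> V - {(u,v,w) \<in> V \<times> V \<times> V. x u + x v + x w < 1})"
    proof -
      have "{(u,v,w). {u,v,w} \<in> F} \<subseteq> V \<times> V \<times> V - {(u,v,w) \<in> V \<times> V \<times> V. x u + x v + x w < 1}"
      proof (clarsimp, safe)
        fix u v w assume T: "{u, v, w} \<in> F"
        note * = F3[OF T]
        show "u \<in> V" "v \<in> V" "w \<in> V" using * by auto
        have "u \<noteq> v" "u \<noteq> w" "v \<noteq> w" using * by (auto simp: card_insert_if split: if_splits)
        moreover assume "x u + x v + x w < 1"
        ultimately show False using * by (simp add: add.assoc)
      qed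
      then show ?thesis using HD(1) by (intro of_nat_mono card_mono) auto
    qed
    also have "\<dots> = n^3 - card {(u,v,w) \<in> V \<times> V \<times> V. x u + x v + x w < 1}"
    proof -
      let ?L = "{(u,v,w) \<in> V \<times> V \<times> V. x u + x v + x w < 1}"
      have L: "?L \<subseteq> V \<times> V \<times> V" by auto
      moreover have fV: "finite (V \<times> V \<times> V)" using HD(1) by auto
      ultimately have "card (V \<times> V \<times> V - ?L) = card (V \<times> V \<times> V) - card ?L"
        by (intro card_Diff_subset) (auto intro: finite_subset)
      moreover have "card ?L \<le> card (V \<times> V \<times> V)" using fV L by (rule card_mono)
      ultimately show ?thesis by (simp add: n power3_eq_cube of_nat_diff card_cartesian_product)
    qed
    also have "\<dots> \<le> n^3 - (27/64 + g) * n^3" using light by simp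
    finally have "(g / 4) * n^3 \<le> 0" by (simp add: algebra_simps)
    moreover have "(g / 4) * n^3 > 0" using g n0 by simp
    ultimately show False by simp
  qed
  \<comment> \<open>Four weights below 1/4 cannot cover an edge, so an edge inside \<open>B\<close>
    is one of the few that the cover ignores.\<close>
  have "{e\<in>E. e \<subseteq> B} \<subseteq> D"
  proof clarify
    fix e assume e: "e \<in> E" "e \<subseteq> B"
    have "e \<noteq> {}" using HD(4)[OF e(1)] by auto
    then have "sum x e < (\<Sum>v\<in>e. 1/4)"
      using e HD(5) by (intro sum_strict_mono) (auto simp: B_def)
    then have "sum x e < 1" using HD(4)[OF e(1)] by simp
    then show "e \<in> D" using cover[OF e(1)] by force
  qed
  then have "card {e\<in>E. e \<subseteq> B} \<le> card D" using DE by (intro card_mono)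
  then have "real (card {e\<in>E. e \<subseteq> B}) \<le> \<beta> * n^4" using D by (simp add: D_def)
  also have "\<dots> \<le> \<eta> * n^4" using \<beta> by (intro mult_right_mono) auto
  finally show ?thesis using big by (intro exI[of _ B]) (auto simp: B_def)
qed

text \<open>The order of the quantifiers matters: \<gamma> depends on \<eta> alone, while \<epsilon>
  is fixed later, once it is known how few vertices may stay uncovered, which in turn depends on
  \<gamma>. Only the weight bound \<open>C\<close> depends on \<epsilon>.\<close>

lemma fractional_or_extremal:
  fixes \<eta> :: real
  assumes \<eta>: "0 < \<eta>"
  shows "\<exists>\<gamma>::real. 0 < \<gamma> \<and> (\<forall>\<epsilon>::real. 0 < \<epsilon> \<longrightarrow> (\<exists>C::real. 0 \<le> C \<and> ( \<forall>(V :: 'a set) E. uniform_hypergraph 4 V E \<longrightarrow> V \<noteq> {} \<longrightarrow>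
    (\<forall>v\<in>V. (37/64 - \<gamma>) * real (card V)^3 / 6 \<le> vertex_degree E v) \<longrightarrow>
    (\<exists>B\<subseteq>V. (3/4 - \<eta>) * card V \<le> card B \<and> card {e\<in>E. e \<subseteq> B} \<le> \<eta> * real (card V)^4) \<or>
    (\<exists>w :: 'a set \<Rightarrow> real. (\<forall>e\<in>E. 0 \<le> w e \<and> w e \<le> C / real (card V)^3) \<and>
       (\<forall>v\<in>V. (\<Sum>e | e \<in> E \<and> v \<in> e. w e) \<le> 4) \<and>
       (\<Sum>v\<in>V. ((\<Sum>e | e \<in> E \<and> v \<in> e. w e) - 1)\<^sup>2) \<le> \<epsilon> * card V))))"
proof -
  from samuels_stability[OF \<eta>, where 'a = 'a] obtain g where g: "g > 0"
    and SP0: "\<forall>(V :: 'a set) x. finite V \<and> V \<noteq> {} \<and> (\<forall>v\<in>V. 0 \<le> x v) \<and> sum x V \<le> real (card V) / 4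
     \<and> real (card {v\<in>V. x v < 1/4}) \<le> (3/4 - \<eta>) * card V
     \<longrightarrow> (27/64 + g) * real (card V)^3 \<le> light_triples x V V V"
    by (elim exE conjE)
  have SP: "(27/64 + g) * real (card V)^3 \<le> light_triples x V V V"
    if "finite V" "V \<noteq> {}" "\<And>v. v\<in>V \<Longrightarrow> 0 \<le> x v" "sum x V \<le> real (card V) / 4"
      "card {v\<in>V. x v < 1/4} \<le> (3/4 - \<eta>) * card V" for V :: "'a set" and x
    by (rule SP0[rule_format]) (intro conjI ballI that)
  have main: "\<exists>C\<ge>0. \<forall>(V :: 'a set) E. uniform_hypergraph 4 V E \<longrightarrow> V \<noteq> {} \<longrightarrow>
      (\<forall>v\<in>V. (37/64 - g/2) * real (card V)^3 / 6 \<le> vertex_degree E v) \<longrightarrow>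
      (\<exists>B\<subseteq>V. (3/4 - \<eta>) * card V \<le> card B \<and> card {e\<in>E. e \<subseteq> B} \<le> \<eta> * real (card V)^4) \<or>
      (\<exists>w :: 'a set \<Rightarrow> real. (\<forall>e\<in>E. 0 \<le> w e \<and> w e \<le> C / real (card V)^3) \<and>
         (\<forall>v\<in>V. (\<Sum>e | e \<in> E \<and> v \<in> e. w e) \<le> 4) \<and>
         (\<Sum>v\<in>V. ((\<Sum>e | e \<in> E \<and> v \<in> e. w e) - 1)\<^sup>2) \<le> \<epsilon> * card V)" if \<epsilon>: "0 < \<epsilon>" for \<epsilon> :: real
  proof -
    define \<beta> where "\<beta> = min \<eta> (\<epsilon> * g / 384)"
    have \<beta>: "0 < \<beta>" "\<beta> \<le> \<eta>" "\<beta> \<le> \<epsilon> * g / 384" using \<epsilon> g \<eta> by (auto simp: \<beta>_def)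
    \<comment> \<open>The total penalty will be at most \<open>n * k\<close>, and an edge of sum
      above \<epsilon> costs at least \<open>\<epsilon>\<^sup>2\<close> of it; with this
      \<open>K\<close> at most \<open>\<beta>*n^4\<close> edges can do so.\<close>
    define K where "K = 1 / (\<beta> * \<epsilon>\<^sup>2)"
    have K: "K > 0" using \<beta> \<epsilon> by (simp add: K_def)
    show ?thesis
    proof (rule exI[of _ "4 * K"], intro conjI allI impI)
      show "0 \<le> 4 * K" using K by simp
      fix V :: "'a set" and E
      assume H: "uniform_hypergraph 4 V E" and Vne: "V \<noteq> {}"
        and deg: "\<forall>v\<in>V. (37/64 - g/2) * real (card V)^3 / 6 \<le> vertex_degree E v"
      note HD = uniform_hypergraphD[OF H]
      define n where "n = real (card V)"
      have n0: "n > 0" using HD(1) Vne by (simp add: n_def card_gt_0_iff)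
      define k where "k = n^3 / K"
      have k: "k > 0" using n0 K by (simp add: k_def)
      obtain y where y: "\<And>v. v \<in> V \<Longrightarrow> - 3 \<le> y v" "\<And>v. v \<in> V \<Longrightarrow> y v \<le> 1"
        "\<And>v. v \<in> V \<Longrightarrow> (\<Sum>e | e \<in> E \<and> v \<in> e. max 0 (sum y e) / k) = 1 - y v"
      proof -
        have "e \<subseteq> V \<and> card e = 4" if "e \<in> E" for e using HD that by auto
        from quadratic_programme[OF HD(1) k this] show thesis using that by blast
      qed
      define w where "w e = max 0 (sum y e) / k" for e
      have Xw: "(\<Sum>e | e \<in> E \<and> v \<in> e. w e) = 1 - y v" if "v \<in> V" for v
        unfolding w_def by (rule y(3)[OF that])
      \<comment> \<open>The stationarity equations are paired with \<open>y\<close>. The resulting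
        identity serves both alternatives: if the sum of squares is small, the weighted degrees
        \<open>1 - y v\<close> are close to 1; if it is large, so is \<open>sum y V\<close>, and the
        penalty is at most \<open>n\<close>.\<close>
      have "(\<Sum>v\<in>V. y v * (1 - y v)) = (\<Sum>v\<in>V. \<Sum>e | e \<in> E \<and> v \<in> e. y v * w e)"
        by (intro sum.cong refl) (simp add: Xw sum_distrib_left[symmetric])
      also have "\<dots> = (\<Sum>e\<in>E. \<Sum>v\<in>e. y v * w e)" using HD by (intro sum_incidence_swap)
      also have "\<dots> = (\<Sum>e\<in>E. sum y e * w e)" by (simp add: sum_distrib_right)
      also have "\<dots> = (\<Sum>e\<in>E. (max 0 (sum y e))\<^sup>2) / k"
        unfolding sum_divide_distrib w_def by (intro sum.cong) (auto simp: power2_eq_square max_def)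
      finally have id: "sum y V - (\<Sum>v\<in>V. (y v)\<^sup>2) = (\<Sum>e\<in>E. (max 0 (sum y e))\<^sup>2) / k"
        by (simp add: algebra_simps power2_eq_square sum_subtractf)
      show "(\<exists>B\<subseteq>V. (3/4 - \<eta>) * card V \<le> card B \<and> card {e\<in>E. e \<subseteq> B} \<le> \<eta> * real (card V)^4) \<or>
        (\<exists>w :: 'a set \<Rightarrow> real. (\<forall>e\<in>E. 0 \<le> w e \<and> w e \<le> 4 * K / real (card V)^3) \<and>
         (\<forall>v\<in>V. (\<Sum>e | e \<in> E \<and> v \<in> e. w e) \<le> 4) \<and>
         (\<Sum>v\<in>V. ((\<Sum>e | e \<in> E \<and> v \<in> e. w e) - 1)\<^sup>2) \<le> \<epsilon> * card V)"
      proof (cases "(\<Sum>v\<in>V. (y v)\<^sup>2) \<le> \<epsilon> * n")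
        case True
        have "0 \<le> w e \<and> w e \<le> 4 * K / n^3" if e: "e \<in> E" for e
        proof
          show "0 \<le> w e" using k by (simp add: w_def)
          have "sum y e \<le> real (card e) * 1" using y(2) HD(3)[OF e] by (intro sum_bounded_above) auto
          then have "max 0 (sum y e) \<le> 4" using HD(4)[OF e] by simp
          then have "w e \<le> 4 / k" unfolding w_def using k by (intro divide_right_mono) auto
          then show "w e \<le> 4 * K / n^3" by (simp add: k_def)
        qed
        moreover have "(\<Sum>v\<in>V. ((\<Sum>e | e \<in> E \<and> v \<in> e. w e) - 1)\<^sup>2) = (\<Sum>v\<in>V. (y v)\<^sup>2)"
          by (intro sum.cong) (auto simp: Xw)
        moreover have "(\<Sum>e | e \<in> E \<and> v \<in> e. w e) \<le> 4" if "v \<in> V" for v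
          unfolding Xw[OF that] using y(1)[OF that] by simp
        ultimately show ?thesis using True unfolding n_def by (intro disjI2 exI[of _ w]) auto
      next
        case False
        have sq: "0 \<le> (\<Sum>e\<in>E. (max 0 (sum y e))\<^sup>2) / k" using k by (intro divide_nonneg_pos sum_nonneg) auto
        have sy: "\<epsilon> * n \<le> sum y V" using False id sq by linarith
        have "sum y V \<le> real (card V) * 1" using y(2) by (intro sum_bounded_above) auto
        moreover have "0 \<le> (\<Sum>v\<in>V. (y v)\<^sup>2)" by (intro sum_nonneg) auto
        ultimately have "(\<Sum>e\<in>E. (max 0 (sum y e))\<^sup>2) / k \<le> n" using id unfolding n_def by linarith
        then have S: "(\<Sum>e\<in>E. (max 0 (sum y e))\<^sup>2) \<le> n * k" using k by (simp add: divide_le_eq)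
        define D where "D = {e\<in>E. \<epsilon> < sum y e}"
        have "card D * \<epsilon>\<^sup>2 = (\<Sum>e\<in>D. \<epsilon>\<^sup>2)" by simp
        also have "\<dots> \<le> (\<Sum>e\<in>D. (max 0 (sum y e))\<^sup>2)"
          using \<epsilon> by (intro sum_mono power_mono) (auto simp: D_def)
        also have "\<dots> \<le> (\<Sum>e\<in>E. (max 0 (sum y e))\<^sup>2)" using HD by (intro sum_mono2) (auto simp: D_def)
        also have "\<dots> \<le> n * k" by (rule S)
        also have "\<dots> = \<beta> * n^4 * \<epsilon>\<^sup>2" using \<beta> \<epsilon>
          by (simp add: k_def K_def power4_eq_xxxx power3_eq_cube)
        finally have "card D \<le> \<beta> * n^4" using \<epsilon> by simp
        then show ?thesis
          using extremal_of_dual[OF H Vne n_def g SP[OF HD(1) Vne, folded n_def] deg[rule_format, folded n_def]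
              y(2) \<epsilon> sy less_imp_le[OF \<beta>(1)] \<beta>(2,3)]
          unfolding n_def D_def by blast
      qed
    qed
  qed
  show ?thesis
  proof (rule exI[of _ "g/2"], intro conjI allI impI)
    show "0 < g/2" using g by simp
  qed (rule main)
qed

section \<open>The nibble\<close>

lemma card_edges_through_pair:
  assumes H: "uniform_hypergraph 4 V E" and "v \<noteq> z"
  shows "card {f\<in>E. v \<in> f \<and> z \<in> f} \<le> card V * card V"
proof -
  note HD = uniform_hypergraphD[OF H]
  have "{f\<in>E. v \<in> f \<and> z \<in> f} \<subseteq> (\<lambda>(a,b). {v,z,a,b}) ` (V \<times> V)"
  proof
    fix f assume f: "f \<in> {f\<in>E. v \<in> f \<and> z \<in> f}"
    then have "card (f - {v,z}) = 2" using HD(4,5) assms(2) by (simp add: card_Diff_subset)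
    then obtain a b where ab: "f - {v,z} = {a,b}" by (auto simp: card_2_iff)
    then have "f = {v,z,a,b}" "a \<in> V" "b \<in> V" using f HD(3)[of f] by auto
    then show "f \<in> (\<lambda>(a,b). {v,z,a,b}) ` (V \<times> V)" by auto
  qed
  then have "card {f\<in>E. v \<in> f \<and> z \<in> f} \<le> card (V \<times> V)"
    by (rule surj_card_le[rotated]) (use HD(1) in simp)
  then show ?thesis by (simp add: card_cartesian_product)
qed

lemma card_edges_meeting_twice:
  assumes H: "uniform_hypergraph 4 V E" and e: "e \<in> E" "v \<notin> e"
  shows "card {f\<in>E. v \<in> f \<and> 2 \<le> card (f \<inter> e)} \<le> 16 * card V"
proof -
  note HD = uniform_hypergraphD[OF H]
  have "{f\<in>E. v \<in> f \<and> 2 \<le> card (f \<inter> e)} \<subseteq> (\<lambda>(p,q,b). {v,p,q,b}) ` (e \<times> e \<times> V)"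
  proof
    fix f assume f: "f \<in> {f\<in>E. v \<in> f \<and> 2 \<le> card (f \<inter> e)}"
    then have "2 \<le> card (f \<inter> e)" by simp
    then obtain Q where Q: "Q \<subseteq> f \<inter> e" "card Q = 2" by (rule obtain_subset_with_card_n)
    then obtain p q where pq: "Q = {p,q}" "p \<noteq> q" by (auto simp: card_2_iff)
    then have in1: "p \<in> f" "q \<in> f" "p \<in> e" "q \<in> e" "p \<noteq> v" "q \<noteq> v" using Q e by auto
    then have "card (f - {v,p,q}) = 1" using HD(4,5) f pq by (simp add: card_Diff_subset)
    then obtain b where b: "f - {v,p,q} = {b}" by (auto simp: card_1_singleton_iff)
    then have "f = {v,p,q,b}" "b \<in> V" using f in1 HD(3)[of f] by auto
    then show "f \<in> (\<lambda>(p,q,b). {v,p,q,b}) ` (e \<times> e \<times> V)" using in1 by auto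
  qed
  then have "card {f\<in>E. v \<in> f \<and> 2 \<le> card (f \<inter> e)} \<le> card (e \<times> e \<times> V)"
    by (rule surj_card_le[rotated]) (use HD(1) HD(5)[OF e(1)] in simp)
  then show ?thesis using HD(4)[OF e(1)] by (simp add: card_cartesian_product)
qed

definition wdeg :: "('a set \<Rightarrow> real) \<Rightarrow> 'a set set \<Rightarrow> 'a set \<Rightarrow> 'a \<Rightarrow> real" where
  "wdeg w E U v = (\<Sum>e | e \<in> {e\<in>E. e \<subseteq> U} \<and> v \<in> e. w e)"

text \<open>Inside a random-like set U of density p the weighted degrees are close to the cube of p.\<close>

definition wdev :: "real \<Rightarrow> ('a set \<Rightarrow> real) \<Rightarrow> 'a set set \<Rightarrow> 'a set \<Rightarrow> real" where
  "wdev n w E U = (\<Sum>v\<in>U. (wdeg w E U v - (card U / n)^3)\<^sup>2)"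

lemma wdev_nonneg: "0 \<le> wdev n w E U"
  unfolding wdev_def by (intro sum_nonneg) auto

lemma square_sum_le:
  fixes f :: "'a \<Rightarrow> real"
  assumes "finite A"
  shows "(sum f A)\<^sup>2 \<le> card A * (\<Sum>a\<in>A. (f a)\<^sup>2)"
  using Cauchy_Schwarz_ineq_sum[of "\<lambda>_. 1" f A] by simp

section \<open>The effect of removing one edge on the potential\<close>

context
  fixes V :: "'a set" and E w and n C :: real
  assumes H: "uniform_hypergraph 4 V E" and n: "n = card V" and n0: "0 < n" and C0: "0 \<le> C"
    and w0: "\<And>e. e \<in> E \<Longrightarrow> 0 \<le> w e" and wC: "\<And>e. e \<in> E \<Longrightarrow> w e \<le> C / n^3"
    and w4: "\<And>v. v \<in> V \<Longrightarrow> (\<Sum>e | e \<in> E \<and> v \<in> e. w e) \<le> 4"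
begin

context
  fixes U :: "'a set" and EU X x D u \<Phi> s W
  assumes U: "U \<subseteq> V" "4 \<le> card U"
    and EU: "EU = {e\<in>E. e \<subseteq> U}" and X: "X = wdeg w E U" and u: "u = real (card U)"
    and x: "x = (u / n)^3" and D: "D = (\<lambda>v. X v - x)" and \<Phi>: "\<Phi> = wdev n w E U"
    and s: "s = sum D U" and W: "W = sum w EU"
begin

lemma nibble_basic:
  shows "finite U" "finite EU" "\<And>e. e \<in> EU \<Longrightarrow> e \<in> E \<and> e \<subseteq> U" "\<And>v. X v = (\<Sum>e | e \<in> EU \<and> v \<in> e. w e)"
    "4 \<le> u" "u \<le> n" "0 \<le> x" "x \<le> 1" "\<Phi> = (\<Sum>v\<in>U. (D v)\<^sup>2)" "0 \<le> \<Phi>"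
    "\<And>v. v \<in> U \<Longrightarrow> 0 \<le> X v" "\<And>v. v \<in> U \<Longrightarrow> X v \<le> 4" "\<And>v. v \<in> U \<Longrightarrow> \<bar>D v\<bar> \<le> 4"
    "\<And>f. (\<Sum>v\<in>U. \<Sum>e | e \<in> EU \<and> v \<in> e. f v e) = (\<Sum>e\<in>EU. \<Sum>v\<in>e. f v e :: real)"
proof -
  note HD = uniform_hypergraphD[OF H]
  show fU: "finite U" using U(1) HD(1) by (rule finite_subset)
  show fE: "finite EU" using HD(2) by (simp add: EU)
  show EUD: "\<And>e. e \<in> EU \<Longrightarrow> e \<in> E \<and> e \<subseteq> U" by (simp add: EU)
  show Xe: "\<And>v. X v = (\<Sum>e | e \<in> EU \<and> v \<in> e. w e)" by (simp add: X wdeg_def EU)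
  show "4 \<le> u" using U by (simp add: u)
  have "card U \<le> card V" using HD(1) U(1) by (rule card_mono)
  then show un: "u \<le> n" by (simp add: u n)
  show x0: "0 \<le> x" using n0 by (simp add: x u)
  have "u / n \<le> 1" using un n0 by simp
  then show x1: "x \<le> 1" unfolding x using n0 by (intro power_le_one) (simp_all add: u)
  show \<Phi>D: "\<Phi> = (\<Sum>v\<in>U. (D v)\<^sup>2)" by (simp add: \<Phi> wdev_def D X x u)
  show "0 \<le> \<Phi>" unfolding \<Phi> by (rule wdev_nonneg)
  show X0: "0 \<le> X v" if "v \<in> U" for v unfolding Xe using w0 EUD by (intro sum_nonneg) auto
  show X4: "X v \<le> 4" if "v \<in> U" for v
  proof -
    have "X v \<le> (\<Sum>e | e \<in> E \<and> v \<in> e. w e)"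
      unfolding Xe by (intro sum_mono2) (use HD(2) w0 EUD in auto)
    also have "\<dots> \<le> 4" using that U(1) by (intro w4) auto
    finally show ?thesis .
  qed
  show "\<bar>D v\<bar> \<le> 4" if "v \<in> U" for v using X0[OF that] X4[OF that] x0 x1 by (simp add: D)
  show "\<And>f. (\<Sum>v\<in>U. \<Sum>e | e \<in> EU \<and> v \<in> e. f v e) = (\<Sum>e\<in>EU. \<Sum>v\<in>e. f v e :: real)"
    using fU fE EUD by (intro sum_incidence_swap) auto
qed

lemma nibble_weight: "W = (u * x + s) / 4"
proof -
  note B = nibble_basic
  have "u * x + s = (\<Sum>v\<in>U. X v)" by (simp add: s D sum_subtractf u)
  also have "\<dots> = (\<Sum>e\<in>EU. \<Sum>v\<in>e. w e)" unfolding B(4) by (rule B(14))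
  also have "\<dots> = (\<Sum>e\<in>EU. 4 * w e)"
    using B(3) uniform_hypergraphD(4)[OF H] by (intro sum.cong refl) simp
  finally show ?thesis by (simp add: W sum_distrib_left[symmetric])
qed

text \<open>The weight lost at \<open>v\<close> when \<open>e\<close> is removed, except that an
  edge \<open>f\<close> counts once for every vertex other than \<open>v\<close> that it shares with
  \<open>e\<close>. This version is additive over the vertices of \<open>e\<close>, so that sums
  over \<open>e\<close> can be exchanged; the true loss is not additive.\<close>

definition codeg where "codeg e v = (\<Sum>f | f \<in> EU \<and> v \<in> f. w f * card (f \<inter> e - {v}))"

lemma codeg_bounds:
  assumes e: "e \<in> EU" and v: "v \<in> U"
  shows "0 \<le> codeg e v" "codeg e v \<le> 4 * C / n"
proof -
  note B = nibble_basic and HD = uniform_hypergraphD[OF H]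
  show "0 \<le> codeg e v" unfolding codeg_def using w0 B(3) by (intro sum_nonneg) auto
  have fe: "finite e" "card e = 4" using B(3)[OF e] HD(4,5)[of e] by simp_all
  have ce: "real (card (f \<inter> e - {v})) = (\<Sum>z\<in>e - {v}. of_bool (z \<in> f))" for f
  proof -
    have "real (card (f \<inter> e - {v})) = (\<Sum>z\<in>f \<inter> e - {v}. 1)" by simp
    also have "\<dots> = (\<Sum>z\<in>e - {v}. of_bool (z \<in> f))"
      using fe by (intro sum.mono_neutral_cong_left) auto
    finally show ?thesis .
  qed
  have "codeg e v = (\<Sum>f | f \<in> EU \<and> v \<in> f. \<Sum>z\<in>e - {v}. w f * of_bool (z \<in> f))"
    unfolding codeg_def ce by (simp only: sum_distrib_left)
  also have "\<dots> = (\<Sum>z\<in>e - {v}. \<Sum>f | f \<in> EU \<and> v \<in> f. w f * of_bool (z \<in> f))" by (rule sum.swap)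
  also have "\<dots> \<le> (\<Sum>z\<in>e - {v}. C / n)"
  proof (rule sum_mono)
    fix z assume z: "z \<in> e - {v}"
    have "(\<Sum>f | f \<in> EU \<and> v \<in> f. w f * of_bool (z \<in> f)) = (\<Sum>f\<in>{f\<in>EU. v \<in> f \<and> z \<in> f}. w f)"
      using B(2) by (intro sum.mono_neutral_cong_right) auto
    also have "\<dots> \<le> card {f\<in>EU. v \<in> f \<and> z \<in> f} * (C / n^3)"
      using wC B(3) by (intro sum_bounded_above) auto
    also have "\<dots> \<le> (n * n) * (C / n^3)"
    proof (intro mult_right_mono)
      have "card {f\<in>EU. v \<in> f \<and> z \<in> f} \<le> card {f\<in>E. v \<in> f \<and> z \<in> f}"
        using HD(2) by (intro card_mono) (auto simp: EU)
      also have "\<dots> \<le> card V * card V" using z by (intro card_edges_through_pair[OF H]) auto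
      finally show "card {f\<in>EU. v \<in> f \<and> z \<in> f} \<le> n * n" unfolding n by (metis of_nat_le_iff of_nat_mult)
    qed (use C0 n0 in simp)
    also have "\<dots> = C / n" using n0 by (simp add: power3_eq_cube)
    finally show "(\<Sum>f | f \<in> EU \<and> v \<in> f. w f * of_bool (z \<in> f)) \<le> C / n" .
  qed
  also have "\<dots> = card (e - {v}) * (C / n)" by simp
  also have "\<dots> \<le> 4 * (C / n)"
    using fe C0 n0 card_mono[of e "e - {v}"] by (intro mult_right_mono) auto
  finally show "codeg e v \<le> 4 * C / n" by simp
qed

text \<open>The overcount stems only from the edges through \<open>v\<close> meeting
  \<open>e\<close> at least twice: at most \<open>16*n\<close> of them, each of weight at most
  \<open>C/n^3\<close> and counted at most three times too often.\<close>

lemma codeg_excess: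
  assumes e: "e \<in> EU" and v: "v \<in> U" "v \<notin> e"
  shows "X v - wdeg w E (U - e) v \<le> codeg e v" "codeg e v \<le> X v - wdeg w E (U - e) v + 48 * C / n\<^sup>2"
    "0 \<le> X v - wdeg w E (U - e) v"
proof -
  note B = nibble_basic and HD = uniform_hypergraphD[OF H]
  have fe: "finite e" "card e = 4" using B(3)[OF e] HD(4,5)[of e] by simp_all
  have "{f \<in> EU. v \<in> f} = {f \<in> EU. v \<in> f \<and> f \<inter> e = {}} \<union> {f \<in> EU. v \<in> f \<and> f \<inter> e \<noteq> {}}" by auto
  then have "X v = (\<Sum>f\<in>{f \<in> EU. v \<in> f \<and> f \<inter> e = {}}. w f) + (\<Sum>f\<in>{f \<in> EU. v \<in> f \<and> f \<inter> e \<noteq> {}}. w f)"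
    unfolding B(4) using B(2) by (simp only:) (intro sum.union_disjoint, auto)
  moreover have "(\<Sum>f\<in>{f \<in> EU. v \<in> f \<and> f \<inter> e = {}}. w f) = wdeg w E (U - e) v"
    unfolding wdeg_def EU by (intro sum.cong) auto
  ultimately have \<Delta>: "X v - wdeg w E (U - e) v = (\<Sum>f\<in>{f \<in> EU. v \<in> f \<and> f \<inter> e \<noteq> {}}. w f)" by simp
  also have "\<dots> = (\<Sum>f | f \<in> EU \<and> v \<in> f. w f * of_bool (f \<inter> e \<noteq> {}))"
    using B(2) by (intro sum.mono_neutral_cong_left) auto
  finally have \<Delta>': "X v - wdeg w E (U - e) v = (\<Sum>f | f \<in> EU \<and> v \<in> f. w f * of_bool (f \<inter> e \<noteq> {}))" .
  show "0 \<le> X v - wdeg w E (U - e) v" unfolding \<Delta> using w0 B(3) by (intro sum_nonneg) auto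
  have c1: "of_bool (f \<inter> e \<noteq> {}) \<le> real (card (f \<inter> e))" for f
    using fe by (auto simp: Suc_le_eq card_gt_0_iff)
  have fv: "f \<inter> e - {v} = f \<inter> e" for f using v by auto
  show "X v - wdeg w E (U - e) v \<le> codeg e v"
    unfolding \<Delta>' codeg_def fv using w0 B(3) c1 by (intro sum_mono mult_left_mono) auto
  have c2: "real (card (f \<inter> e)) \<le> of_bool (f \<inter> e \<noteq> {}) + 3 * of_bool (2 \<le> card (f \<inter> e))" for f
  proof -
    have "card (f \<inter> e) \<le> 4" using fe card_mono[of e "f \<inter> e"] by auto
    moreover have "card (f \<inter> e) = 0 \<longleftrightarrow> f \<inter> e = {}" using fe by simp
    ultimately show ?thesis by (cases "card (f \<inter> e) = 0") (auto simp: of_bool_def)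
  qed
  have "codeg e v \<le> (\<Sum>f | f \<in> EU \<and> v \<in> f. w f * of_bool (f \<inter> e \<noteq> {}) + 3 * (w f * of_bool (2 \<le> card (f \<inter> e))))"
    unfolding codeg_def fv
  proof (rule sum_mono)
    fix f assume "f \<in> {f. f \<in> EU \<and> v \<in> f}"
    then have "0 \<le> w f" using w0 B(3) by auto
    then have "w f * card (f \<inter> e) \<le> w f * (of_bool (f \<inter> e \<noteq> {}) + 3 * of_bool (2 \<le> card (f \<inter> e)))"
      by (intro mult_left_mono c2)
    then show "w f * card (f \<inter> e) \<le> w f * of_bool (f \<inter> e \<noteq> {}) + 3 * (w f * of_bool (2 \<le> card (f \<inter> e)))"
      by (simp add: algebra_simps)
  qed
  also have "\<dots> = (X v - wdeg w E (U - e) v) + 3 * (\<Sum>f | f \<in> EU \<and> v \<in> f. w f * of_bool (2 \<le> card (f \<inter> e)))"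
    unfolding \<Delta>' by (simp add: sum.distrib sum_distrib_left)
  also have "(\<Sum>f | f \<in> EU \<and> v \<in> f. w f * of_bool (2 \<le> card (f \<inter> e)))
      = (\<Sum>f\<in>{f\<in>EU. v \<in> f \<and> 2 \<le> card (f \<inter> e)}. w f)"
    using B(2) by (intro sum.mono_neutral_cong_right) auto
  also have "\<dots> \<le> card {f\<in>EU. v \<in> f \<and> 2 \<le> card (f \<inter> e)} * (C / n^3)"
    using wC B(3) by (intro sum_bounded_above) auto
  also have "\<dots> \<le> (16 * n) * (C / n^3)"
  proof (intro mult_right_mono)
    have "card {f\<in>EU. v \<in> f \<and> 2 \<le> card (f \<inter> e)} \<le> card {f\<in>E. v \<in> f \<and> 2 \<le> card (f \<inter> e)}"
      using HD(2) by (intro card_mono) (auto simp: EU)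
    also have "\<dots> \<le> 16 * card V" using B(3)[OF e] v by (intro card_edges_meeting_twice[OF H]) auto
    finally show "card {f\<in>EU. v \<in> f \<and> 2 \<le> card (f \<inter> e)} \<le> 16 * n" unfolding n by linarith
  qed (use C0 n0 in simp)
  also have "(16 * n) * (C / n^3) = 16 * C / n\<^sup>2" using n0 by (simp add: power3_eq_cube power2_eq_square)
  finally show "codeg e v \<le> X v - wdeg w E (U - e) v + 48 * C / n\<^sup>2" by simp
qed

text \<open>The decrease of the target degree \<open>(u/n)^3\<close> when four vertices leave
  \<open>U\<close>.\<close>

definition drift where "drift = x - ((u - 4) / n)^3"

lemma drift_eq: "drift = (12 * u\<^sup>2 - 48 * u + 64) / n^3"
  unfolding drift_def unfolding x power_divide diff_divide_distrib[symmetric]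
  by (simp add: power3_eq_cube power2_eq_square algebra_simps)

lemma drift_bounds: "0 \<le> drift" "drift \<le> 12 * u\<^sup>2 / n^3" "drift \<le> 12 / n"
proof -
  note B = nibble_basic
  have "u * 4 \<le> u * u" using B(5) by (intro mult_left_mono) auto
  then show "0 \<le> drift" unfolding drift_eq using n0 B(5)
    by (intro divide_nonneg_pos) (auto simp: power2_eq_square)
  show 1: "drift \<le> 12 * u\<^sup>2 / n^3" unfolding drift_eq using n0 B(5)
    by (intro divide_right_mono) auto
  have "12 * u\<^sup>2 / n^3 \<le> 12 * n\<^sup>2 / n^3"
    using B(5,6) n0 by (intro divide_right_mono mult_left_mono power_mono) auto
  also have "\<dots> = 12 / n" using n0 by (simp add: power3_eq_cube power2_eq_square)
  finally show "drift \<le> 12 / n" by (rule order.trans[OF 1])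
qed

text \<open>The squares are expanded. Terms linear in the change are kept, since they cancel on
  average over \<open>e\<close>; the quadratic ones are O(1/n^2) per vertex. The sum on the right
  runs over all of \<open>U\<close>, and putting the four removed vertices back costs
  O(1/n).\<close>

lemma wdev_remove_edge:
  assumes e: "e \<in> EU"
  shows "wdev n w E (U - e) \<le> (\<Sum>v\<in>U. (D v)\<^sup>2 - 2 * D v * (codeg e v - drift)) + (16*C\<^sup>2 + 512*C + 528) / n"
proof -
  note B = nibble_basic and HD = uniform_hypergraphD[OF H]
  have eU: "e \<subseteq> U" "finite e" "card e = 4" using B(3)[OF e] HD(4,5)[of e] by simp_all
  define b where "b v = (D v)\<^sup>2 - 2 * D v * (codeg e v - drift)" for v
  have "card (U - e) = card U - 4" using eU B(1) by (simp add: card_Diff_subset)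
  then have cu: "real (card (U - e)) = u - 4" using U by (simp add: u of_nat_diff)
  have 1: "(wdeg w E (U - e) v - ((u - 4) / n)^3)\<^sup>2 \<le> b v + (16*C\<^sup>2 + 384*C + 144) / n\<^sup>2" if v: "v \<in> U - e" for v
  proof -
    have v': "v \<in> U" "v \<notin> e" using v by auto
    define \<Delta> where "\<Delta> = X v - wdeg w E (U - e) v"
    note ce = codeg_excess[OF e v', folded \<Delta>_def]
    have D4: "\<bar>D v\<bar> \<le> 4" by (rule B(13)[OF v'(1)])
    have eq: "wdeg w E (U - e) v - ((u - 4) / n)^3 = D v - (\<Delta> - drift)"
      by (simp add: \<Delta>_def D drift_def)
    have "(wdeg w E (U - e) v - ((u - 4) / n)^3)\<^sup>2 = b v + 2 * (D v * (codeg e v - \<Delta>)) + (\<Delta> - drift)\<^sup>2"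
      unfolding eq b_def by (simp add: power2_eq_square algebra_simps)
    moreover have "D v * (codeg e v - \<Delta>) \<le> 4 * (48 * C / n\<^sup>2)"
      using D4 ce C0 n0 by (intro mult_mono) auto
    moreover have "(\<Delta> - drift)\<^sup>2 \<le> (16*C\<^sup>2 + 144) / n\<^sup>2"
    proof -
      have d0: "0 \<le> \<Delta> * drift" using ce drift_bounds by simp
      have "(\<Delta> - drift)\<^sup>2 = \<Delta>\<^sup>2 + drift\<^sup>2 - 2 * (\<Delta> * drift)" by (simp add: power2_eq_square algebra_simps)
      also have "\<dots> \<le> \<Delta>\<^sup>2 + drift\<^sup>2" using d0 by simp
      also have "\<dots> \<le> (4 * C / n)\<^sup>2 + (12 / n)\<^sup>2"
        using ce drift_bounds codeg_bounds[OF e v'(1)] by (intro add_mono power_mono) auto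
      also have "\<dots> = (16*C\<^sup>2 + 144) / n\<^sup>2" by (simp add: power_divide power_mult_distrib add_divide_distrib)
      finally show ?thesis .
    qed
    ultimately show ?thesis by (simp add: add_divide_distrib)
  qed
  have 2: "- (8 * ((4 * C + 12) / n)) \<le> b v" if v: "v \<in> e" for v
  proof -
    have vU: "v \<in> U" using v eU by auto
    have "\<bar>codeg e v - drift\<bar> \<le> (4 * C + 12) / n"
      using codeg_bounds[OF e vU] drift_bounds(1,3) C0 n0 by (simp add: add_divide_distrib abs_le_iff)
    then have "\<bar>D v\<bar> * \<bar>codeg e v - drift\<bar> \<le> 4 * ((4 * C + 12) / n)" using B(13)[OF vU] by (intro mult_mono) auto
    then have "\<bar>D v * (codeg e v - drift)\<bar> \<le> 4 * ((4 * C + 12) / n)" by (simp add: abs_mult)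
    moreover have "0 \<le> (D v)\<^sup>2" by simp
    ultimately show ?thesis unfolding b_def by (simp only: mult.assoc)
  qed
  have "wdev n w E (U - e) = (\<Sum>v\<in>U - e. (wdeg w E (U - e) v - ((u - 4) / n)^3)\<^sup>2)" by (simp add: wdev_def cu)
  also have "\<dots> \<le> (\<Sum>v\<in>U - e. b v + (16*C\<^sup>2 + 384*C + 144) / n\<^sup>2)" by (intro sum_mono 1)
  also have "\<dots> = sum b (U - e) + (u - 4) * ((16*C\<^sup>2 + 384*C + 144) / n\<^sup>2)" by (simp add: sum.distrib cu)
  also have "\<dots> \<le> sum b (U - e) + n * ((16*C\<^sup>2 + 384*C + 144) / n\<^sup>2)"
    using B(6) C0 by (intro add_mono mult_right_mono divide_nonneg_nonneg) auto
  also have "\<dots> = sum b (U - e) + (16*C\<^sup>2 + 384*C + 144) / n" using n0 by (simp add: power2_eq_square)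
  finally have A: "wdev n w E (U - e) \<le> sum b (U - e) + (16*C\<^sup>2 + 384*C + 144) / n" .
  have "(\<Sum>v\<in>e. - (8 * ((4 * C + 12) / n))) \<le> sum b e" by (intro sum_mono 2)
  then have "- (32 * ((4 * C + 12) / n)) \<le> sum b e" using eU by simp
  moreover have "32 * ((4 * C + 12) / n) = (128 * C + 384) / n" by (simp add: algebra_simps)
  moreover have "sum b U = sum b (U - e) + sum b e" using B(1) eU by (intro sum.subset_diff)
  moreover have "(16*C\<^sup>2 + 512*C + 528) / n = (16*C\<^sup>2 + 384*C + 144) / n + (128 * C + 384) / n"
    by (simp add: add_divide_distrib[symmetric])
  ultimately have "wdev n w E (U - e) \<le> sum b U + (16*C\<^sup>2 + 512*C + 528) / n" using A by linarith
  then show ?thesis unfolding b_def .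
qed

text \<open>After exchanging sums the expression is \<open>\<Sum>z\<in>U. X z * R z\<close>.
  Replacing \<open>X z\<close> by the target \<open>x\<close> gives the main term
  \<open>3*x^2*s\<close> and a nonnegative multiple of \<open>\<Phi>\<close>. The rest, with
  \<open>D z\<close> for \<open>X z\<close>, is the sum over edges \<open>f\<close> of
  \<open>w f\<close> times the square of \<open>sum D f\<close>, minus a diagonal that is at most
  \<open>4*\<Phi>\<close> because weighted degrees are at most 4.\<close>

lemma weighted_codeg: "3 * x\<^sup>2 * s - 4 * \<Phi> \<le> (\<Sum>e\<in>EU. w e * (\<Sum>v\<in>U. D v * codeg e v))"
proof -
  note B = nibble_basic and HD = uniform_hypergraphD[OF H]
  have card4: "finite f" "card f = 4" if "f \<in> EU" for f using B(3)[OF that] HD(4,5)[of f] by simp_all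
  define R where "R z = (\<Sum>f | f \<in> EU \<and> z \<in> f. w f * (sum D f - D z))" for z
  have R: "(\<Sum>v\<in>U. D v * codeg e v) = (\<Sum>z\<in>e. R z)" if e: "e \<in> EU" for e
  proof -
    have "(\<Sum>v\<in>U. D v * codeg e v) = (\<Sum>v\<in>U. \<Sum>f | f \<in> EU \<and> v \<in> f. D v * (w f * card (f \<inter> e - {v})))"
      by (simp add: codeg_def sum_distrib_left)
    also have "\<dots> = (\<Sum>f\<in>EU. \<Sum>v\<in>f. D v * (w f * card (f \<inter> e - {v})))" by (rule B(14))
    also have "\<dots> = (\<Sum>f\<in>EU. \<Sum>z\<in>e. if z \<in> f then w f * (sum D f - D z) else 0)"
    proof (rule sum.cong[OF refl])
      fix f assume f: "f \<in> EU"
      have "(\<Sum>v\<in>f. D v * (w f * card (f \<inter> e - {v}))) = (\<Sum>v\<in>f. \<Sum>z\<in>f \<inter> e. if z \<noteq> v then w f * D v else 0)"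
      proof (rule sum.cong[OF refl])
        fix v
        have "(\<Sum>z\<in>f \<inter> e. if z \<noteq> v then w f * D v else 0) = (\<Sum>z\<in>f \<inter> e - {v}. w f * D v)"
          using card4[OF f] by (intro sum.mono_neutral_cong_right) auto
        then show "D v * (w f * card (f \<inter> e - {v})) = (\<Sum>z\<in>f \<inter> e. if z \<noteq> v then w f * D v else 0)" by simp
      qed
      also have "\<dots> = (\<Sum>z\<in>f \<inter> e. \<Sum>v\<in>f. if z \<noteq> v then w f * D v else 0)" by (rule sum.swap)
      also have "\<dots> = (\<Sum>z\<in>f \<inter> e. w f * (sum D f - D z))"
      proof (rule sum.cong[OF refl])
        fix z assume z: "z \<in> f \<inter> e"
        have "(\<Sum>v\<in>f. if z \<noteq> v then w f * D v else 0) = (\<Sum>v\<in>f - {z}. w f * D v)"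
          using card4[OF f] by (intro sum.mono_neutral_cong_right) auto
        also have "\<dots> = w f * (sum D f - D z)"
          using card4[OF f] z by (simp add: sum_distrib_left[symmetric] sum_diff1)
        finally show "(\<Sum>v\<in>f. if z \<noteq> v then w f * D v else 0) = w f * (sum D f - D z)" .
      qed
      also have "\<dots> = (\<Sum>z\<in>e. if z \<in> f then w f * (sum D f - D z) else 0)"
        using card4[OF e] by (intro sum.mono_neutral_cong_left) auto
      finally show "(\<Sum>v\<in>f. D v * (w f * card (f \<inter> e - {v}))) = (\<Sum>z\<in>e. if z \<in> f then w f * (sum D f - D z) else 0)" .
    qed
    also have "\<dots> = (\<Sum>z\<in>e. \<Sum>f\<in>EU. if z \<in> f then w f * (sum D f - D z) else 0)" by (rule sum.swap)
    also have "\<dots> = (\<Sum>z\<in>e. R z)"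
      unfolding R_def using B(2) by (intro sum.cong refl sum.mono_neutral_cong_right) auto
    finally show ?thesis .
  qed
  have "(\<Sum>e\<in>EU. w e * (\<Sum>v\<in>U. D v * codeg e v)) = (\<Sum>e\<in>EU. \<Sum>z\<in>e. w e * R z)"
    by (intro sum.cong refl) (simp add: R sum_distrib_left)
  also have "\<dots> = (\<Sum>z\<in>U. \<Sum>e | e \<in> EU \<and> z \<in> e. w e * R z)" by (rule B(14)[symmetric])
  also have "\<dots> = (\<Sum>z\<in>U. X z * R z)" by (simp add: B(4) sum_distrib_right)
  also have "\<dots> = (\<Sum>z\<in>U. x * R z + D z * R z)" by (intro sum.cong refl) (simp add: D algebra_simps)
  also have "\<dots> = x * (\<Sum>z\<in>U. R z) + (\<Sum>z\<in>U. D z * R z)" by (simp add: sum.distrib sum_distrib_left)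
  finally have total: "(\<Sum>e\<in>EU. w e * (\<Sum>v\<in>U. D v * codeg e v)) = x * (\<Sum>z\<in>U. R z) + (\<Sum>z\<in>U. D z * R z)" .
  have "(\<Sum>z\<in>U. R z) = (\<Sum>f\<in>EU. \<Sum>z\<in>f. w f * (sum D f - D z))" unfolding R_def by (rule B(14))
  also have "\<dots> = (\<Sum>f\<in>EU. \<Sum>z\<in>f. 3 * (D z * w f))"
  proof (rule sum.cong[OF refl])
    fix f assume f: "f \<in> EU"
    have "(\<Sum>z\<in>f. w f * (sum D f - D z)) = w f * (4 * sum D f - sum D f)"
      using card4[OF f] by (simp add: sum_distrib_left[symmetric] sum_subtractf)
    also have "\<dots> = (\<Sum>z\<in>f. 3 * (D z * w f))"
      by (simp add: sum_distrib_left[symmetric] sum_distrib_right[symmetric])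
    finally show "(\<Sum>z\<in>f. w f * (sum D f - D z)) = (\<Sum>z\<in>f. 3 * (D z * w f))" .
  qed
  also have "\<dots> = (\<Sum>z\<in>U. \<Sum>f | f \<in> EU \<and> z \<in> f. 3 * (D z * w f))" by (rule B(14)[symmetric])
  also have "\<dots> = 3 * (\<Sum>z\<in>U. D z * X z)" by (simp add: B(4) sum_distrib_left)
  also have "(\<Sum>z\<in>U. D z * X z) = (\<Sum>z\<in>U. x * D z + (D z)\<^sup>2)"
    by (intro sum.cong refl) (simp add: D algebra_simps power2_eq_square)
  also have "\<dots> = x * s + \<Phi>" by (simp add: sum.distrib sum_distrib_left s B(9))
  finally have sR: "(\<Sum>z\<in>U. R z) = 3 * (x * s + \<Phi>)" .
  have "(\<Sum>z\<in>U. D z * R z) = (\<Sum>z\<in>U. \<Sum>f | f \<in> EU \<and> z \<in> f. D z * (w f * (sum D f - D z)))"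
    by (simp add: R_def sum_distrib_left)
  also have "\<dots> = (\<Sum>f\<in>EU. \<Sum>z\<in>f. D z * (w f * (sum D f - D z)))" by (rule B(14))
  also have "\<dots> \<ge> (\<Sum>f\<in>EU. \<Sum>z\<in>f. - (w f * (D z)\<^sup>2))"
  proof (rule sum_mono)
    fix f assume f: "f \<in> EU"
    have "(\<Sum>z\<in>f. D z * (w f * (sum D f - D z))) = (\<Sum>z\<in>f. (w f * sum D f) * D z - w f * (D z)\<^sup>2)"
      by (intro sum.cong refl) (simp add: algebra_simps power2_eq_square)
    also have "\<dots> = w f * (sum D f)\<^sup>2 - (\<Sum>z\<in>f. w f * (D z)\<^sup>2)"
      by (simp add: sum_subtractf sum_distrib_left[symmetric] power2_eq_square)
    finally show "(\<Sum>z\<in>f. - (w f * (D z)\<^sup>2)) \<le> (\<Sum>z\<in>f. D z * (w f * (sum D f - D z)))"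
      using w0 B(3)[OF f] by (simp add: sum_negf)
  qed
  also have "(\<Sum>f\<in>EU. \<Sum>z\<in>f. - (w f * (D z)\<^sup>2)) = (\<Sum>z\<in>U. \<Sum>f | f \<in> EU \<and> z \<in> f. - (w f * (D z)\<^sup>2))"
    by (rule B(14)[symmetric])
  also have "\<dots> = (\<Sum>z\<in>U. - (X z * (D z)\<^sup>2))" by (simp add: B(4) sum_distrib_right sum_negf)
  also have "\<dots> \<ge> (\<Sum>z\<in>U. - (4 * (D z)\<^sup>2))"
    using B(12) by (intro sum_mono) (simp add: mult_right_mono)
  also have "(\<Sum>z\<in>U. - (4 * (D z)\<^sup>2)) = - 4 * \<Phi>" by (simp add: B(9) sum_negf sum_distrib_left)
  finally have sDR: "- 4 * \<Phi> \<le> (\<Sum>z\<in>U. D z * R z)" by simp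
  have "0 \<le> 3 * (x * \<Phi>)" using B(7,10) by simp
  then show ?thesis unfolding total sR using sDR by (simp add: algebra_simps power2_eq_square)
qed

text \<open>The mean loss of degree and the fall of the target agree to leading order:
  \<open>drift\<close> is about \<open>12*u^2/n^3\<close> and \<open>W\<close> about
  \<open>u*x/4\<close>, so \<open>drift * W\<close> is about \<open>3*x^2\<close> and the terms
  linear in \<open>s\<close> cancel. What remains is either quadratic in \<open>s\<close>, hence
  bounded by a multiple of \<open>\<Phi>\<close> through Cauchy-Schwarz, or bounded
  absolutely.\<close>

lemma drift_gain: "2 * drift * W * s - 6 * x\<^sup>2 * s \<le> 6 * \<Phi> + 96"
proof -
  note B = nibble_basic
  have "s\<^sup>2 \<le> u * \<Phi>" unfolding s B(9) u by (rule square_sum_le[OF B(1)])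
  then have "drift * s\<^sup>2 \<le> (12 * u\<^sup>2 / n^3) * (u * \<Phi>)"
    using drift_bounds B(5,10) n0 by (intro mult_mono) auto
  also have "\<dots> = 12 * (x * \<Phi>)" by (simp add: x power_divide power3_eq_cube power2_eq_square)
  also have "\<dots> \<le> 12 * (1 * \<Phi>)" using B(8,10) by (intro mult_left_mono mult_right_mono) auto
  finally have 1: "drift * s\<^sup>2 \<le> 12 * \<Phi>" by simp
  define q where "q = drift * u / 2 - 6 * x"
  have "q = (32 * u - 24 * u\<^sup>2) / n^3"
    unfolding q_def drift_eq by (simp add: x power_divide power2_eq_square power3_eq_cube diff_divide_distrib add_divide_distrib algebra_simps)
  moreover have "\<bar>32 * u - 24 * u\<^sup>2\<bar> \<le> 24 * n\<^sup>2"
  proof -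
    have "u * 4 \<le> u * u" using B(5) by (intro mult_left_mono) auto
    moreover have "u * u \<le> n * n" using B(5,6) by (intro mult_mono) auto
    ultimately show ?thesis using B(5) by (simp add: power2_eq_square abs_le_iff)
  qed
  ultimately have "\<bar>q\<bar> \<le> 24 * n\<^sup>2 / n^3" using n0 by (simp add: abs_divide divide_right_mono)
  then have q: "\<bar>q\<bar> \<le> 24 / n" using n0 by (simp add: power3_eq_cube power2_eq_square)
  have "\<bar>s\<bar> \<le> (\<Sum>v\<in>U. \<bar>D v\<bar>)" unfolding s by (rule sum_abs)
  also have "\<dots> \<le> real (card U) * 4" using B(13) by (intro sum_bounded_above)
  also have "\<dots> \<le> n * 4" using B(6) by (simp add: u)
  finally have sn: "\<bar>s\<bar> \<le> n * 4" .
  have "x * s * q \<le> \<bar>x * s * q\<bar>" by simp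
  also have "\<dots> = x * (\<bar>s\<bar> * \<bar>q\<bar>)" using B(7) by (simp add: abs_mult)
  also have "\<dots> \<le> 1 * ((n * 4) * (24 / n))" using B(7,8) q sn n0 by (intro mult_mono) auto
  also have "\<dots> = 96" using n0 by simp
  finally have 2: "x * s * q \<le> 96" .
  have "2 * drift * W * s - 6 * x\<^sup>2 * s = x * s * q + drift * s\<^sup>2 / 2"
    unfolding nibble_weight q_def by (simp add: power2_eq_square field_simps)
  with 1 2 show ?thesis by linarith
qed

text \<open>The weighted average of the potential after removal, with edge weights \<open>w\<close>,
  is at most the stated value, so some edge does no worse. This replaces the random choice of an
  edge.\<close>

lemma nibble_step:
  assumes W0: "0 < W"
  shows "\<exists>e\<in>EU. wdev n w E (U - e) \<le> \<Phi> + (16*C\<^sup>2 + 512*C + 528) / n + (14 * \<Phi> + 96) / W"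
proof (rule ccontr)
  note B = nibble_basic
  define C1 where "C1 = (16*C\<^sup>2 + 512*C + 528) / n"
  define T where "T = \<Phi> + C1 + (14 * \<Phi> + 96) / W"
  assume "\<not> ?thesis"
  then have gt: "T < wdev n w E (U - e)" if "e \<in> EU" for e using that by (auto simp: T_def C1_def not_le)
  have we: "0 \<le> w e" if "e \<in> EU" for e using w0 B(3)[OF that] by simp
  have "(\<Sum>e\<in>EU. w e * wdev n w E (U - e))
    \<le> (\<Sum>e\<in>EU. w e * ((\<Phi> + 2 * drift * s + C1) - 2 * (\<Sum>v\<in>U. D v * codeg e v)))"
  proof (intro sum_mono mult_left_mono we)
    fix e assume e: "e \<in> EU"
    have "(\<Sum>v\<in>U. (D v)\<^sup>2 - 2 * D v * (codeg e v - drift))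
      = (\<Sum>v\<in>U. (D v)\<^sup>2 + 2 * drift * D v - 2 * (D v * codeg e v))"
      by (intro sum.cong refl) (simp add: algebra_simps)
    also have "\<dots> = \<Phi> + 2 * drift * s - 2 * (\<Sum>v\<in>U. D v * codeg e v)"
      by (simp add: sum_subtractf sum.distrib sum_distrib_left s B(9))
    finally show "wdev n w E (U - e) \<le> (\<Phi> + 2 * drift * s + C1) - 2 * (\<Sum>v\<in>U. D v * codeg e v)"
      using wdev_remove_edge[OF e] by (simp add: C1_def)
  qed
  also have "\<dots> = W * (\<Phi> + 2 * drift * s + C1) - 2 * (\<Sum>e\<in>EU. w e * (\<Sum>v\<in>U. D v * codeg e v))"
    by (simp add: right_diff_distrib sum_subtractf W sum_distrib_right sum_distrib_left mult.left_commute)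
  also have "\<dots> \<le> W * (\<Phi> + 2 * drift * s + C1) - 2 * (3 * x\<^sup>2 * s - 4 * \<Phi>)"
    using weighted_codeg by simp
  also have "\<dots> = W * (\<Phi> + C1) + (2 * drift * W * s - 6 * x\<^sup>2 * s) + 8 * \<Phi>" by (simp add: algebra_simps)
  also have "\<dots> \<le> W * (\<Phi> + C1) + (6 * \<Phi> + 96) + 8 * \<Phi>" using drift_gain by simp
  also have "\<dots> = W * T"
  proof -
    have "W * ((14 * \<Phi> + 96) / W) = 14 * \<Phi> + 96" using W0 by simp
    then show ?thesis unfolding T_def distrib_left by linarith
  qed
  finally have "(\<Sum>e\<in>EU. w e * (wdev n w E (U - e) - T)) \<le> 0"
    by (simp add: right_diff_distrib sum_subtractf W sum_distrib_right)
  moreover have nn: "0 \<le> w e * (wdev n w E (U - e) - T)" if "e \<in> EU" for e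
    using we[OF that] gt[OF that] by simp
  ultimately have "(\<Sum>e\<in>EU. w e * (wdev n w E (U - e) - T)) = 0" by (meson antisym sum_nonneg)
  then have "\<forall>e\<in>EU. w e * (wdev n w E (U - e) - T) = 0"
    using sum_nonneg_eq_0_iff[OF B(2), of "\<lambda>e. w e * (wdev n w E (U - e) - T)"] nn by simp
  then have "\<forall>e\<in>EU. w e = 0" using gt by fastforce
  then show False using W0 by (simp add: W)
qed

text \<open>By Cauchy-Schwarz a small potential keeps the absolute value of \<open>s\<close> below
  \<open>u*x/2\<close>, so at least half of the expected weight \<open>u*x/4\<close> is still inside
  \<open>U\<close> and the division by \<open>W\<close> in \<open>nibble_step\<close> is
  harmless.\<close>

lemma nibble_weight_ge:
  assumes "\<Phi> \<le> u * x\<^sup>2 / 4"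
  shows "u * x / 8 \<le> W"
proof -
  note B = nibble_basic
  have "s\<^sup>2 \<le> u * \<Phi>" unfolding s B(9) u by (rule square_sum_le[OF B(1)])
  also have "\<dots> \<le> u * (u * x\<^sup>2 / 4)" using assms B(5) by (intro mult_left_mono) auto
  also have "\<dots> = (u * x / 2)\<^sup>2" by (simp add: power2_eq_square)
  finally have "\<bar>s\<bar> \<le> \<bar>u * x / 2\<bar>" by (simp only: abs_le_square_iff)
  then have "\<bar>s\<bar> \<le> u * x / 2" using B(5,7) by simp
  then show ?thesis unfolding nibble_weight by simp
qed

end
end

text \<open>Per removed edge the potential grows by a factor at most \<open>1 + A/n\<close> and a
  term \<open>G/n\<close>, hence over at most \<open>n\<close> steps by \<open>exp A\<close> and a
  bounded term. It is essential that \<epsilon> does not depend on \<open>C\<close>, because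
  \<open>C\<close> is obtained from \<epsilon> in \<open>fractional_or_extremal\<close>; the part
  that depends on \<open>C\<close> is made negligible by \<open>n\<^sub>0\<close>.\<close>

lemma nibble:
  fixes \<zeta> :: real
  assumes \<zeta>: "0 < \<zeta>" "\<zeta> \<le> 1"
  shows "\<exists>\<epsilon>>0. \<forall>C\<ge>0. \<exists>n\<^sub>0::nat. \<forall>(V :: 'a set) E w. uniform_hypergraph 4 V E \<longrightarrow> n\<^sub>0 \<le> card V \<longrightarrow>
    (\<forall>e\<in>E. 0 \<le> w e \<and> w e \<le> C / real (card V)^3) \<longrightarrow>
    (\<forall>v\<in>V. (\<Sum>e | e \<in> E \<and> v \<in> e. w e) \<le> 4) \<longrightarrow>
    (\<Sum>v\<in>V. ((\<Sum>e | e \<in> E \<and> v \<in> e. w e) - 1)\<^sup>2) \<le> \<epsilon> * real (card V) \<longrightarrow>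
    (\<exists>M\<subseteq>E. pairwise disjnt M \<and> card (V - \<Union>M) \<le> \<zeta> * card V)"
proof -
  \<comment> \<open>While more than \<open>\<zeta>*n\<close> vertices are uncovered,
    \<open>W\<close> is at least \<open>\<zeta>^4*n/8\<close>, so \<open>14*\<Phi>/W\<close> is at
    most \<open>A/n*\<Phi>\<close>. The power \<open>\<zeta>^7\<close> below comes from
    \<open>u*x^2 \<ge> \<zeta>^7*n\<close>, which makes the hypothesis of
    \<open>nibble_weight_ge\<close> hold throughout.\<close>
  define A where "A = 112 / \<zeta>^4"
  define \<epsilon> where "\<epsilon> = exp (- A) * \<zeta>^7 / 8"
  have A0: "0 < A" and \<epsilon>0: "0 < \<epsilon>" using \<zeta> by (simp_all add: A_def \<epsilon>_def)
  have main: "\<exists>M\<subseteq>E. pairwise disjnt M \<and> card (V - \<Union>M) \<le> \<zeta> * card V"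
    if C0: "0 \<le> C" and G: "G = 16*C\<^sup>2 + 512*C + 528 + 768 / \<zeta>^4"
      and H: "uniform_hypergraph 4 V E" and n: "n = real (card V)"
      and nbig: "8 * G * exp A / \<zeta>^7 \<le> n" "4 / \<zeta> \<le> n"
      and w: "\<And>e. e \<in> E \<Longrightarrow> 0 \<le> w e" "\<And>e. e \<in> E \<Longrightarrow> w e \<le> C / n^3"
      and w4: "\<And>v. v \<in> V \<Longrightarrow> (\<Sum>e | e \<in> E \<and> v \<in> e. w e) \<le> 4"
      and dev: "(\<Sum>v\<in>V. ((\<Sum>e | e \<in> E \<and> v \<in> e. w e) - 1)\<^sup>2) \<le> \<epsilon> * n"
    for C G n :: real and V :: "'a set" and E w
  proof -
    note HD = uniform_hypergraphD[OF H]
    have n0: "0 < n" using nbig(2) \<zeta> by (smt (verit) divide_pos_pos)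
    have G0: "0 \<le> G" unfolding G using C0 \<zeta> by (intro add_nonneg_nonneg) auto
    have "wdev n w E V = (\<Sum>v\<in>V. ((\<Sum>e | e \<in> E \<and> v \<in> e. w e) - 1)\<^sup>2)"
    proof -
      have "{e. e \<in> {e \<in> E. e \<subseteq> V} \<and> v \<in> e} = {e. e \<in> E \<and> v \<in> e}" for v using HD(3) by blast
      then show ?thesis using n0 by (simp add: wdev_def wdeg_def n)
    qed
    then have start: "wdev n w E V \<le> \<epsilon> * n" using dev by simp
    have step: "(\<exists>M\<subseteq>E. pairwise disjnt M \<and> card (V - \<Union>M) \<le> \<zeta> * n) \<or>
      (\<exists>M\<subseteq>E. pairwise disjnt M \<and> card (V - \<Union>M) + 4 * t = card V \<and>
        wdev n w E (V - \<Union>M) \<le> (1 + A / n)^t * (\<epsilon> * n + t * (G / n)))" for t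
    proof (induction t)
      case 0
      have "\<exists>M\<subseteq>E. pairwise disjnt M \<and> card (V - \<Union>M) + 4 * 0 = card V \<and>
        wdev n w E (V - \<Union>M) \<le> (1 + A / n)^0 * (\<epsilon> * n + real 0 * (G / n))"
        using start by (intro exI[of _ "{}"]) simp
      then show ?case by (rule disjI2)
    next
      case (Suc t)
      then show ?case
      proof (elim disjE)
        assume "\<exists>M\<subseteq>E. pairwise disjnt M \<and> card (V - \<Union>M) + 4 * t = card V \<and>
          wdev n w E (V - \<Union>M) \<le> (1 + A / n)^t * (\<epsilon> * n + t * (G / n))"
        then obtain M where M: "M \<subseteq> E" "pairwise disjnt M" "card (V - \<Union>M) + 4 * t = card V"
          and \<Phi>le: "wdev n w E (V - \<Union>M) \<le> (1 + A / n)^t * (\<epsilon> * n + t * (G / n))" by blast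
        define U where "U = V - \<Union>M"
        define u where "u = real (card U)"
        define \<Phi> where "\<Phi> = wdev n w E U"
        show ?case
        proof (cases "u \<le> \<zeta> * n")
          case True
          then show ?thesis using M unfolding u_def U_def by blast
        next
          case False
          then have u\<zeta>: "\<zeta> * n \<le> u" by simp
          have "4 \<le> \<zeta> * n" using nbig(2) \<zeta> by (simp add: pos_divide_le_eq mult.commute)
          then have u4: "4 \<le> card U" using u\<zeta> by (simp add: u_def)
          have UV: "U \<subseteq> V" by (auto simp: U_def)
          define x where "x = (u / n)^3"
          define W where "W = sum w {e\<in>E. e \<subseteq> U}"
          have tn: "real t \<le> n" using M(3) by (simp add: n)
          have "(1 + A / n)^t \<le> exp (A / n)^t"
            using A0 n0 by (intro power_mono exp_ge_add_one_self) auto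
          also have "\<dots> = exp (real t * (A / n))" by (simp only: exp_of_nat_mult)
          also have "\<dots> \<le> exp A"
          proof -
            have "real t * (A / n) \<le> n * (A / n)" using A0 n0 tn by (intro mult_right_mono) auto
            then show ?thesis using n0 by simp
          qed
          finally have pw: "(1 + A / n)^t \<le> exp A" .
          have "t * (G / n) \<le> n * (G / n)" using tn G0 n0 by (intro mult_right_mono) auto
          then have tG: "t * (G / n) \<le> G" using n0 by simp
          have "\<Phi> \<le> (1 + A / n)^t * (\<epsilon> * n + t * (G / n))" using \<Phi>le by (simp add: \<Phi>_def U_def)
          also have "\<dots> \<le> exp A * (\<epsilon> * n + G)"
            using pw tG G0 A0 n0 \<epsilon>0 by (intro mult_mono add_mono) auto
          also have "\<dots> = \<zeta>^7 * n / 8 + exp A * G" by (simp add: \<epsilon>_def exp_minus field_simps)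
          also have "exp A * G \<le> \<zeta>^7 * n / 8"
            using nbig(1) \<zeta> by (simp add: pos_divide_le_eq mult.commute mult.left_commute)
          finally have \<Phi>small: "\<Phi> \<le> \<zeta>^7 * n / 4" by linarith
          have un: "\<zeta> \<le> u / n" using u\<zeta> n0 by (simp add: pos_le_divide_eq)
          have x\<zeta>: "\<zeta>^3 \<le> x" unfolding x_def using un \<zeta> by (intro power_mono) auto
          have "\<zeta>^7 * n = (\<zeta> * n) * (\<zeta>^3)\<^sup>2" by (simp add: power_mult[symmetric] mult.commute mult.left_commute flip: power_Suc2 power_Suc)
          also have "\<dots> \<le> u * x\<^sup>2" using u\<zeta> x\<zeta> \<zeta> n0 by (intro mult_mono power_mono) (auto simp: u_def)
          finally have \<Phi>x: "\<Phi> \<le> u * x\<^sup>2 / 4" using \<Phi>small by (simp add: mult.commute)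
          have Wux: "u * x / 8 \<le> W"
            by (rule nibble_weight_ge[OF H n n0 C0 w w4 UV u4 refl refl u_def x_def refl \<Phi>_def refl W_def \<Phi>x])
          have "\<zeta>^4 * n = (\<zeta> * n) * \<zeta>^3" by (simp add: eval_nat_numeral)
          also have "\<dots> \<le> u * x" using u\<zeta> x\<zeta> \<zeta> n0 by (intro mult_mono) (auto simp: u_def)
          finally have W\<zeta>: "\<zeta>^4 * n / 8 \<le> W" using Wux by simp
          have \<zeta>n: "0 < \<zeta>^4 * n / 8" using \<zeta> n0 by simp
          then have W0: "0 < W" using W\<zeta> by simp
          have \<Phi>0: "0 \<le> \<Phi>" unfolding \<Phi>_def by (rule wdev_nonneg)
          obtain e where e: "e \<in> E" "e \<subseteq> U" and e\<Phi>:
            "wdev n w E (U - e) \<le> \<Phi> + (16*C\<^sup>2 + 512*C + 528) / n + (14 * \<Phi> + 96) / W"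
            using nibble_step[OF H n n0 C0 w w4 UV u4 refl refl u_def x_def refl \<Phi>_def refl W_def W0] by blast
          have "(14 * \<Phi> + 96) / W \<le> (14 * \<Phi> + 96) / (\<zeta>^4 * n / 8)"
            using W\<zeta> \<zeta>n \<Phi>0 by (intro divide_left_mono) auto
          also have "\<dots> = \<Phi> * (A / n) + (768 / \<zeta>^4) / n"
            using \<zeta> n0 by (simp add: A_def field_simps)
          finally have "wdev n w E (U - e) \<le> \<Phi> * (1 + A / n) + G / n"
            using e\<Phi> by (simp add: G add_divide_distrib algebra_simps)
          also have "\<dots> \<le> ((1 + A / n)^t * (\<epsilon> * n + t * (G / n))) * (1 + A / n) + (1 + A / n)^Suc t * (G / n)"
          proof (rule add_mono)
            show "\<Phi> * (1 + A / n) \<le> ((1 + A / n)^t * (\<epsilon> * n + t * (G / n))) * (1 + A / n)"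
              using \<Phi>le A0 n0 unfolding \<Phi>_def U_def by (intro mult_right_mono) auto
            have "1 \<le> (1 + A / n)^Suc t" using A0 n0 by (intro one_le_power) auto
            then have "1 * (G / n) \<le> (1 + A / n)^Suc t * (G / n)" using G0 n0 by (intro mult_right_mono) auto
            then show "G / n \<le> (1 + A / n)^Suc t * (G / n)" by simp
          qed
          also have "(r^t * (a + t * q)) * r + r^Suc t * q = r^Suc t * (a + Suc t * q)" for r a q :: real
            by (simp add: algebra_simps)
          finally have \<Phi>': "wdev n w E (U - e) \<le> (1 + A / n)^Suc t * (\<epsilon> * n + Suc t * (G / n))" .
          have U': "V - \<Union>(insert e M) = U - e" by (auto simp: U_def)
          have ce: "card e = 4" "finite e" using HD(4,5) e by auto
          have "card (U - e) = card U - 4" using ce e by (simp add: card_Diff_subset)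
          then have "card (V - \<Union>(insert e M)) + 4 * Suc t = card V" using M(3) u4 unfolding U' by (simp add: U_def)
          moreover have "pairwise disjnt (insert e M)"
            using M(2) e(2) by (auto simp: pairwise_insert disjnt_def U_def)
          ultimately have "insert e M \<subseteq> E \<and> pairwise disjnt (insert e M) \<and>
            card (V - \<Union>(insert e M)) + 4 * Suc t = card V \<and>
            wdev n w E (V - \<Union>(insert e M)) \<le> (1 + A / n)^Suc t * (\<epsilon> * n + Suc t * (G / n))"
            using e M(1) \<Phi>' unfolding U' by blast
          then show ?thesis by blast
        qed
      qed blast
    qed
    \<comment> \<open>So many edges would cover more vertices than there are, which leaves only the
      first alternative.\<close>
    from step[of "Suc (card V)"] show ?thesis
    proof (elim disjE)
      assume "\<exists>M\<subseteq>E. pairwise disjnt M \<and> card (V - \<Union>M) + 4 * Suc (card V) = card V \<and>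
        wdev n w E (V - \<Union>M) \<le> (1 + A / n)^Suc (card V) * (\<epsilon> * n + Suc (card V) * (G / n))"
      then show ?thesis by auto
    qed (simp add: n)
  qed
  show ?thesis
  proof (rule exI[of _ \<epsilon>], intro conjI allI impI)
    show "0 < \<epsilon>" by (rule \<epsilon>0)
    fix C :: real assume C0: "0 \<le> C"
    define G where "G = 16*C\<^sup>2 + 512*C + 528 + 768 / \<zeta>^4"
    define n\<^sub>0 where "n\<^sub>0 = nat \<lceil>max (8 * G * exp A / \<zeta>^7) (4 / \<zeta>)\<rceil>"
    show "\<exists>n\<^sub>0::nat. \<forall>(V :: 'a set) E w. uniform_hypergraph 4 V E \<longrightarrow> n\<^sub>0 \<le> card V \<longrightarrow>
      (\<forall>e\<in>E. 0 \<le> w e \<and> w e \<le> C / real (card V)^3) \<longrightarrow>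
      (\<forall>v\<in>V. (\<Sum>e | e \<in> E \<and> v \<in> e. w e) \<le> 4) \<longrightarrow>
      (\<Sum>v\<in>V. ((\<Sum>e | e \<in> E \<and> v \<in> e. w e) - 1)\<^sup>2) \<le> \<epsilon> * real (card V) \<longrightarrow>
      (\<exists>M\<subseteq>E. pairwise disjnt M \<and> card (V - \<Union>M) \<le> \<zeta> * card V)"
    proof (rule exI[of _ n\<^sub>0], intro allI impI)
      fix V :: "'a set" and E w
      assume *: "uniform_hypergraph 4 V E" "n\<^sub>0 \<le> card V" "\<forall>e\<in>E. 0 \<le> w e \<and> w e \<le> C / real (card V)^3"
        "\<forall>v\<in>V. (\<Sum>e | e \<in> E \<and> v \<in> e. w e) \<le> 4"
        "(\<Sum>v\<in>V. ((\<Sum>e | e \<in> E \<and> v \<in> e. w e) - 1)\<^sup>2) \<le> \<epsilon> * real (card V)"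
      have "max (8 * G * exp A / \<zeta>^7) (4 / \<zeta>) \<le> real n\<^sub>0" unfolding n\<^sub>0_def by linarith
      then have "8 * G * exp A / \<zeta>^7 \<le> card V" "4 / \<zeta> \<le> card V" using *(2) by linarith+
      then show "\<exists>M\<subseteq>E. pairwise disjnt M \<and> card (V - \<Union>M) \<le> \<zeta> * card V"
        using * by (intro main[OF C0 G_def *(1) refl, of w]) auto
    qed
  qed
qed

text \<open>The two preceding results are chained: \<gamma> from \<eta>, then \<epsilon> from
  \<zeta> by the nibble, then \<open>C\<close> from \<epsilon>, and finally the size bound from
  \<open>C\<close>.\<close>

lemma almost_perfect_or_extremal:
  fixes \<eta> :: real
  assumes \<eta>: "0 < \<eta>"
  shows "\<exists>\<gamma>>0. \<forall>\<zeta>. 0 < \<zeta> \<and> \<zeta> \<le> 1 \<longrightarrow> (\<exists>n\<^sub>0::nat. \<forall>(V :: 'a set) E. uniform_hypergraph 4 V E \<longrightarrow> n\<^sub>0 \<le> card V \<longrightarrow>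
    (\<forall>v\<in>V. (37/64 - \<gamma>) * real (card V)^3 / 6 \<le> vertex_degree E v) \<longrightarrow>
    (\<exists>B\<subseteq>V. (3/4 - \<eta>) * card V \<le> card B \<and> card {e\<in>E. e \<subseteq> B} \<le> \<eta> * real (card V)^4) \<or>
    (\<exists>M\<subseteq>E. pairwise disjnt M \<and> card (V - \<Union>M) \<le> \<zeta> * real (card V)))"
proof -
  from fractional_or_extremal[OF \<eta>, where 'a = 'a] obtain \<gamma> where \<gamma>: "0 < \<gamma>" and
    fr: "\<forall>\<epsilon>::real. 0 < \<epsilon> \<longrightarrow> (\<exists>C::real. 0 \<le> C \<and> (\<forall>(V :: 'a set) E. uniform_hypergraph 4 V E \<longrightarrow> V \<noteq> {} \<longrightarrow>
    (\<forall>v\<in>V. (37/64 - \<gamma>) * real (card V)^3 / 6 \<le> vertex_degree E v) \<longrightarrow>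
    (\<exists>B\<subseteq>V. (3/4 - \<eta>) * card V \<le> card B \<and> card {e\<in>E. e \<subseteq> B} \<le> \<eta> * real (card V)^4) \<or>
    (\<exists>w :: 'a set \<Rightarrow> real. (\<forall>e\<in>E. 0 \<le> w e \<and> w e \<le> C / real (card V)^3) \<and>
       (\<forall>v\<in>V. (\<Sum>e | e \<in> E \<and> v \<in> e. w e) \<le> 4) \<and>
       (\<Sum>v\<in>V. ((\<Sum>e | e \<in> E \<and> v \<in> e. w e) - 1)\<^sup>2) \<le> \<epsilon> * real (card V))))"
    by (elim exE conjE)
  have "\<exists>n\<^sub>0::nat. \<forall>(V :: 'a set) E. uniform_hypergraph 4 V E \<longrightarrow> n\<^sub>0 \<le> card V \<longrightarrow>
    (\<forall>v\<in>V. (37/64 - \<gamma>) * real (card V)^3 / 6 \<le> vertex_degree E v) \<longrightarrow>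
    (\<exists>B\<subseteq>V. (3/4 - \<eta>) * card V \<le> card B \<and> card {e\<in>E. e \<subseteq> B} \<le> \<eta> * real (card V)^4) \<or>
    (\<exists>M\<subseteq>E. pairwise disjnt M \<and> card (V - \<Union>M) \<le> \<zeta> * real (card V))" if \<zeta>: "0 < \<zeta>" "\<zeta> \<le> 1" for \<zeta> :: real
  proof -
    from nibble[OF \<zeta>, where 'a = 'a] obtain \<epsilon> where \<epsilon>: "0 < \<epsilon>" and
      nb: "\<forall>C\<ge>0. \<exists>n\<^sub>0::nat. \<forall>(V :: 'a set) E w. uniform_hypergraph 4 V E \<longrightarrow> n\<^sub>0 \<le> card V \<longrightarrow>
    (\<forall>e\<in>E. 0 \<le> w e \<and> w e \<le> C / real (card V)^3) \<longrightarrow>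
    (\<forall>v\<in>V. (\<Sum>e | e \<in> E \<and> v \<in> e. w e) \<le> 4) \<longrightarrow>
    (\<Sum>v\<in>V. ((\<Sum>e | e \<in> E \<and> v \<in> e. w e) - 1)\<^sup>2) \<le> \<epsilon> * real (card V) \<longrightarrow>
    (\<exists>M\<subseteq>E. pairwise disjnt M \<and> card (V - \<Union>M) \<le> \<zeta> * card V)"
      by (elim exE conjE)
    from fr[rule_format, OF \<epsilon>] obtain C where C: "0 \<le> C" and
      fr': "\<forall>(V :: 'a set) E. uniform_hypergraph 4 V E \<longrightarrow> V \<noteq> {} \<longrightarrow>
    (\<forall>v\<in>V. (37/64 - \<gamma>) * real (card V)^3 / 6 \<le> vertex_degree E v) \<longrightarrow>
    (\<exists>B\<subseteq>V. (3/4 - \<eta>) * card V \<le> card B \<and> card {e\<in>E. e \<subseteq> B} \<le> \<eta> * real (card V)^4) \<or>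
    (\<exists>w :: 'a set \<Rightarrow> real. (\<forall>e\<in>E. 0 \<le> w e \<and> w e \<le> C / real (card V)^3) \<and>
       (\<forall>v\<in>V. (\<Sum>e | e \<in> E \<and> v \<in> e. w e) \<le> 4) \<and>
       (\<Sum>v\<in>V. ((\<Sum>e | e \<in> E \<and> v \<in> e. w e) - 1)\<^sup>2) \<le> \<epsilon> * real (card V))"
      by (elim exE conjE)
    from nb[rule_format, OF C] obtain n\<^sub>0 :: nat where nb': "\<forall>(V :: 'a set) E w. uniform_hypergraph 4 V E \<longrightarrow> n\<^sub>0 \<le> card V \<longrightarrow>
    (\<forall>e\<in>E. 0 \<le> w e \<and> w e \<le> C / real (card V)^3) \<longrightarrow>
    (\<forall>v\<in>V. (\<Sum>e | e \<in> E \<and> v \<in> e. w e) \<le> 4) \<longrightarrow>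
    (\<Sum>v\<in>V. ((\<Sum>e | e \<in> E \<and> v \<in> e. w e) - 1)\<^sup>2) \<le> \<epsilon> * real (card V) \<longrightarrow>
    (\<exists>M\<subseteq>E. pairwise disjnt M \<and> card (V - \<Union>M) \<le> \<zeta> * card V)"
      by (elim exE)
    show ?thesis
    proof (rule exI[of _ "max 1 n\<^sub>0"], intro allI impI)
      fix V :: "'a set" and E
      assume H: "uniform_hypergraph 4 V E" and n: "max 1 n\<^sub>0 \<le> card V"
        and deg: "\<forall>v\<in>V. (37/64 - \<gamma>) * real (card V)^3 / 6 \<le> vertex_degree E v"
      have "V \<noteq> {}" using n by auto
      from fr'[THEN spec, THEN spec, THEN mp, OF H, THEN mp, OF this, THEN mp, OF deg]
      show "(\<exists>B\<subseteq>V. (3/4 - \<eta>) * card V \<le> card B \<and> card {e\<in>E. e \<subseteq> B} \<le> \<eta> * real (card V)^4) \<or>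
        (\<exists>M\<subseteq>E. pairwise disjnt M \<and> card (V - \<Union>M) \<le> \<zeta> * real (card V))"
      proof (elim disjE exE conjE)
        fix w :: "'a set \<Rightarrow> real"
        assume w: "\<forall>e\<in>E. 0 \<le> w e \<and> w e \<le> C / real (card V)^3" "\<forall>v\<in>V. (\<Sum>e | e \<in> E \<and> v \<in> e. w e) \<le> 4"
          "(\<Sum>v\<in>V. ((\<Sum>e | e \<in> E \<and> v \<in> e. w e) - 1)\<^sup>2) \<le> \<epsilon> * real (card V)"
        have "n\<^sub>0 \<le> card V" using n by simp
        with nb' H w show ?thesis by blast
      qed blast
    qed
  qed
  then show ?thesis using \<gamma> by blast
qed

section \<open>Absorption\<close>

definition matchable :: "'a set set \<Rightarrow> 'a set \<Rightarrow> bool" where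
  "matchable E W \<longleftrightarrow> (\<exists>M. perfect_matching W E M)"

lemma matchable_Union:
  assumes "M \<subseteq> E" "pairwise disjnt M"
  shows "matchable E (\<Union>M)"
  using assms by (auto simp: matchable_def perfect_matching_def)

lemma matchable_empty: "matchable E {}"
  using matchable_Union[of "{}" E] by simp

lemma matchable_edge: "e \<in> E \<Longrightarrow> matchable E e"
  using matchable_Union[of "{e}" E] by (simp add: pairwise_singleton)

lemma matchable_Un:
  assumes "matchable E A" "matchable E B" "A \<inter> B = {}"
  shows "matchable E (A \<union> B)"
proof -
  obtain M N where M: "M \<subseteq> E" "pairwise disjnt M" "\<Union>M = A" and N: "N \<subseteq> E" "pairwise disjnt N" "\<Union>N = B"
    using assms(1,2) by (auto simp: matchable_def perfect_matching_def)
  have "pairwise disjnt (M \<union> N)"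
  proof (rule pairwiseI)
    fix e f assume ef: "e \<in> M \<union> N" "f \<in> M \<union> N" "e \<noteq> f"
    have "disjnt e f" if "e \<in> M" "f \<in> N" for e f
    proof -
      have "e \<subseteq> A" "f \<subseteq> B" using that M(3) N(3) by blast+
      then show ?thesis using assms(3) unfolding disjnt_def by blast
    qed
    then show "disjnt e f" using ef M(2) N(2) by (metis Un_iff disjnt_sym pairwiseD)
  qed
  moreover have "M \<union> N \<subseteq> E" using M N by blast
  moreover have "\<Union>(M \<union> N) = A \<union> B" using M N by blast
  ultimately show ?thesis unfolding matchable_def perfect_matching_def by blast
qed

lemma matchable_disjoint_Union:
  assumes "finite \<A>" "pairwise disjnt \<A>" "\<And>A. A \<in> \<A> \<Longrightarrow> matchable E A"
  shows "matchable E (\<Union>\<A>)"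
  using assms
proof (induction \<A> rule: finite_induct)
  case empty
  then show ?case by (simp add: matchable_empty)
next
  case (insert A \<A>)
  have "A \<inter> \<Union>\<A> = {}" using insert.prems(1) insert.hyps(2) by (fastforce simp: pairwise_insert disjnt_def)
  moreover have "matchable E (\<Union>\<A>)" using insert.prems by (intro insert.IH) (auto simp: pairwise_insert)
  ultimately show ?case using matchable_Un[of E A "\<Union>\<A>"] insert.prems by simp
qed

definition absorbs :: "'a set set \<Rightarrow> 'a set \<Rightarrow> 'a set \<Rightarrow> bool" where
  "absorbs E A S \<longleftrightarrow> A \<inter> S = {} \<and> matchable E A \<and> matchable E (A \<union> S)"

text \<open>Each step spends one absorber on one 4-set of the leftover. Every other 4-set loses at
  most this one absorber, while the number of 4-sets still to be absorbed also drops by one.\<close>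

lemma absorb_leftover:
  assumes "finite \<A>" "pairwise disjnt \<A>" "\<And>A. A \<in> \<A> \<Longrightarrow> matchable E A"
    and "card L = 4 * j" "finite L" "L \<inter> \<Union>\<A> = {}"
    and "\<And>S. S \<subseteq> L \<Longrightarrow> card S = 4 \<Longrightarrow> j \<le> card {A\<in>\<A>. absorbs E A S}"
  shows "matchable E (\<Union>\<A> \<union> L)"
  using assms
proof (induction j arbitrary: \<A> L)
  case 0
  then have "L = {}" by simp
  then show ?case using matchable_disjoint_Union[of \<A> E] 0 by simp
next
  case (Suc j)
  have "4 \<le> card L" using Suc.prems(4) by simp
  then obtain S where S: "S \<subseteq> L" "card S = 4" "finite S" by (rule obtain_subset_with_card_n)
  have "0 < card {A\<in>\<A>. absorbs E A S}" using Suc.prems(7)[OF S(1,2)] by simp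
  then have "{A\<in>\<A>. absorbs E A S} \<noteq> {}" by (metis card.empty less_irrefl)
  then obtain A where A: "A \<in> \<A>" "absorbs E A S" by blast
  have disj: "A \<inter> B = {}" if "B \<in> \<A> - {A}" for B
    using Suc.prems(2) A(1) that by (auto simp: pairwise_def disjnt_def)
  have "matchable E (\<Union>(\<A> - {A}) \<union> (L - S))"
  proof (rule Suc.IH)
    show "finite (\<A> - {A})" "finite (L - S)" using Suc.prems by auto
    show "pairwise disjnt (\<A> - {A})" using Suc.prems(2) by (rule pairwise_subset) auto
    show "matchable E B" if "B \<in> \<A> - {A}" for B using Suc.prems(3) that by blast
    show "card (L - S) = 4 * j" using S Suc.prems(4) by (simp add: card_Diff_subset)
    show "(L - S) \<inter> \<Union>(\<A> - {A}) = {}" using Suc.prems(6) by blast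
    fix S' assume S': "S' \<subseteq> L - S" "card S' = 4"
    have "{B\<in>\<A>. absorbs E B S'} \<subseteq> insert A {B\<in>\<A> - {A}. absorbs E B S'}" by blast
    then have "card {B\<in>\<A>. absorbs E B S'} \<le> card (insert A {B\<in>\<A> - {A}. absorbs E B S'})"
      using Suc.prems(1) by (intro card_mono) auto
    also have "\<dots> \<le> Suc (card {B\<in>\<A> - {A}. absorbs E B S'})" by (rule card_insert_le_m1) auto
    finally have "card {B\<in>\<A>. absorbs E B S'} \<le> Suc (card {B\<in>\<A> - {A}. absorbs E B S'})" .
    moreover have "Suc j \<le> card {B\<in>\<A>. absorbs E B S'}" using S' by (intro Suc.prems(7)) auto
    ultimately show "j \<le> card {B\<in>\<A> - {A}. absorbs E B S'}" by simp
  qed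
  moreover have "matchable E (A \<union> S)" using A(2) by (simp add: absorbs_def)
  moreover have "(A \<union> S) \<inter> (\<Union>(\<A> - {A}) \<union> (L - S)) = {}"
    using disj Suc.prems(6) S(1) A(1) by blast
  ultimately have "matchable E ((A \<union> S) \<union> (\<Union>(\<A> - {A}) \<union> (L - S)))" using matchable_Un by blast
  moreover have "(A \<union> S) \<union> (\<Union>(\<A> - {A}) \<union> (L - S)) = \<Union>\<A> \<union> L" using A(1) S(1) by blast
  ultimately show ?case by simp
qed

text \<open>Without \<open>v \<notin> T\<close> an edge through \<open>v\<close> would itself count
  as a member, and the link would no longer correspond to the edges at \<open>v\<close>.\<close>

definition link :: "'a set set \<Rightarrow> 'a \<Rightarrow> 'a set set" where
  "link E v = {T. v \<notin> T \<and> insert v T \<in> E}"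

lemma link_subset:
  assumes "uniform_hypergraph 4 V E"
  shows "link E v \<subseteq> {T. T \<subseteq> V \<and> card T = 3}"
proof
  fix T assume T: "T \<in> link E v"
  note HD = uniform_hypergraphD[OF assms]
  have e: "insert v T \<in> E" "v \<notin> T" using T by (auto simp: link_def)
  have "finite T" using HD(5)[OF e(1)] by simp
  then show "T \<in> {T. T \<subseteq> V \<and> card T = 3}" using HD(3,4)[OF e(1)] e(2) by auto
qed

lemma card_link: "card (link E v) = vertex_degree E v"
proof -
  have "bij_betw (insert v) (link E v) {e\<in>E. v \<in> e}"
    by (rule bij_betw_byWitness[where f' = "\<lambda>e. e - {v}"]) (auto simp: link_def insert_absorb)
  then show ?thesis unfolding vertex_degree_def by (rule bij_betw_same_card)
qed

lemma card_3_subsets_le: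
  assumes "finite V"
  shows "real (card {T. T \<subseteq> V \<and> card T = 3}) \<le> real (card V)^3 / 6"
proof -
  have eq: "real (card V choose 3) = (\<Prod>i = 0..<3. real (card V) - real i) / 6"
    by (simp add: binomial_gbinomial gbinomial_prod_rev fact_numeral)
  note eq
  also have "\<dots> \<le> real (card V)^3 / 6"
  proof (cases "card V < 3")
    case True
    then have "card V choose 3 = 0" by (rule binomial_eq_0)
    then have "real (card V choose 3) = 0" by (simp only: of_nat_0)
    moreover have "0 \<le> real (card V)^3 / 6" by simp
    ultimately show ?thesis unfolding eq[symmetric] by linarith
  next
    case False
    then have "(\<Prod>i = 0..<3. real (card V) - real i) \<le> (\<Prod>i = 0..<3::nat. real (card V))"
      by (intro prod_mono) auto
    then show ?thesis by (simp add: divide_right_mono)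
  qed
  finally show ?thesis using assms by (simp add: n_subsets)
qed

lemma card_3_subsets_meeting:
  assumes "finite V" "F \<subseteq> V"
  shows "card {T. T \<subseteq> V \<and> card T = 3 \<and> T \<inter> F \<noteq> {}} \<le> card F * (card V)\<^sup>2"
proof -
  have "{T. T \<subseteq> V \<and> card T = 3 \<and> T \<inter> F \<noteq> {}} \<subseteq> (\<lambda>(a,b,c). {a,b,c}) ` (F \<times> V \<times> V)"
  proof
    fix T assume "T \<in> {T. T \<subseteq> V \<and> card T = 3 \<and> T \<inter> F \<noteq> {}}"
    then obtain x where T: "T \<subseteq> V" "card T = 3" and x: "x \<in> T" "x \<in> F" by blast
    have "finite T" using T(1) assms(1) by (rule finite_subset)
    then have "card (T - {x}) = 2" using T(2) x(1) by simp
    then obtain a b where ab: "T - {x} = {a,b}" by (auto simp: card_2_iff)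
    then have "T = {x,a,b}" "a \<in> V" "b \<in> V" using T(1) x(1) by blast+
    then show "T \<in> (\<lambda>(a,b,c). {a,b,c}) ` (F \<times> V \<times> V)" using x(2) by force
  qed
  then have "card {T. T \<subseteq> V \<and> card T = 3 \<and> T \<inter> F \<noteq> {}} \<le> card (F \<times> V \<times> V)"
    by (rule surj_card_le[rotated]) (use assms finite_subset in auto)
  then show ?thesis by (simp add: card_cartesian_product power2_eq_square)
qed

text \<open>Two links of density 9/16 among the triples overlap in density at least 1/8, that is in
  \<open>n^3/48\<close> triples. At most \<open>n^3/100\<close> of them meet \<open>F\<close>, which
  leaves more than \<open>n^3/96\<close>.\<close>

lemma common_link:
  assumes H: "uniform_hypergraph 4 V E" and n: "n = real (card V)"
    and deg: "\<And>v. v \<in> V \<Longrightarrow> 9/16 * n^3 / 6 \<le> vertex_degree E v"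
    and st: "s \<in> V" "t \<in> V" and F: "F \<subseteq> V" "card F \<le> n / 100"
  shows "n^3 / 96 \<le> card {T \<in> link E t \<inter> link E s. T \<inter> F = {}}"
proof -
  note HD = uniform_hypergraphD[OF H]
  let ?P = "{T. T \<subseteq> V \<and> card T = 3}" and ?Q = "{T. T \<subseteq> V \<and> card T = 3 \<and> T \<inter> F \<noteq> {}}"
  have fP: "finite ?P" using HD(1) by simp
  have sub: "link E s \<subseteq> ?P" "link E t \<subseteq> ?P" by (rule link_subset[OF H])+
  have fl: "finite (link E s)" "finite (link E t)" using sub fP finite_subset by metis+
  have "card (link E t) + card (link E s) = card (link E t \<union> link E s) + card (link E t \<inter> link E s)"
    by (rule card_Un_Int[OF fl(2,1)])
  moreover have "card (link E t \<union> link E s) \<le> card ?P" using sub fP by (intro card_mono) auto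
  moreover have "card ?P \<le> n^3 / 6" unfolding n by (rule card_3_subsets_le[OF HD(1)])
  moreover have "9/16 * n^3 / 6 \<le> card (link E t)" "9/16 * n^3 / 6 \<le> card (link E s)"
    using deg st by (simp_all add: card_link)
  ultimately have 1: "n^3 / 48 \<le> card (link E t \<inter> link E s)" by linarith
  have "link E t \<inter> link E s \<subseteq> {T \<in> link E t \<inter> link E s. T \<inter> F = {}} \<union> ?Q" using sub by auto
  then have "card (link E t \<inter> link E s) \<le> card ({T \<in> link E t \<inter> link E s. T \<inter> F = {}} \<union> ?Q)"
    using fl HD(1) by (intro card_mono) auto
  also have "\<dots> \<le> card {T \<in> link E t \<inter> link E s. T \<inter> F = {}} + card ?Q" by (rule card_Un_le)
  finally have 2: "card (link E t \<inter> link E s) \<le> card {T \<in> link E t \<inter> link E s. T \<inter> F = {}} + card ?Q" .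
  have "real (card ?Q) \<le> real (card F * (card V)\<^sup>2)"
    by (rule of_nat_mono[OF card_3_subsets_meeting[OF HD(1) F(1)]])
  also have "\<dots> = real (card F) * n\<^sup>2" by (simp add: n)
  finally have "real (card ?Q) \<le> real (card F) * n\<^sup>2" .
  also have "\<dots> \<le> n / 100 * n\<^sup>2" using F(2) by (intro mult_right_mono) auto
  also have "\<dots> = n^3 / 100" by (simp add: power2_eq_square power3_eq_cube)
  finally have "real (card ?Q) \<le> n^3 / 100" .
  moreover have "0 \<le> n^3" by (simp add: n)
  ultimately show ?thesis using 1 2 by linarith
qed

lemma card_Sigma_ge:
  fixes m :: real
  assumes "finite A" "\<And>a. a \<in> A \<Longrightarrow> finite (B a)" "\<And>a. a \<in> A \<Longrightarrow> m \<le> card (B a)"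
  shows "card A * m \<le> card (Sigma A B)"
proof -
  have "card A * m = (\<Sum>a\<in>A. m)" by simp
  also have "\<dots> \<le> (\<Sum>a\<in>A. real (card (B a)))" by (intro sum_mono assms)
  also have "\<dots> = card (Sigma A B)" using assms by simp
  finally show ?thesis .
qed

lemma card_edges_avoiding:
  assumes H: "uniform_hypergraph 4 V E" and n: "n = real (card V)"
    and deg: "\<And>v. v \<in> V \<Longrightarrow> 9/16 * n^3 / 6 \<le> vertex_degree E v"
    and F: "F \<subseteq> V" "card F \<le> n / 100"
  shows "n^4 / 60 \<le> card {e\<in>E. e \<inter> F = {}}"
proof -
  note HD = uniform_hypergraphD[OF H]
  have fF: "finite F" using F(1) HD(1) by (rule finite_subset)
  have dle: "real (vertex_degree E v) \<le> n^3 / 6" for v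
  proof -
    have "card (link E v) \<le> card {T. T \<subseteq> V \<and> card T = 3}"
      using link_subset[OF H] HD(1) by (intro card_mono) auto
    then show ?thesis using card_3_subsets_le[OF HD(1)] by (simp add: card_link n)
  qed
  have "n * (9/16 * n^3 / 6) = (\<Sum>v\<in>V. 9/16 * n^3 / 6)" by (simp add: n)
  also have "\<dots> \<le> (\<Sum>v\<in>V. real (card {e\<in>E. v \<in> e}))"
    using deg by (intro sum_mono) (simp add: vertex_degree_def)
  also have "\<dots> = 4 * card E" using sum_degrees[OF H order.refl] by (metis of_nat_mult of_nat_numeral of_nat_sum)
  finally have E: "n * (9/16 * n^3 / 6) \<le> 4 * card E" .
  have "{e\<in>E. e \<inter> F \<noteq> {}} = (\<Union>v\<in>F. {e\<in>E. v \<in> e})" by auto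
  then have "card {e\<in>E. e \<inter> F \<noteq> {}} \<le> (\<Sum>v\<in>F. card {e\<in>E. v \<in> e})" by (simp only: card_UN_le[OF fF])
  then have "real (card {e\<in>E. e \<inter> F \<noteq> {}}) \<le> real (\<Sum>v\<in>F. card {e\<in>E. v \<in> e})" by (rule of_nat_mono)
  also have "\<dots> = (\<Sum>v\<in>F. real (vertex_degree E v))" by (simp add: vertex_degree_def)
  also have "\<dots> \<le> real (card F) * (n^3 / 6)" using dle by (intro sum_bounded_above)
  also have "\<dots> \<le> n / 100 * (n^3 / 6)" using F(2) by (intro mult_right_mono) (auto simp: n)
  finally have M: "real (card {e\<in>E. e \<inter> F \<noteq> {}}) \<le> n / 100 * (n^3 / 6)" .
  have "card E \<le> card {e\<in>E. e \<inter> F = {}} + card {e\<in>E. e \<inter> F \<noteq> {}}"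
  proof -
    have "{e\<in>E. e \<inter> F = {}} \<union> {e\<in>E. e \<inter> F \<noteq> {}} = E" by auto
    then show ?thesis using card_Un_le[of "{e\<in>E. e \<inter> F = {}}" "{e\<in>E. e \<inter> F \<noteq> {}}"] by (simp only:)
  qed
  moreover have "n * n^3 = n^4" by (simp add: eval_nat_numeral)
  moreover have "0 \<le> n^4" by (simp add: n)
  ultimately show ?thesis using E M by linarith
qed

text \<open>A candidate absorber consists of an edge t1 t2 t3 t4 and triples T1, ..., T4. It absorbs s1 s2 s3 s4 if
  every Ti lies in the links of both ti and si: then either all ti or all si can be matched with the Ti.\<close>

type_synonym 'a candidate = "('a \<times> 'a \<times> 'a \<times> 'a) \<times> 'a set \<times> 'a set \<times> 'a set \<times> 'a set"

fun vertices_of :: "'a candidate \<Rightarrow> 'a set" where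
  "vertices_of ((t1,t2,t3,t4), T1, T2, T3, T4) = {t1,t2,t3,t4} \<union> T1 \<union> T2 \<union> T3 \<union> T4"

text \<open>Disjointness is not part of the definition. This is merely a set of size at most
  \<open>n^16\<close> to average over, of which the absorbers of any given 4-set form a constant
  fraction.\<close>

definition candidates :: "'a set \<Rightarrow> 'a candidate set" where
  "candidates V = (V \<times> V \<times> V \<times> V) \<times> {T. T \<subseteq> V \<and> card T = 3} \<times> {T. T \<subseteq> V \<and> card T = 3}
      \<times> {T. T \<subseteq> V \<and> card T = 3} \<times> {T. T \<subseteq> V \<and> card T = 3}"

lemma candidatesD:
  assumes "finite V" "\<omega> \<in> candidates V"
  shows "vertices_of \<omega> \<subseteq> V" "card (vertices_of \<omega>) \<le> 16" "vertices_of \<omega> \<noteq> {}"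
proof -
  obtain t1 t2 t3 t4 T1 T2 T3 T4 where \<omega>: "\<omega> = ((t1,t2,t3,t4), T1, T2, T3, T4)"
    by (cases \<omega> rule: vertices_of.cases) auto
  have T: "card T1 = 3" "card T2 = 3" "card T3 = 3" "card T4 = 3"
    using assms(2) by (simp_all add: candidates_def \<omega>)
  show "vertices_of \<omega> \<subseteq> V" using assms(2) by (auto simp: candidates_def \<omega>)
  have "card (vertices_of \<omega>) \<le> card {t1,t2,t3,t4} + card T1 + card T2 + card T3 + card T4"
    unfolding \<omega> vertices_of.simps
    by (meson add_le_mono1 card_Un_le order.trans)
  also have "card {t1,t2,t3,t4} \<le> 4" by (rule card_insert_le_m1 card.empty | simp add: card_insert_if)+
  finally show "card (vertices_of \<omega>) \<le> 16" using T by simp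
  show "vertices_of \<omega> \<noteq> {}" by (simp add: \<omega>)
qed

lemma card_candidates:
  assumes "finite V"
  shows "finite (candidates V)" "real (card (candidates V)) \<le> real (card V)^16"
proof -
  let ?P = "{T. T \<subseteq> V \<and> card T = 3}"
  show "finite (candidates V)" using assms by (simp add: candidates_def)
  have "0 \<le> real (card V)^3" by simp
  then have P: "real (card ?P) \<le> real (card V)^3" using card_3_subsets_le[OF assms] by linarith
  have "real (card (candidates V)) = real (card V)^4 * (real (card ?P))^4"
    by (simp add: candidates_def card_cartesian_product eval_nat_numeral)
  also have "\<dots> \<le> real (card V)^4 * (real (card V)^3)^4" using P by (intro mult_left_mono power_mono) auto
  also have "\<dots> = real (card V)^16" by (simp add: power_mult[symmetric] power_add[symmetric])
  finally show "real (card (candidates V)) \<le> real (card V)^16" .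
qed

text \<open>Successive choices: the edge in at least \<open>n^4/60\<close> ways, then each triple
  from the common link of a vertex of that edge and a vertex of \<open>S\<close>, avoiding
  everything before, in at least \<open>n^3/96\<close> ways. Up to 13 vertices join \<open>F\<close>
  before the last choice, and \<open>n/200 + 13 \<le> n/100\<close> is where 2600 comes
  from.\<close>

lemma absorber_count:
  assumes H: "uniform_hypergraph 4 V E" and n: "n = real (card V)" and big: "2600 \<le> n"
    and deg: "\<And>v. v \<in> V \<Longrightarrow> 9/16 * n^3 / 6 \<le> vertex_degree E v"
    and S: "S \<subseteq> F" "card S = 4" and F: "F \<subseteq> V" "card F \<le> n / 200"
  shows "n^16 / (60 * 96^4) \<le> card {\<omega> \<in> candidates V. vertices_of \<omega> \<inter> F = {} \<and> absorbs E (vertices_of \<omega>) S}"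
proof -
  note HD = uniform_hypergraphD[OF H]
  have fF: "finite F" using F(1) HD(1) by (rule finite_subset)
  have "finite S" using S(1) fF by (rule finite_subset)
  then obtain s1 s2 s3 s4 where s: "S = {s1,s2,s3,s4}" "distinct [s1,s2,s3,s4]"
  proof -
    obtain xs where xs: "set xs = S" "distinct xs" using \<open>finite S\<close> finite_distinct_list by blast
    then have "length xs = 4" using S(2) distinct_card by metis
    then obtain a b c d where "xs = [a,b,c,d]" by (auto simp: eval_nat_numeral length_Suc_conv)
    then show thesis using that[of a b c d] xs by auto
  qed
  have sV: "s1 \<in> V" "s2 \<in> V" "s3 \<in> V" "s4 \<in> V" using s(1) S(1) F(1) by auto
  define N where "N F t s = {T \<in> link E t \<inter> link E s. T \<inter> F = {}}" for F t s
  have NP: "N F t s \<subseteq> {T. T \<subseteq> V \<and> card T = 3}" for F t s using link_subset[OF H] by (auto simp: N_def)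
  have fN: "finite (N F t s)" for F t s by (rule finite_subset[OF NP]) (use HD(1) in simp)
  define G where "G = {(t1,t2,t3,t4). {t1,t2,t3,t4} \<in> E \<and> {t1,t2,t3,t4} \<inter> F = {}}"
  have GV: "G \<subseteq> V \<times> V \<times> V \<times> V" using HD(3) by (fastforce simp: G_def)
  have fG: "finite G" by (rule finite_subset[OF GV]) (use HD(1) in simp)
  have "{e\<in>E. e \<inter> F = {}} \<subseteq> (\<lambda>(t1,t2,t3,t4). {t1,t2,t3,t4}) ` G"
  proof
    fix e assume e: "e \<in> {e\<in>E. e \<inter> F = {}}"
    then have "finite e" "card e = 4" using HD(4,5) by auto
    then obtain xs where xs: "set xs = e" "distinct xs" using finite_distinct_list by blast
    then have "length xs = 4" using \<open>card e = 4\<close> distinct_card by metis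
    then obtain a b c d where "xs = [a,b,c,d]" by (auto simp: eval_nat_numeral length_Suc_conv)
    then have abcd: "e = {a,b,c,d}" using xs by auto
    then have "(a,b,c,d) \<in> G" using e unfolding G_def by simp
    then show "e \<in> (\<lambda>(t1,t2,t3,t4). {t1,t2,t3,t4}) ` G" using abcd by force
  qed
  then have "card {e\<in>E. e \<inter> F = {}} \<le> card G" using fG by (rule surj_card_le[rotated])
  moreover have "n^4 / 60 \<le> card {e\<in>E. e \<inter> F = {}}"
    by (rule card_edges_avoiding[OF H n deg F(1)]) (use F(2) n in auto)
  ultimately have cG: "n^4 / 60 \<le> card G" by linarith
  define \<Omega> where "\<Omega> = Sigma G (\<lambda>(t1,t2,t3,t4). Sigma (N (F \<union> {t1,t2,t3,t4}) t1 s1) (\<lambda>T1.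
      Sigma (N (F \<union> {t1,t2,t3,t4} \<union> T1) t2 s2) (\<lambda>T2. Sigma (N (F \<union> {t1,t2,t3,t4} \<union> T1 \<union> T2) t3 s3)
       (\<lambda>T3. N (F \<union> {t1,t2,t3,t4} \<union> T1 \<union> T2 \<union> T3) t4 s4))))"
  have cN: "n^3 / 96 \<le> card (N F' t s)" if "t \<in> V" "s \<in> V" "F' \<subseteq> V" "card F' \<le> card F + 13" for F' t s
  proof -
    have "real (card F') \<le> n / 100" using that(4) F(2) big by linarith
    then show ?thesis unfolding N_def using that by (intro common_link[OF H n deg]) auto
  qed
  have cU: "card (X \<union> Y) \<le> card F + (a + b)" if "card X \<le> card F + a" "card Y \<le> b" for X Y :: "'a set" and a b
    using that card_Un_le[of X Y] by linarith
  have "real (card G) * (n^3/96 * (n^3/96 * (n^3/96 * (n^3/96)))) \<le> card \<Omega>"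
    unfolding \<Omega>_def
  proof (rule card_Sigma_ge[OF fG], goal_cases)
    case (1 t) then show ?case using fN by (auto split: prod.split intro!: finite_SigmaI)
  next
    case (2 t)
    obtain t1 t2 t3 t4 where t: "t = (t1,t2,t3,t4)" by (cases t) auto
    have tV: "t1 \<in> V" "t2 \<in> V" "t3 \<in> V" "t4 \<in> V" using 2 GV t by auto
    define F0 where "F0 = F \<union> {t1,t2,t3,t4}"
    have "card {t1,t2,t3,t4} \<le> 4" by (simp add: card_insert_if)
    then have F0: "F0 \<subseteq> V" "card F0 \<le> card F + 4" using tV F(1) cU[of F 0 "{t1,t2,t3,t4}" 4] by (auto simp: F0_def)
    have T3: "T \<subseteq> V" "card T \<le> 3" if "T \<in> N F t s" for T F t s using NP that by fastforce+
    have lev4: "n^3/96 \<le> card (N (F0 \<union> T1 \<union> T2 \<union> T3) t4 s4)"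
      if "T1 \<in> N F1 a1 b1" "T2 \<in> N F2 a2 b2" "T3 \<in> N F3 a3 b3" for T1 T2 T3 F1 a1 b1 F2 a2 b2 F3 a3 b3
    proof -
      have a1: "card (F0 \<union> T1) \<le> card F + 7" using cU[of F0 4 T1 3] F0(2) T3(2)[OF that(1)] by simp
      have a2: "card (F0 \<union> T1 \<union> T2) \<le> card F + 10" using cU[of "F0 \<union> T1" 7 T2 3] a1 T3(2)[OF that(2)] by simp
      have a3: "card (F0 \<union> T1 \<union> T2 \<union> T3) \<le> card F + 13"
        using cU[of "F0 \<union> T1 \<union> T2" 10 T3 3] a2 T3(2)[OF that(3)] by simp
      have "F0 \<union> T1 \<union> T2 \<union> T3 \<subseteq> V" using F0(1) T3(1)[OF that(1)] T3(1)[OF that(2)] T3(1)[OF that(3)] by blast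
      then show ?thesis using a3 by (rule cN[OF tV(4) sV(4)])
    qed
    have lev3: "n^3/96 \<le> card (N (F0 \<union> T1 \<union> T2) t3 s3)"
      if "T1 \<in> N F1 a1 b1" "T2 \<in> N F2 a2 b2" for T1 T2 F1 a1 b1 F2 a2 b2
    proof -
      have a1: "card (F0 \<union> T1) \<le> card F + 7" using cU[of F0 4 T1 3] F0(2) T3(2)[OF that(1)] by simp
      have a2: "card (F0 \<union> T1 \<union> T2) \<le> card F + 10" using cU[of "F0 \<union> T1" 7 T2 3] a1 T3(2)[OF that(2)] by simp
      have "F0 \<union> T1 \<union> T2 \<subseteq> V" using F0(1) T3(1)[OF that(1)] T3(1)[OF that(2)] by blast
      then show ?thesis using a2 by (intro cN[OF tV(3) sV(3)]) auto
    qed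
    have lev2: "n^3/96 \<le> card (N (F0 \<union> T1) t2 s2)" if "T1 \<in> N F1 a1 b1" for T1 F1 a1 b1
    proof -
      have a1: "card (F0 \<union> T1) \<le> card F + 7" using cU[of F0 4 T1 3] F0(2) T3(2)[OF that(1)] by simp
      have "F0 \<union> T1 \<subseteq> V" using F0(1) T3(1)[OF that(1)] by blast
      then show ?thesis using a1 by (intro cN[OF tV(2) sV(2)]) auto
    qed
    have lev1: "n^3/96 \<le> card (N F0 t1 s1)" using F0 by (intro cN[OF tV(1) sV(1)]) auto
    have n0: "0 \<le> n^3/96" by (simp add: n)
    have "n^3/96 * (n^3/96 * (n^3/96 * (n^3/96))) \<le> card (N F0 t1 s1) * (n^3/96 * (n^3/96 * (n^3/96)))"
      using lev1 n0 by (intro mult_right_mono) auto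
    also have "\<dots> \<le> card (Sigma (N F0 t1 s1) (\<lambda>T1. Sigma (N (F0 \<union> T1) t2 s2) (\<lambda>T2. Sigma (N (F0 \<union> T1 \<union> T2) t3 s3)
       (\<lambda>T3. N (F0 \<union> T1 \<union> T2 \<union> T3) t4 s4))))"
    proof (rule card_Sigma_ge[OF fN], goal_cases)
      case (1 T1) then show ?case using fN by (auto intro!: finite_SigmaI)
    next
      case (2 T1)
      have "n^3/96 * (n^3/96 * (n^3/96)) \<le> card (N (F0 \<union> T1) t2 s2) * (n^3/96 * (n^3/96))"
        using lev2[OF 2] n0 by (intro mult_right_mono) auto
      also have "\<dots> \<le> card (Sigma (N (F0 \<union> T1) t2 s2) (\<lambda>T2. Sigma (N (F0 \<union> T1 \<union> T2) t3 s3)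
       (\<lambda>T3. N (F0 \<union> T1 \<union> T2 \<union> T3) t4 s4)))"
      proof (rule card_Sigma_ge[OF fN], goal_cases)
        case (1 T2) then show ?case using fN by (auto intro!: finite_SigmaI)
      next
        case T2: (2 T2)
        have "n^3/96 * (n^3/96) \<le> card (N (F0 \<union> T1 \<union> T2) t3 s3) * (n^3/96)"
          using lev3[OF 2 T2] n0 by (intro mult_right_mono) auto
        also have "\<dots> \<le> card (Sigma (N (F0 \<union> T1 \<union> T2) t3 s3) (\<lambda>T3. N (F0 \<union> T1 \<union> T2 \<union> T3) t4 s4))"
          by (rule card_Sigma_ge[OF fN fN lev4[OF 2 T2]])
        finally show ?case .
      qed
      finally show ?case .
    qed
    finally show ?case unfolding t F0_def by simp
  qed
  moreover have "n^16 / (60 * 96^4) = n^4/60 * (n^3/96 * (n^3/96 * (n^3/96 * (n^3/96))))"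
  proof -
    have "n^16 = n^4 * (n^3 * (n^3 * (n^3 * n^3)))" by (simp flip: power_add)
    then show ?thesis by simp
  qed
  moreover have "n^4/60 * (n^3/96 * (n^3/96 * (n^3/96 * (n^3/96)))) \<le> card G * (n^3/96 * (n^3/96 * (n^3/96 * (n^3/96))))"
    using cG by (intro mult_right_mono) (auto simp: n)
  ultimately have c\<Omega>: "n^16 / (60 * 96^4) \<le> card \<Omega>" by linarith
  have "\<Omega> \<subseteq> {\<omega> \<in> candidates V. vertices_of \<omega> \<inter> F = {} \<and> absorbs E (vertices_of \<omega>) S}"
  proof
    fix \<omega> assume \<omega>: "\<omega> \<in> \<Omega>"
    obtain t1 t2 t3 t4 T1 T2 T3 T4 where o: "\<omega> = ((t1,t2,t3,t4), T1, T2, T3, T4)"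
      by (cases \<omega> rule: vertices_of.cases) auto
    let ?t = "{t1,t2,t3,t4}"
    have t: "?t \<in> E" "?t \<inter> F = {}" and tV: "(t1,t2,t3,t4) \<in> V \<times> V \<times> V \<times> V"
      using \<omega> GV unfolding \<Omega>_def o by (auto simp: G_def)
    have T: "T1 \<in> N (F \<union> ?t) t1 s1" "T2 \<in> N (F \<union> ?t \<union> T1) t2 s2" "T3 \<in> N (F \<union> ?t \<union> T1 \<union> T2) t3 s3"
      "T4 \<in> N (F \<union> ?t \<union> T1 \<union> T2 \<union> T3) t4 s4" using \<omega> unfolding \<Omega>_def o by auto
    have L: "insert t1 T1 \<in> E" "insert s1 T1 \<in> E" "insert t2 T2 \<in> E" "insert s2 T2 \<in> E"
      "insert t3 T3 \<in> E" "insert s3 T3 \<in> E" "insert t4 T4 \<in> E" "insert s4 T4 \<in> E"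
      using T by (auto simp: N_def link_def)
    have disF: "F \<inter> (T1 \<union> T2 \<union> T3 \<union> T4) = {}" and dist: "?t \<inter> (T1 \<union> T2 \<union> T3 \<union> T4) = {}"
      and disT: "T1 \<inter> T2 = {}" "T1 \<inter> T3 = {}" "T1 \<inter> T4 = {}" "T2 \<inter> T3 = {}" "T2 \<inter> T4 = {}" "T3 \<inter> T4 = {}"
      using T unfolding N_def by blast+
    have "card ?t = 4" using HD(4)[OF t(1)] .
    then have td: "t1 \<noteq> t2" "t1 \<noteq> t3" "t1 \<noteq> t4" "t2 \<noteq> t3" "t2 \<noteq> t4" "t3 \<noteq> t4"
      by (auto simp: card_insert_if split: if_splits)
    have sd: "s1 \<noteq> s2" "s1 \<noteq> s3" "s1 \<noteq> s4" "s2 \<noteq> s3" "s2 \<noteq> s4" "s3 \<noteq> s4" using s(2) by auto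
    have sF: "s1 \<in> F" "s2 \<in> F" "s3 \<in> F" "s4 \<in> F" using s(1) S(1) by auto
    have four: "matchable E (insert a T1 \<union> insert b T2 \<union> insert c T3 \<union> insert d T4)"
      if e: "insert a T1 \<in> E" "insert b T2 \<in> E" "insert c T3 \<in> E" "insert d T4 \<in> E"
        and d: "{a,b,c,d} \<inter> (T1 \<union> T2 \<union> T3 \<union> T4) = {}"
        and ne: "a \<noteq> b" "a \<noteq> c" "a \<noteq> d" "b \<noteq> c" "b \<noteq> d" "c \<noteq> d" for a b c d
    proof -
      have "insert a T1 \<inter> insert b T2 = {}" using d ne(1) disT(1) by blast
      note m2 = matchable_Un[OF matchable_edge[OF e(1)] matchable_edge[OF e(2)] this]
      have "insert a T1 \<inter> insert c T3 = {}" "insert b T2 \<inter> insert c T3 = {}"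
        using d ne(2,4) disT(2,4) by blast+
      then have "(insert a T1 \<union> insert b T2) \<inter> insert c T3 = {}" by blast
      note m3 = matchable_Un[OF m2 matchable_edge[OF e(3)] this]
      have "insert a T1 \<inter> insert d T4 = {}" "insert b T2 \<inter> insert d T4 = {}" "insert c T3 \<inter> insert d T4 = {}"
        using d ne(3,5,6) disT(3,5,6) by blast+
      then have "(insert a T1 \<union> insert b T2 \<union> insert c T3) \<inter> insert d T4 = {}" by blast
      then show ?thesis by (rule matchable_Un[OF m3 matchable_edge[OF e(4)]])
    qed
    have A: "matchable E (vertices_of \<omega>)"
    proof -
      have "matchable E (insert t1 T1 \<union> insert t2 T2 \<union> insert t3 T3 \<union> insert t4 T4)"
        by (rule four[OF L(1,3,5,7) dist td])
      moreover have "insert t1 T1 \<union> insert t2 T2 \<union> insert t3 T3 \<union> insert t4 T4 = vertices_of \<omega>"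
        unfolding o by auto
      ultimately show ?thesis by simp
    qed
    \<comment> \<open>With \<open>S\<close> matched to the four triples, the vertices
      \<open>t1\<close>, ..., \<open>t4\<close> remain, and they form an edge by themselves.\<close>
    have B: "matchable E (vertices_of \<omega> \<union> S)"
    proof -
      have "matchable E (insert s1 T1 \<union> insert s2 T2 \<union> insert s3 T3 \<union> insert s4 T4)"
        by (rule four[OF L(2,4,6,8) _ sd]) (use disF sF in blast)
      moreover have "?t \<inter> (insert s1 T1 \<union> insert s2 T2 \<union> insert s3 T3 \<union> insert s4 T4) = {}"
        using dist t(2) sF by blast
      ultimately have "matchable E (?t \<union> (insert s1 T1 \<union> insert s2 T2 \<union> insert s3 T3 \<union> insert s4 T4))"
        using matchable_Un[OF matchable_edge[OF t(1)]] by blast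
      moreover have "?t \<union> (insert s1 T1 \<union> insert s2 T2 \<union> insert s3 T3 \<union> insert s4 T4) = vertices_of \<omega> \<union> S"
        unfolding o s(1) by auto
      ultimately show ?thesis by simp
    qed
    have AF: "vertices_of \<omega> \<inter> F = {}" unfolding o vertices_of.simps using t(2) disF by blast
    then have "vertices_of \<omega> \<inter> S = {}" using S(1) by blast
    moreover have "\<omega> \<in> candidates V"
      unfolding candidates_def o using tV subsetD[OF NP T(1)] subsetD[OF NP T(2)] subsetD[OF NP T(3)] subsetD[OF NP T(4)] by simp
    ultimately show "\<omega> \<in> {\<omega> \<in> candidates V. vertices_of \<omega> \<inter> F = {} \<and> absorbs E (vertices_of \<omega>) S}"
      using A B AF by (simp add: absorbs_def)
  qed
  then have "card \<Omega> \<le> card {\<omega> \<in> candidates V. vertices_of \<omega> \<inter> F = {} \<and> absorbs E (vertices_of \<omega>) S}"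
    using card_candidates(1)[OF HD(1)] by (intro card_mono) auto
  with c\<Omega> show ?thesis by linarith
qed

text \<open>A 4-set has weight 2 to the minus number of its absorbers so far. Each 4-set is absorbed
  by at least a fraction \<open>c\<close> of the candidates disjoint from earlier choices, relative
  to \<open>n^16\<close>; by double counting one candidate absorbs 4-sets carrying a fraction
  \<open>c\<close> of the total weight. Adding it halves their weights, so the total shrinks by the
  factor \<open>1 - c/2\<close>.\<close>

lemma select_absorbers:
  assumes H: "uniform_hypergraph 4 V E" and n: "n = real (card V)" and big: "2600 \<le> n"
    and deg: "\<And>v. v \<in> V \<Longrightarrow> 9/16 * n^3 / 6 \<le> vertex_degree E v"
    and c: "c = 1 / (60 * 96^4)" and m: "16 * real m + 4 \<le> n / 200"
    and SS: "SS = {S. S \<subseteq> V \<and> card S = 4}"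
  shows "\<exists>\<A>. finite \<A> \<and> pairwise disjnt \<A> \<and> (\<forall>A\<in>\<A>. A \<subseteq> V \<and> matchable E A) \<and> card (\<Union>\<A>) \<le> 16 * m \<and>
     (\<Sum>S\<in>SS. (1/2)^card {A\<in>\<A>. absorbs E A S}) \<le> (1 - c/2)^m * real (card SS)"
  using m
proof (induction m)
  case 0
  show ?case by (intro exI[of _ "{}"]) simp
next
  case (Suc m)
  note HD = uniform_hypergraphD[OF H]
  have fSS: "finite SS" using HD(1) by (simp add: SS)
  have c0: "0 < c" "c \<le> 1" by (simp_all add: c)
  have pm: "16 * real m + 4 \<le> n / 200" using Suc.prems by simp
  from Suc.IH[OF this] obtain \<A> where \<A>: "finite \<A>" "pairwise disjnt \<A>" "\<forall>A\<in>\<A>. A \<subseteq> V \<and> matchable E A"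
      "card (\<Union>\<A>) \<le> 16 * m" and pot: "(\<Sum>S\<in>SS. (1/2)^card {A\<in>\<A>. absorbs E A S}) \<le> (1 - c/2)^m * real (card SS)"
    by blast
  define f :: "'a set \<Rightarrow> real" where "f S = (1/2)^card {A\<in>\<A>. absorbs E A S}" for S
  have f0: "0 < f S" for S by (simp add: f_def)
  define Y where "Y S = {\<omega> \<in> candidates V. vertices_of \<omega> \<inter> (\<Union>\<A> \<union> S) = {} \<and> absorbs E (vertices_of \<omega>) S}" for S
  have fC: "finite (candidates V)" and cC: "real (card (candidates V)) \<le> n^16"
    using card_candidates[OF HD(1)] by (simp_all add: n)
  have UV: "\<Union>\<A> \<subseteq> V" using \<A>(3) by blast
  have Y: "c * n^16 \<le> card (Y S)" if S: "S \<in> SS" for S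
  proof -
    have SV: "S \<subseteq> V" "card S = 4" using S by (simp_all add: SS)
    have "card (\<Union>\<A> \<union> S) \<le> card (\<Union>\<A>) + card S" by (rule card_Un_le)
    then have "card (\<Union>\<A> \<union> S) \<le> 16 * m + 4" using \<A>(4) SV(2) by linarith
    then have "real (card (\<Union>\<A> \<union> S)) \<le> n / 200" using pm by linarith
    then have "n^16 / (60 * 96^4) \<le> card (Y S)"
      unfolding Y_def using UV SV by (intro absorber_count[OF H n big deg]) auto
    then show ?thesis by (simp add: c)
  qed
  have n0: "0 < n^16" using big by simp
  obtain \<omega> where \<omega>: "\<omega> \<in> candidates V" "c * sum f SS \<le> (\<Sum>S | S \<in> SS \<and> \<omega> \<in> Y S. f S)"
  proof (rule ccontr)
    assume "\<not> thesis"
    then have small: "(\<Sum>S | S \<in> SS \<and> \<omega> \<in> Y S. f S) < c * sum f SS" if "\<omega> \<in> candidates V" for \<omega>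
      using that \<open>\<And>\<omega>. \<omega> \<in> candidates V \<Longrightarrow> c * sum f SS \<le> (\<Sum>S | S \<in> SS \<and> \<omega> \<in> Y S. f S) \<Longrightarrow> thesis\<close>
      by (meson not_le)
    have "n^16 * (c * sum f SS) = (c * n^16) * sum f SS" by simp
    also have "\<dots> = (\<Sum>S\<in>SS. (c * n^16) * f S)" by (rule sum_distrib_left)
    also have "\<dots> \<le> (\<Sum>S\<in>SS. card (Y S) * f S)" using Y f0 by (intro sum_mono mult_right_mono) (auto simp: less_imp_le)
    also have "\<dots> = (\<Sum>S\<in>SS. \<Sum>\<omega> | \<omega> \<in> candidates V \<and> \<omega> \<in> Y S. f S)"
      by (intro sum.cong refl) (simp add: Y_def)
    also have "\<dots> = (\<Sum>\<omega>\<in>candidates V. \<Sum>S | S \<in> SS \<and> \<omega> \<in> Y S. f S)"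
      by (rule sum.swap_restrict[OF fSS fC])
    finally have key: "n^16 * (c * sum f SS) \<le> (\<Sum>\<omega>\<in>candidates V. \<Sum>S | S \<in> SS \<and> \<omega> \<in> Y S. f S)" .
    have "4 \<le> card V" using big n by linarith
    then obtain S0 where "S0 \<subseteq> V" "card S0 = 4" by (rule obtain_subset_with_card_n)
    then have S0: "S0 \<in> SS" by (simp add: SS)
    have "0 < c * n^16" using c0 n0 by simp
    then have "Y S0 \<noteq> {}" using Y[OF S0] by auto
    then have Cne: "candidates V \<noteq> {}" by (auto simp: Y_def)
    have "0 \<le> c * sum f SS" using c0 f0 by (intro mult_nonneg_nonneg sum_nonneg) (auto simp: less_imp_le)
    have "(\<Sum>\<omega>\<in>candidates V. \<Sum>S | S \<in> SS \<and> \<omega> \<in> Y S. f S) < (\<Sum>\<omega>\<in>candidates V. c * sum f SS)"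
      by (rule sum_strict_mono[OF fC Cne small])
    also have "\<dots> = card (candidates V) * (c * sum f SS)" by simp
    also have "\<dots> \<le> n^16 * (c * sum f SS)" by (rule mult_right_mono[OF cC \<open>0 \<le> c * sum f SS\<close>])
    finally show False using key by simp
  qed
  define A where "A = vertices_of \<omega>"
  have A: "A \<subseteq> V" "card A \<le> 16" "A \<noteq> {}" using candidatesD[OF HD(1) \<omega>(1)] by (simp_all add: A_def)
  \<comment> \<open>The total weight is positive, so the chosen candidate absorbs at least one
    4-set. From that it follows that it is matchable and disjoint from the absorbers chosen
    before.\<close>
  have "SS \<noteq> {}"
  proof -
    have "4 \<le> card V" using big n by linarith
    then obtain S0 where "S0 \<subseteq> V" "card S0 = 4" by (rule obtain_subset_with_card_n)
    then show ?thesis by (auto simp: SS)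
  qed
  then have "0 < c * sum f SS" using c0 f0 fSS by (intro mult_pos_pos sum_pos) auto
  then have "(\<Sum>S | S \<in> SS \<and> \<omega> \<in> Y S. f S) \<noteq> 0" using \<omega>(2) by linarith
  then have "{S. S \<in> SS \<and> \<omega> \<in> Y S} \<noteq> {}" by (metis sum.empty)
  then obtain S1 where "\<omega> \<in> Y S1" by blast
  then have AU: "A \<inter> \<Union>\<A> = {}" and mA: "matchable E A" by (auto simp: Y_def A_def absorbs_def)
  have An: "A \<notin> \<A>" using AU A(3) by blast
  have cnt: "(1/2)^card {B\<in>insert A \<A>. absorbs E B S} = f S - (if absorbs E A S then f S / 2 else 0)" for S
  proof (cases "absorbs E A S")
    case True
    then have "{B\<in>insert A \<A>. absorbs E B S} = insert A {B\<in>\<A>. absorbs E B S}" by auto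
    then have "card {B\<in>insert A \<A>. absorbs E B S} = Suc (card {B\<in>\<A>. absorbs E B S})" using An \<A>(1) by simp
    then show ?thesis using True by (simp add: f_def)
  next
    case False
    then have "{B\<in>insert A \<A>. absorbs E B S} = {B\<in>\<A>. absorbs E B S}" by auto
    then show ?thesis using False by (simp add: f_def)
  qed
  have "(\<Sum>S\<in>SS. (1/2)^card {B\<in>insert A \<A>. absorbs E B S}) = sum f SS - (\<Sum>S\<in>SS. if absorbs E A S then f S / 2 else 0)"
    unfolding cnt by (rule sum_subtractf)
  also have "\<dots> \<le> sum f SS - c / 2 * sum f SS"
  proof -
    have "c / 2 * sum f SS \<le> (\<Sum>S | S \<in> SS \<and> \<omega> \<in> Y S. f S) / 2" using \<omega>(2) by simp
    also have "\<dots> = (\<Sum>S | S \<in> SS \<and> \<omega> \<in> Y S. f S / 2)" by (rule sum_divide_distrib)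
    also have "\<dots> \<le> (\<Sum>S | S \<in> SS \<and> absorbs E A S. f S / 2)"
      using fSS f0 by (intro sum_mono2) (auto simp: Y_def A_def less_imp_le)
    also have "\<dots> = (\<Sum>S\<in>SS. if absorbs E A S then f S / 2 else 0)"
      using fSS by (intro sum.mono_neutral_cong_left) auto
    finally show ?thesis by simp
  qed
  also have "\<dots> = (1 - c/2) * sum f SS" by (simp add: algebra_simps)
  also have "\<dots> \<le> (1 - c/2) * ((1 - c/2)^m * real (card SS))" using pot c0 by (intro mult_left_mono) (simp_all add: f_def)
  finally have "(\<Sum>S\<in>SS. (1/2)^card {B\<in>insert A \<A>. absorbs E B S}) \<le> (1 - c/2)^Suc m * real (card SS)"
    by (simp only: power_Suc mult.assoc)
  moreover have "card (\<Union>(insert A \<A>)) \<le> 16 * Suc m"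
  proof -
    have "card (\<Union>(insert A \<A>)) \<le> card A + card (\<Union>\<A>)" using card_Un_le[of A "\<Union>\<A>"] by simp
    then show ?thesis using A(2) \<A>(4) by simp
  qed
  moreover have "pairwise disjnt (insert A \<A>)"
    using \<A>(2) AU unfolding pairwise_insert disjnt_def by blast
  moreover have "\<forall>B\<in>insert A \<A>. B \<subseteq> V \<and> matchable E B" using \<A>(3) A(1) mA by blast
  ultimately show ?case using \<A>(1) by (intro exI[of _ "insert A \<A>"]) simp
qed

lemma eventually_power4_less_exp:
  fixes k C :: real
  assumes "0 < k" "0 < C"
  shows "\<exists>n\<^sub>0::nat. \<forall>n\<ge>n\<^sub>0. C * real n^4 < exp (k * real n)"
proof -
  have "((\<lambda>x::real. x^4 / exp x) \<longlongrightarrow> 0) at_top" by (rule tendsto_power_div_exp_0)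
  then have "eventually (\<lambda>x::real. x^4 / exp x < k^4 / C) at_top"
    by (rule order_tendstoD) (use assms in simp)
  then obtain N where N: "\<And>x. N \<le> x \<Longrightarrow> x^4 / exp x < k^4 / C" by (auto simp: eventually_at_top_linorder)
  show ?thesis
  proof (intro exI[of _ "nat \<lceil>N / k\<rceil>"] allI impI)
    fix n :: nat assume "nat \<lceil>N / k\<rceil> \<le> n"
    then have "N / k \<le> n" by linarith
    then have "N \<le> k * n" using assms by (simp add: pos_divide_le_eq mult.commute)
    from N[OF this] have "(k * n)^4 * C < k^4 * exp (k * n)" using assms by (simp add: divide_less_eq less_divide_eq mult_ac)
    then have "k^4 * (C * real n^4) < k^4 * exp (k * n)" by (simp add: power_mult_distrib mult_ac)
    then show "C * real n^4 < exp (k * real n)" using assms by simp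
  qed
qed

text \<open>After about \<open>\<beta>*n/16\<close> choices the total weight is at most
  \<open>exp (1 - 2*(\<beta>'*n)) * n^4\<close>. A 4-set with fewer than \<open>\<beta>'*n\<close>
  absorbers would alone have weight at least \<open>exp (- (\<beta>'*n))\<close>, which is larger
  for large \<open>n\<close>. A leftover of size \<open>\<beta>'*n\<close> asks for only a quarter
  of these absorbers.\<close>

lemma absorbing_set:
  fixes \<beta> :: real
  assumes \<beta>: "0 < \<beta>" "\<beta> \<le> 1/400"
  shows "\<exists>\<beta>'>0. \<beta>' \<le> 1 \<and> (\<exists>n\<^sub>0::nat. \<forall>(V :: 'a set) E. uniform_hypergraph 4 V E \<longrightarrow> n\<^sub>0 \<le> card V \<longrightarrow>
    (\<forall>v\<in>V. 9/16 * real (card V)^3 / 6 \<le> vertex_degree E v) \<longrightarrow>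
    (\<exists>W\<subseteq>V. card W \<le> \<beta> * real (card V) \<and>
      (\<forall>L. L \<subseteq> V - W \<and> card L \<le> \<beta>' * real (card V) \<and> 4 dvd card L \<longrightarrow> matchable E (W \<union> L))))"
proof -
  define c :: real where "c = 1 / (60 * 96^4)"
  have c0: "0 < c" "c \<le> 1" by (simp_all add: c_def)
  \<comment> \<open>The exponent \<open>m*c/2\<close> is about \<open>\<beta>*c*n/32\<close>, twice
    \<open>\<beta>'*n\<close>; the factor two is the margin that beats \<open>n^4\<close>.\<close>
  define \<beta>' where "\<beta>' = c * \<beta> / 64"
  have \<beta>'0: "0 < \<beta>'" using c0 \<beta> by (simp add: \<beta>'_def)
  have "c * \<beta> \<le> 1 * 1" using c0 \<beta> by (intro mult_mono) auto
  then have \<beta>'1: "\<beta>' \<le> 1" by (simp add: \<beta>'_def)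
  from eventually_power4_less_exp[OF \<beta>'0, of "exp 1"]
  obtain n1 :: nat where n1: "\<And>n. n1 \<le> n \<Longrightarrow> exp 1 * real n^4 < exp (\<beta>' * real n)" by auto
  have "\<exists>W\<subseteq>V. card W \<le> \<beta> * real (card V) \<and>
      (\<forall>L. L \<subseteq> V - W \<and> card L \<le> \<beta>' * real (card V) \<and> 4 dvd card L \<longrightarrow> matchable E (W \<union> L))"
    if H: "uniform_hypergraph 4 V E" and big: "max 2600 n1 \<le> card V"
      and deg: "\<forall>v\<in>V. 9/16 * real (card V)^3 / 6 \<le> vertex_degree E v" for V :: "'a set" and E
  proof -
    note HD = uniform_hypergraphD[OF H]
    define n where "n = real (card V)"
    have nb: "2600 \<le> n" using big by (simp add: n_def)
    define m where "m = nat \<lfloor>\<beta> * n / 16\<rfloor>"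
    have \<beta>n: "0 \<le> \<beta> * n / 16" using \<beta> nb by simp
    then have m: "real m \<le> \<beta> * n / 16" "\<beta> * n / 16 - 1 \<le> real m" unfolding m_def by linarith+
    have "\<beta> * n \<le> 1/400 * n" using \<beta> nb by (intro mult_right_mono) auto
    then have m200: "16 * real m + 4 \<le> n / 200" using m nb by linarith
    define SS where "SS = {S. S \<subseteq> V \<and> card S = 4}"
    have fSS: "finite SS" using HD(1) by (simp add: SS_def)
    from select_absorbers[OF H n_def nb deg[rule_format, folded n_def] c_def m200 SS_def] obtain \<A> where
      \<A>: "finite \<A>" "pairwise disjnt \<A>" "\<forall>A\<in>\<A>. A \<subseteq> V \<and> matchable E A" "card (\<Union>\<A>) \<le> 16 * m"
      and pot: "(\<Sum>S\<in>SS. (1/2)^card {A\<in>\<A>. absorbs E A S}) \<le> (1 - c/2)^m * real (card SS)" by blast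
    have "SS \<subseteq> (\<lambda>(a,b,c,d). {a,b,c,d}) ` (V \<times> V \<times> V \<times> V)"
    proof
      fix S assume S: "S \<in> SS"
      then have "finite S" using HD(1) finite_subset by (auto simp: SS_def)
      then obtain xs where xs: "set xs = S" "distinct xs" using finite_distinct_list by blast
      then have "length xs = 4" using S distinct_card[of xs] by (simp add: SS_def)
      then obtain a b c d where "xs = [a,b,c,d]" by (auto simp: eval_nat_numeral length_Suc_conv)
      then have "S = {a,b,c,d}" using xs by auto
      then show "S \<in> (\<lambda>(a,b,c,d). {a,b,c,d}) ` (V \<times> V \<times> V \<times> V)" using S by (force simp: SS_def)
    qed
    then have "card SS \<le> card (V \<times> V \<times> V \<times> V)" by (rule surj_card_le[rotated]) (use HD(1) in simp)
    then have "real (card SS) \<le> real (card (V \<times> V \<times> V \<times> V))" by (rule of_nat_mono)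
    also have "\<dots> = n^4" by (simp add: n_def card_cartesian_product eval_nat_numeral)
    finally have cSS: "real (card SS) \<le> n^4" .
    have "(1 - c/2)^m \<le> exp (- (c/2))^m" using c0 exp_ge_add_one_self[of "- (c/2)"] by (intro power_mono) auto
    also have "\<dots> = exp (real m * - (c/2))" by (simp only: exp_of_nat_mult)
    also have "\<dots> \<le> exp (1 - 2 * (\<beta>' * n))"
    proof -
      have "(\<beta> * n / 16 - 1) * (c/2) \<le> real m * (c/2)" using m(2) c0 by (intro mult_right_mono) auto
      moreover have "(\<beta> * n / 16 - 1) * (c/2) = 2 * (\<beta>' * n) - c/2" by (simp add: \<beta>'_def field_simps)
      moreover have "real m * - (c/2) = - (real m * (c/2))" by simp
      ultimately have "real m * - (c/2) \<le> 1 - 2 * (\<beta>' * n)" using c0 by linarith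
      then show ?thesis by simp
    qed
    finally have pw: "(1 - c/2)^m \<le> exp (1 - 2 * (\<beta>' * n))" .
    have many: "\<beta>' * n \<le> card {A\<in>\<A>. absorbs E A S}" if S: "S \<in> SS" for S
    proof (rule ccontr)
      define q where "q = card {A\<in>\<A>. absorbs E A S}"
      assume "\<not> \<beta>' * n \<le> card {A\<in>\<A>. absorbs E A S}"
      then have q: "real q \<le> \<beta>' * n" by (simp add: q_def)
      have "exp (- (\<beta>' * n)) \<le> exp (real q * - 1)" using q by simp
      also have "\<dots> = exp (- 1)^q" by (simp only: exp_of_nat_mult)
      also have "\<dots> \<le> (1/2)^q"
        using exp_ge_add_one_self[of 1] by (intro power_mono) (simp_all add: exp_minus inverse_eq_divide divide_le_eq)
      also have "\<dots> \<le> (\<Sum>S\<in>SS. (1/2)^card {A\<in>\<A>. absorbs E A S})"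
        unfolding q_def using fSS S by (intro member_le_sum) auto
      also have "\<dots> \<le> (1 - c/2)^m * real (card SS)" by (rule pot)
      also have "\<dots> \<le> exp (1 - 2 * (\<beta>' * n)) * n^4" using pw cSS c0 by (intro mult_mono) auto
      finally have "exp (2 * (\<beta>' * n)) * exp (- (\<beta>' * n)) \<le> exp (2 * (\<beta>' * n)) * (exp (1 - 2 * (\<beta>' * n)) * n^4)"
        by (intro mult_left_mono) auto
      then have "exp (\<beta>' * n) \<le> exp 1 * n^4" by (simp add: exp_add[symmetric] mult.assoc[symmetric])
      moreover have "exp 1 * n^4 < exp (\<beta>' * n)" unfolding n_def using big by (intro n1) simp
      ultimately show False by simp
    qed
    show ?thesis
    proof (intro exI[of _ "\<Union>\<A>"] conjI allI impI)
      show "\<Union>\<A> \<subseteq> V" using \<A>(3) by blast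
      have "real (card (\<Union>\<A>)) \<le> 16 * real m" using \<A>(4) by linarith
      then show "card (\<Union>\<A>) \<le> \<beta> * real (card V)" using m(1) by (simp add: n_def)
      fix L assume "L \<subseteq> V - \<Union>\<A> \<and> card L \<le> \<beta>' * real (card V) \<and> 4 dvd card L"
      then have L: "L \<subseteq> V - \<Union>\<A>" "card L \<le> \<beta>' * n" "4 dvd card L" by (simp_all add: n_def)
      then obtain j where j: "card L = 4 * j" by blast
      show "matchable E (\<Union>\<A> \<union> L)"
      proof (rule absorb_leftover[OF \<A>(1,2) _ j])
        show "matchable E A" if "A \<in> \<A>" for A using \<A>(3) that by blast
        show "finite L" using L(1) HD(1) by (meson Diff_subset finite_subset)
        show "L \<inter> \<Union>\<A> = {}" using L(1) by blast
        fix S assume S: "S \<subseteq> L" "card S = 4"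
        then have "S \<in> SS" using L(1) by (auto simp: SS_def)
        from many[OF this] show "j \<le> card {A\<in>\<A>. absorbs E A S}" using L(2) j by linarith
      qed
    qed
  qed
  then show ?thesis using \<beta>'0 \<beta>'1 by (intro exI[of _ \<beta>'] conjI exI[of _ "max 2600 n1"] allI impI) simp_all
qed

section \<open>The extremal case\<close>

lemma matchable_mono: "matchable E W \<Longrightarrow> E \<subseteq> E' \<Longrightarrow> matchable E' W"
  unfolding matchable_def perfect_matching_def by blast

lemma matchable_subset: "matchable E W \<Longrightarrow> (\<And>e. e \<in> E \<Longrightarrow> e \<subseteq> V) \<Longrightarrow> W \<subseteq> V"
  unfolding matchable_def perfect_matching_def by blast

text \<open>Edges of one type take the two parts in a fixed proportion. This gives the sizes of both
  parts after edges of type ABBB or AABB have been removed.\<close>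

lemma matchable_card_Int:
  assumes "matchable E W" "finite W" "\<And>e. e \<in> E \<Longrightarrow> card (e \<inter> X) = i" "\<And>e. e \<in> E \<Longrightarrow> card e = k"
  shows "k * card (W \<inter> X) = i * card W"
proof -
  obtain M where M: "M \<subseteq> E" "pairwise disjnt M" "\<Union>M = W"
    using assms(1) by (auto simp: matchable_def perfect_matching_def)
  have fM: "finite M" using M(3) assms(2) finite_UnionD by blast
  have fe: "finite e" if "e \<in> M" for e using that M(3) assms(2) by (meson Sup_upper finite_subset)
  have dj: "e \<inter> f = {}" if "e \<in> M" "f \<in> M" "e \<noteq> f" for e f
    using M(2) that by (auto simp: pairwise_def disjnt_def)
  have "card (\<Union>e\<in>M. e \<inter> X) = (\<Sum>e\<in>M. card (e \<inter> X))"
    using fM fe dj by (intro card_UN_disjoint) (blast+)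
  also have "\<dots> = (\<Sum>e\<in>M. i)" using assms(3) M(1) by (intro sum.cong) auto
  finally have 1: "card (\<Union>e\<in>M. e \<inter> X) = i * card M" by simp
  have "(\<Union>e\<in>M. e \<inter> X) = W \<inter> X" using M(3) by blast
  with 1 have 2: "card (W \<inter> X) = i * card M" by simp
  have "card (\<Union>e\<in>M. e) = (\<Sum>e\<in>M. card e)"
    using fM fe dj by (intro card_UN_disjoint) (blast+)
  also have "\<dots> = (\<Sum>e\<in>M. k)" using assms(4) M(1) by (intro sum.cong) auto
  finally have "card W = k * card M" using M(3) by simp
  then show ?thesis using 2 by simp
qed

text \<open>Four vertices per element of \<open>Z\<close> bound what is blocked at any time by
  \<open>K\<close>. Elements of \<open>Z\<close> that lie in \<open>U0\<close> or in an earlier edge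
  count as covered already, hence the form \<open>Z \<subseteq> W \<union> U0\<close>.\<close>

lemma greedy_cover:
  assumes "finite Z" and "finite V" and E: "\<And>e. e \<in> E \<Longrightarrow> e \<subseteq> V \<and> card e = 4"
    and ext: "\<And>z U. z \<in> Z \<Longrightarrow> U \<subseteq> V \<Longrightarrow> card U \<le> K \<Longrightarrow> z \<notin> U \<Longrightarrow> \<exists>e\<in>E. z \<in> e \<and> e \<inter> U = {}"
    and U0: "U0 \<subseteq> V" "card U0 + 4 * card Z \<le> K"
  shows "\<exists>W\<subseteq>V. matchable E W \<and> Z \<subseteq> W \<union> U0 \<and> W \<inter> U0 = {} \<and> card W \<le> 4 * card Z"
  using assms(1) ext U0(2)
proof (induction Z rule: finite_induct)
  case empty
  show ?case by (intro exI[of _ "{}"]) (simp add: matchable_empty)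
next
  case (insert z Z)
  have "\<exists>W\<subseteq>V. matchable E W \<and> Z \<subseteq> W \<union> U0 \<and> W \<inter> U0 = {} \<and> card W \<le> 4 * card Z"
  proof (rule insert.IH)
    show "\<exists>e\<in>E. y \<in> e \<and> e \<inter> U = {}" if "y \<in> Z" "U \<subseteq> V" "card U \<le> K" "y \<notin> U" for y U
      using insert.prems(1)[of y U] that by blast
    show "card U0 + 4 * card Z \<le> K" using insert.prems(2) insert.hyps by simp
  qed
  then obtain W where W: "W \<subseteq> V" "matchable E W" "Z \<subseteq> W \<union> U0" "W \<inter> U0 = {}" "card W \<le> 4 * card Z" by blast
  have cZ: "card (insert z Z) = Suc (card Z)" using insert.hyps by simp
  show ?case
  proof (cases "z \<in> W \<union> U0")
    case True
    then show ?thesis using W cZ by (intro exI[of _ W]) auto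
  next
    case False
    have "card (W \<union> U0) \<le> card W + card U0" by (rule card_Un_le)
    then have cK: "card (W \<union> U0) \<le> K" using W(5) insert.prems(2) cZ by linarith
    have "\<exists>e\<in>E. z \<in> e \<and> e \<inter> (W \<union> U0) = {}"
      by (rule insert.prems(1)[OF _ _ cK False]) (use W(1) U0(1) in simp_all)
    then obtain e where e: "e \<in> E" "z \<in> e" "e \<inter> (W \<union> U0) = {}" by blast
    have "W \<inter> e = {}" using e(3) by blast
    then have "matchable E (W \<union> e)" by (rule matchable_Un[OF W(2) matchable_edge[OF e(1)]])
    moreover have "card (W \<union> e) \<le> 4 * card (insert z Z)"
      using card_Un_le[of W e] W(5) E[OF e(1)] cZ by linarith
    moreover have "W \<union> e \<subseteq> V" "insert z Z \<subseteq> (W \<union> e) \<union> U0" "(W \<union> e) \<inter> U0 = {}"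
      using W(1,3,4) e(2,3) E[OF e(1)] by blast+
    ultimately show ?thesis by (intro exI[of _ "W \<union> e"] conjI)
  qed
qed

lemma greedy_many:
  assumes "finite V" and E: "\<And>e. e \<in> E \<Longrightarrow> e \<subseteq> V \<and> card e = 4"
    and ext: "\<And>U. U \<subseteq> V \<Longrightarrow> card U \<le> K \<Longrightarrow> \<exists>e\<in>E. e \<inter> U = {}" and "4 * s \<le> K"
  shows "\<exists>W\<subseteq>V. matchable E W \<and> card W = 4 * s"
  using assms(4)
proof (induction s)
  case 0
  show ?case by (intro exI[of _ "{}"]) (simp add: matchable_empty)
next
  case (Suc s)
  then obtain W where W: "W \<subseteq> V" "matchable E W" "card W = 4 * s" by auto
  then obtain e where e: "e \<in> E" "e \<inter> W = {}" using ext[of W] Suc.prems by auto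
  have eV: "e \<subseteq> V" "card e = 4" using E[OF e(1)] by auto
  have "finite W" "finite e" using W(1) eV assms(1) finite_subset by blast+
  then have "card (W \<union> e) = 4 * Suc s" using e(2) W(3) eV(2) by (subst card_Un_disjoint) auto
  moreover have "W \<inter> e = {}" using e(2) by blast
  then have "matchable E (W \<union> e)" by (rule matchable_Un[OF W(2) matchable_edge[OF e(1)]])
  ultimately show ?case using W(1) eV(1) by (intro exI[of _ "W \<union> e"]) auto
qed

text \<open>A largest matching by edges meeting A in one vertex is perfect: otherwise three of its edges and four
  uncovered vertices could be rearranged into four disjoint edges.\<close>

lemma abbb_matching:
  assumes fin: "finite A" "finite B" and AB: "A \<inter> B = {}" and cB: "card B = 3 * card A"
    and card4: "\<And>e. e \<in> E \<Longrightarrow> card e = 4"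
    and a_hyp: "\<And>a. a \<in> A \<Longrightarrow> real (card {(u,v,w) \<in> B \<times> B \<times> B. {a,u,v,w} \<notin> E}) \<le> real (card A)^3 / 100"
    and b_hyp: "\<And>b. b \<in> B \<Longrightarrow> real (card {(a,v,w) \<in> A \<times> B \<times> B. {b,a,v,w} \<notin> E}) \<le> real (card A)^3 / 100"
  shows "matchable E (A \<union> B)"
proof -
  define E' where "E' = {e\<in>E. e \<subseteq> A \<union> B \<and> card (e \<inter> A) = 1}"
  have E': "e \<subseteq> A \<union> B" "card (e \<inter> A) = 1" "card e = 4" "finite e" if "e \<in> E'" for e
    using that card4[of e] fin finite_subset[of e "A \<union> B"] by (auto simp: E'_def)
  have abE': "{a,u,v,w} \<in> E'" if "{a,u,v,w} \<in> E" "a \<in> A" "u \<in> B" "v \<in> B" "w \<in> B" for a u v w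
  proof -
    have "{a,u,v,w} \<inter> A = {a}" using that(2-5) AB by blast
    then have "card ({a,u,v,w} \<inter> A) = 1" by (simp only: card.insert card.empty finite.emptyI empty_iff not_False_eq_True One_nat_def)
    moreover have "{a,u,v,w} \<subseteq> A \<union> B" using that(2-5) by blast
    ultimately show ?thesis unfolding E'_def using that(1) by (intro CollectI conjI)
  qed
  define N where "N = card A"
  let ?P = "\<lambda>W. W \<subseteq> A \<union> B \<and> matchable E' W"
  have bound: "card W \<le> card (A \<union> B)" if "?P W" for W using that fin by (intro card_mono) auto
  have "?P {}" by (simp add: matchable_empty)
  then have "\<exists>W. ?P W \<and> (\<forall>W'. ?P W' \<longrightarrow> card W' \<le> card W)"
    by (rule ex_has_greatest_nat[of ?P "{}" card "Suc (card (A \<union> B))"]) (use bound in \<open>simp add: less_Suc_eq_le\<close>)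
  then obtain W where W: "W \<subseteq> A \<union> B" "matchable E' W" and Wmax: "\<And>W'. ?P W' \<Longrightarrow> card W' \<le> card W"
    by blast
  have fW: "finite W" using W(1) fin by (meson finite_Un finite_subset)
  obtain M where M: "M \<subseteq> E'" "pairwise disjnt M" "\<Union>M = W"
    using W(2) by (auto simp: matchable_def perfect_matching_def)
  have fM: "finite M" using M(3) fW finite_UnionD by blast
  define m where "m = card M"
  have cW4: "card W = 4 * m"
  proof -
    have "card (\<Union>M) = (\<Sum>e\<in>M. card e)"
      using M(1,2) E'(4) by (intro card_Union_disjoint) (auto simp: pairwise_def disjnt_def disjoint_def)
    also have "\<dots> = (\<Sum>e\<in>M. 4)" using M(1) E'(3) by (intro sum.cong) auto
    finally show ?thesis using M(3) by (simp add: m_def)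
  qed
  have cWA: "card (W \<inter> A) = m"
    using matchable_card_Int[OF W(2) fW E'(2) E'(3)] cW4 by simp
  have "card W = card (W \<inter> A) + card (W \<inter> B)"
  proof -
    have "W = (W \<inter> A) \<union> (W \<inter> B)" using W(1) by blast
    moreover have "card ((W \<inter> A) \<union> (W \<inter> B)) = card (W \<inter> A) + card (W \<inter> B)"
      using fW AB by (intro card_Un_disjoint) auto
    ultimately show ?thesis by simp
  qed
  then have cWB: "card (W \<inter> B) = 3 * m" using cWA cW4 by simp
  have "card (W \<inter> A) \<le> N" unfolding N_def using fin by (intro card_mono) auto
  then have mN: "m \<le> N" using cWA by simp
  have "card (A - W) = card A - card (A \<inter> W)" using fin fW by (intro card_Diff_subset_Int) auto
  then have cAW: "card (A - W) = N - m" using cWA by (simp add: N_def Int_commute)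
  have "card (B - W) = card B - card (B \<inter> W)" using fin fW by (intro card_Diff_subset_Int) auto
  then have cBW: "card (B - W) = 3 * (N - m)" using cWB cB by (simp add: N_def Int_commute)
  have E'E: "E' \<subseteq> E" by (auto simp: E'_def)
  show ?thesis
  proof (cases "m = N")
    case True
    then have "A - W = {}" "B - W = {}" using cAW cBW fin by auto
    then have "W = A \<union> B" using W(1) by blast
    then show ?thesis using matchable_mono[OF W(2) E'E] by simp
  next
    case False
    then have mN: "m < N" using mN by simp
    then have N0: "0 < real N" by simp
    have "A - W \<noteq> {}" using cAW mN by (metis card.empty less_irrefl zero_less_diff)
    then obtain a0 where a0: "a0 \<in> A" "a0 \<notin> W" by blast
    have extend: False if "matchable E' W'" "W' \<inter> Q = {}" "matchable E' Q" "card (W' \<union> Q) > card W" for W' Q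
    proof -
      have "W' \<union> Q \<subseteq> A \<union> B" using matchable_subset[OF that(1) E'(1)] matchable_subset[OF that(3) E'(1)] by blast
      then have "?P (W' \<union> Q)" using matchable_Un[OF that(1,3,2)] by simp
      then show False using Wmax[of "W' \<union> Q"] that(4) by linarith
    qed
    \<comment> \<open>If at least half of \<open>A\<close> is uncovered, the uncovered part of
      \<open>B\<close> has at least \<open>(3*N/2)^3\<close> ordered triples, far more than the
      \<open>N^3/100\<close> bad ones at \<open>a0\<close>, and one edge can simply be added.
      Otherwise there are more than \<open>(N/2)^3\<close> triples of matching edges to choose an
      exchange from.\<close>
    show ?thesis
    proof (cases "2 * m \<le> N")
      case True
      have "(3 * real N / 2)^3 \<le> real (card (B - W))^3"
        using True mN by (intro power_mono) (auto simp: cBW)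
      moreover have "(3 * real N / 2)^3 = 27 / 8 * real N^3" by (simp add: power_divide power_mult_distrib)
      moreover have "real (card ((B - W) \<times> (B - W) \<times> (B - W))) = real (card (B - W))^3"
        by (simp add: card_cartesian_product power3_eq_cube)
      moreover have "0 < real N^3" using N0 by simp
      ultimately have gt: "real (card {(u,v,w) \<in> B \<times> B \<times> B. {a0,u,v,w} \<notin> E}) < card ((B - W) \<times> (B - W) \<times> (B - W))"
        using a_hyp[OF a0(1)] unfolding N_def by linarith
      have "\<not> (B - W) \<times> (B - W) \<times> (B - W) \<subseteq> {(u,v,w) \<in> B \<times> B \<times> B. {a0,u,v,w} \<notin> E}"
      proof
        assume sub: "(B - W) \<times> (B - W) \<times> (B - W) \<subseteq> {(u,v,w) \<in> B \<times> B \<times> B. {a0,u,v,w} \<notin> E}"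
        have "finite {(u,v,w) \<in> B \<times> B \<times> B. {a0,u,v,w} \<notin> E}"
          by (rule finite_subset[of _ "B \<times> B \<times> B"]) (use fin in auto)
        from card_mono[OF this sub] gt show False by linarith
      qed
      then obtain u v w where uvw: "u \<in> B - W" "v \<in> B - W" "w \<in> B - W" "{a0,u,v,w} \<in> E" by blast
      have e: "{a0,u,v,w} \<in> E'" using abE'[OF uvw(4) a0(1)] uvw by blast
      have dis: "W \<inter> {a0,u,v,w} = {}" using uvw a0 by blast
      have "card (W \<union> {a0,u,v,w}) = card W + 4"
        using card_Un_disjoint[OF fW E'(4)[OF e] dis] E'(3)[OF e] by simp
      then have "card (W \<union> {a0,u,v,w}) > card W" by simp
      from extend[OF W(2) dis matchable_edge[OF e] this] show ?thesis ..
    next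
      case False
      have "3 \<le> card (B - W)" using cBW mN by simp
      then obtain Q where Q: "Q \<subseteq> B - W" "card Q = 3" by (rule obtain_subset_with_card_n)
      then obtain p1 p2 p3 where p: "Q = {p1,p2,p3}" "p1 \<noteq> p2" "p1 \<noteq> p3" "p2 \<noteq> p3" by (auto simp: card_3_iff)
      have pB: "p1 \<in> B" "p2 \<in> B" "p3 \<in> B" "p1 \<notin> W" "p2 \<notin> W" "p3 \<notin> W" using Q(1) p(1) by auto
      have "\<forall>e\<in>M. \<exists>a x y z. e = {a,x,y,z} \<and> a \<in> A \<and> x \<in> B \<and> y \<in> B \<and> z \<in> B"
      proof
        fix e assume e: "e \<in> M"
        have e': "e \<in> E'" using e M(1) by blast
        obtain a where a: "e \<inter> A = {a}" using E'(2)[OF e'] card_1_singletonE by blast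
        have "card (e - {a}) = 3" using E'(3,4)[OF e'] a by (subst card_Diff_singleton) auto
        then obtain x y z where xyz: "e - {a} = {x,y,z}" by (auto simp: card_3_iff)
        have "e = {a,x,y,z}" using xyz a by blast
        moreover have "{x,y,z} \<subseteq> B" using xyz a E'(1)[OF e'] by blast
        moreover have "a \<in> A" using a by blast
        ultimately show "\<exists>a x y z. e = {a,x,y,z} \<and> a \<in> A \<and> x \<in> B \<and> y \<in> B \<and> z \<in> B" by blast
      qed
      then obtain al x y z where el0:
        "\<forall>e\<in>M. e = {al e, x e, y e, z e} \<and> al e \<in> A \<and> x e \<in> B \<and> y e \<in> B \<and> z e \<in> B" by metis
      have el: "e = {al e, x e, y e, z e}" "al e \<in> A" "x e \<in> B" "y e \<in> B" "z e \<in> B" if "e \<in> M" for e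
        using bspec[OF el0 that] by - (elim conjE, assumption)+
      have dj: "e \<inter> e' = {}" if "e \<in> M" "e' \<in> M" "e \<noteq> e'" for e e'
        using M(2) that by (auto simp: pairwise_def disjnt_def)
      have inj: "inj_on g M" if "\<And>e. e \<in> M \<Longrightarrow> g e \<in> e" for g
      proof (rule inj_onI)
        fix e e' assume "e \<in> M" "e' \<in> M" "g e = g e'"
        then show "e = e'" using dj[of e e'] that[of e] that[of e'] by auto
      qed
      have ins: "al e \<in> e" "x e \<in> e" "y e \<in> e" "z e \<in> e" if "e \<in> M" for e
        by (subst (2) el(1)[OF that], simp)+
      have injs: "inj_on al M" "inj_on x M" "inj_on y M" "inj_on z M" by (rule inj, erule ins)+
      let ?M3 = "M \<times> M \<times> M"
      \<comment> \<open>Each set collects the triples of matching edges for which one of the four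
        intended new edges is absent. The three \<open>x\<close> go to \<open>a0\<close>; every
        \<open>p\<close> gets one \<open>al\<close>, one \<open>y\<close> and one \<open>z\<close>
        from three different edges, so all sixteen vertices are used once. Each set injects into the
        bad triples at one vertex, and \<open>4*N^3/100\<close> is below
        \<open>N^3/8\<close>.\<close>
      define b1 where "b1 = {(e1,e2,e3) \<in> ?M3. {a0, x e1, x e2, x e3} \<notin> E}"
      define b2 where "b2 = {(e1,e2,e3) \<in> ?M3. {p1, al e1, y e2, z e3} \<notin> E}"
      define b3 where "b3 = {(e1,e2,e3) \<in> ?M3. {p2, al e2, y e3, z e1} \<notin> E}"
      define b4 where "b4 = {(e1,e2,e3) \<in> ?M3. {p3, al e3, y e1, z e2} \<notin> E}"
      have fM3: "finite ?M3" using fM by simp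
      have fB3: "finite {(u,v,w) \<in> B \<times> B \<times> B. R u v w}" "finite {(u,v,w) \<in> A \<times> B \<times> B. R u v w}" for R
        by (rule finite_subset[of _ "B \<times> B \<times> B"] finite_subset[of _ "A \<times> B \<times> B"], use fin in auto)+
      have c1: "real (card b1) \<le> real N^3 / 100"
      proof -
        have "card b1 \<le> card {(u,v,w) \<in> B \<times> B \<times> B. {a0,u,v,w} \<notin> E}"
        proof (rule card_inj_on_le[of "\<lambda>(e1,e2,e3). (x e1, x e2, x e3)"])
          show "inj_on (\<lambda>(e1,e2,e3). (x e1, x e2, x e3)) b1"
            using injs(2) by (auto simp: inj_on_def b1_def)
          show "(\<lambda>(e1,e2,e3). (x e1, x e2, x e3)) ` b1 \<subseteq> {(u,v,w) \<in> B \<times> B \<times> B. {a0,u,v,w} \<notin> E}"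
            using el(3) by (auto simp: b1_def)
        qed (rule fB3)
        then show ?thesis using a_hyp[OF a0(1)] unfolding N_def by linarith
      qed
      have c2: "real (card b2) \<le> real N^3 / 100"
      proof -
        have "card b2 \<le> card {(u,v,w) \<in> A \<times> B \<times> B. {p1,u,v,w} \<notin> E}"
        proof (rule card_inj_on_le[of "\<lambda>(e1,e2,e3). (al e1, y e2, z e3)"])
          show "inj_on (\<lambda>(e1,e2,e3). (al e1, y e2, z e3)) b2"
            using injs by (auto simp: inj_on_def b2_def)
          show "(\<lambda>(e1,e2,e3). (al e1, y e2, z e3)) ` b2 \<subseteq> {(u,v,w) \<in> A \<times> B \<times> B. {p1,u,v,w} \<notin> E}"
            using el(2,4,5) by (auto simp: b2_def)
        qed (rule fB3)
        then show ?thesis using b_hyp[OF pB(1)] unfolding N_def by linarith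
      qed
      have c3: "real (card b3) \<le> real N^3 / 100"
      proof -
        have "card b3 \<le> card {(u,v,w) \<in> A \<times> B \<times> B. {p2,u,v,w} \<notin> E}"
        proof (rule card_inj_on_le[of "\<lambda>(e1,e2,e3). (al e2, y e3, z e1)"])
          show "inj_on (\<lambda>(e1,e2,e3). (al e2, y e3, z e1)) b3"
            using injs by (auto simp: inj_on_def b3_def)
          show "(\<lambda>(e1,e2,e3). (al e2, y e3, z e1)) ` b3 \<subseteq> {(u,v,w) \<in> A \<times> B \<times> B. {p2,u,v,w} \<notin> E}"
            using el(2,4,5) by (auto simp: b3_def)
        qed (rule fB3)
        then show ?thesis using b_hyp[OF pB(2)] unfolding N_def by linarith
      qed
      have c4: "real (card b4) \<le> real N^3 / 100"
      proof -
        have "card b4 \<le> card {(u,v,w) \<in> A \<times> B \<times> B. {p3,u,v,w} \<notin> E}"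
        proof (rule card_inj_on_le[of "\<lambda>(e1,e2,e3). (al e3, y e1, z e2)"])
          show "inj_on (\<lambda>(e1,e2,e3). (al e3, y e1, z e2)) b4"
            using injs by (auto simp: inj_on_def b4_def)
          show "(\<lambda>(e1,e2,e3). (al e3, y e1, z e2)) ` b4 \<subseteq> {(u,v,w) \<in> A \<times> B \<times> B. {p3,u,v,w} \<notin> E}"
            using el(2,4,5) by (auto simp: b4_def)
        qed (rule fB3)
        then show ?thesis using b_hyp[OF pB(3)] unfolding N_def by linarith
      qed
      have "card (b1 \<union> b2 \<union> b3 \<union> b4) \<le> card b1 + card b2 + card b3 + card b4"
        by (meson add_le_mono1 card_Un_le order.trans)
      then have "real (card (b1 \<union> b2 \<union> b3 \<union> b4)) \<le> 4 * (real N^3 / 100)" using c1 c2 c3 c4 by linarith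
      moreover have "(real N / 2)^3 \<le> real m^3" using False by (intro power_mono) auto
      moreover have "(real N / 2)^3 = real N^3 / 8" by (simp add: power_divide)
      moreover have "real (card ?M3) = real m^3" by (simp add: card_cartesian_product power3_eq_cube m_def)
      moreover have "0 < real N^3" using N0 by simp
      ultimately have "real (card (b1 \<union> b2 \<union> b3 \<union> b4)) < card ?M3" by linarith
      moreover have "finite (b1 \<union> b2 \<union> b3 \<union> b4)"
        by (rule finite_subset[OF _ fM3]) (auto simp: b1_def b2_def b3_def b4_def)
      ultimately have "\<not> ?M3 \<subseteq> b1 \<union> b2 \<union> b3 \<union> b4" using card_mono[of "b1 \<union> b2 \<union> b3 \<union> b4" ?M3] by linarith
      then obtain t where t: "t \<in> ?M3" "t \<notin> b1 \<union> b2 \<union> b3 \<union> b4" by blast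
      obtain e1 e2 e3 where t': "t = (e1,e2,e3)" by (cases t) auto
      have e: "e1 \<in> M" "e2 \<in> M" "e3 \<in> M" using t t' by auto
      define f0 f1 f2 f3 where "f0 = {a0, x e1, x e2, x e3}" and "f1 = {p1, al e1, y e2, z e3}"
        and "f2 = {p2, al e2, y e3, z e1}" and "f3 = {p3, al e3, y e1, z e2}"
      have fE: "f0 \<in> E" "f1 \<in> E" "f2 \<in> E" "f3 \<in> E"
        using t e unfolding t' by (simp_all add: b1_def b2_def b3_def b4_def f0_def f1_def f2_def f3_def)
      have f': "f1 = {al e1, p1, y e2, z e3}" "f2 = {al e2, p2, y e3, z e1}" "f3 = {al e3, p3, y e1, z e2}"
        by (simp_all add: f1_def f2_def f3_def insert_commute)
      note el' = el[OF e(1)] el[OF e(2)] el[OF e(3)]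
      have f0E': "f0 \<in> E'" unfolding f0_def by (rule abE'[OF fE(1)[unfolded f0_def] a0(1) el'(3,8,13)])
      have f1E': "f1 \<in> E'" unfolding f'(1) by (rule abE'[OF fE(2)[unfolded f'(1)] el'(2) pB(1) el'(9,15)])
      have f2E': "f2 \<in> E'" unfolding f'(2) by (rule abE'[OF fE(3)[unfolded f'(2)] el'(7) pB(2) el'(14,5)])
      have f3E': "f3 \<in> E'" unfolding f'(3) by (rule abE'[OF fE(4)[unfolded f'(3)] el'(12) pB(3) el'(4,10)])
      note fE' = f0E' f1E' f2E' f3E'
      \<comment> \<open>Triples with a repeated edge were not excluded before; they drop out because
        the edge \<open>f0\<close> has four distinct vertices.\<close>
      have ne: "e1 \<noteq> e2" "e1 \<noteq> e3" "e2 \<noteq> e3"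
        using E'(3)[OF fE'(1)] unfolding f0_def by (auto simp: card_insert_if split: if_splits)
      have D: "{al e1, x e1, y e1, z e1} \<inter> {al e2, x e2, y e2, z e2} = {}"
        "{al e1, x e1, y e1, z e1} \<inter> {al e3, x e3, y e3, z e3} = {}"
        "{al e2, x e2, y e2, z e2} \<inter> {al e3, x e3, y e3, z e3} = {}"
        unfolding el(1)[OF e(1), symmetric] el(1)[OF e(2), symmetric] el(1)[OF e(3), symmetric]
        by (rule dj[OF e(1,2) ne(1)] dj[OF e(1,3) ne(2)] dj[OF e(2,3) ne(3)])+
      have eW: "e1 \<subseteq> W" "e2 \<subseteq> W" "e3 \<subseteq> W" using e M(3) by blast+
      have O: "{a0,p1,p2,p3} \<inter> W = {}" using a0 pB by blast
      have O': "{a0,p1,p2,p3} \<inter> {al e1, x e1, y e1, z e1} = {}" "{a0,p1,p2,p3} \<inter> {al e2, x e2, y e2, z e2} = {}"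
         "{a0,p1,p2,p3} \<inter> {al e3, x e3, y e3, z e3} = {}"
        unfolding el(1)[OF e(1), symmetric] el(1)[OF e(2), symmetric] el(1)[OF e(3), symmetric]
        using O eW by blast+
      have I: "al e1 \<noteq> x e1" "al e1 \<noteq> y e1" "al e1 \<noteq> z e1" "x e1 \<noteq> y e1" "x e1 \<noteq> z e1" "y e1 \<noteq> z e1" if "e1 \<in> M" for e1
      proof -
        have "card {al e1, x e1, y e1, z e1} = 4"
          unfolding el(1)[OF that, symmetric] by (rule E'(3)[OF subsetD[OF M(1) that]])
        then show "al e1 \<noteq> x e1" "al e1 \<noteq> y e1" "al e1 \<noteq> z e1" "x e1 \<noteq> y e1" "x e1 \<noteq> z e1" "y e1 \<noteq> z e1"
          by (auto simp: card_insert_if split: if_splits)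
      qed
      have ap: "a0 \<noteq> p1" "a0 \<noteq> p2" "a0 \<noteq> p3" using a0 pB AB by blast+
      have fd: "f0 \<inter> f1 = {}" "f0 \<inter> f2 = {}" "f0 \<inter> f3 = {}" "f1 \<inter> f2 = {}" "f1 \<inter> f3 = {}" "f2 \<inter> f3 = {}"
        unfolding f0_def f1_def f2_def f3_def using D O' I[OF e(1)] I[OF e(2)] I[OF e(3)] ap p(2-4) by auto
      define R where "R = \<Union>(M - {e1,e2,e3})"
      have mR: "matchable E' R" unfolding R_def
        by (rule matchable_Union[OF _ pairwise_subset[OF M(2)]]) (use M(1) in blast)+
      have WR: "W = R \<union> (e1 \<union> e2 \<union> e3)" using M(3) e by (auto simp: R_def)
      have Rdj: "R \<inter> e' = {}" if "e' \<in> M" "e' \<in> {e1,e2,e3}" for e'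
      proof -
        have "e'' \<inter> e' = {}" if "e'' \<in> M - {e1,e2,e3}" for e'' using that \<open>e' \<in> {e1,e2,e3}\<close> by (intro dj \<open>e' \<in> M\<close>) auto
        then show ?thesis unfolding R_def by blast
      qed
      have Re: "R \<inter> e1 = {}" "R \<inter> e2 = {}" "R \<inter> e3 = {}" using e by (simp_all add: Rdj)
      have fsub: "f0 \<union> f1 \<union> f2 \<union> f3 \<subseteq> {a0,p1,p2,p3} \<union> (e1 \<union> e2 \<union> e3)"
        using ins[OF e(1)] ins[OF e(2)] ins[OF e(3)] unfolding f0_def f1_def f2_def f3_def by blast
      have RF: "R \<inter> (f0 \<union> f1 \<union> f2 \<union> f3) = {}" using fsub Re O WR by blast
      have mF: "matchable E' (f0 \<union> f1 \<union> f2 \<union> f3)"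
        using fd fE' by (intro matchable_Un matchable_edge) (simp_all add: Int_Un_distrib2)
      have ff: "finite f0" "finite f1" "finite f2" "finite f3" "finite R"
        using E'(4)[OF f0E'] E'(4)[OF f1E'] E'(4)[OF f2E'] E'(4)[OF f3E'] finite_subset[OF _ fW, of R] WR by blast+
      have "card (f0 \<union> f1 \<union> f2 \<union> f3) = 16"
        using fd ff E'(3)[OF fE'(1)] E'(3)[OF fE'(2)] E'(3)[OF fE'(3)] E'(3)[OF fE'(4)]
        by (simp add: card_Un_disjoint Int_Un_distrib2)
      then have c1: "card (R \<union> (f0 \<union> f1 \<union> f2 \<union> f3)) = card R + 16"
        using RF ff by (subst card_Un_disjoint) auto
      have fe: "finite e1" "finite e2" "finite e3" "card e1 = 4" "card e2 = 4" "card e3 = 4"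
        using E'(3,4)[OF subsetD[OF M(1) e(1)]] E'(3,4)[OF subsetD[OF M(1) e(2)]] E'(3,4)[OF subsetD[OF M(1) e(3)]]
        by simp_all
      have "card W \<le> card R + (card e1 + card e2 + card e3)"
        unfolding WR by (meson add_le_mono1 add_left_mono card_Un_le order.trans)
      then have "card W < card (R \<union> (f0 \<union> f1 \<union> f2 \<union> f3))" using c1 fe by simp
      from extend[OF mR RF mF this] show ?thesis ..
    qed
  qed
qed

section \<open>Binomial estimates and degrees relative to a vertex set\<close>

lemma choose_3_upper:
  assumes "q \<le> p"
  shows "p choose 3 \<le> (q choose 3) + (p - q) * p\<^sup>2"
proof -
  have "(q + d) choose 3 \<le> (q choose 3) + d * (q + d)\<^sup>2" for d
  proof (induction d)
    case (Suc d)
    have "m choose 2 \<le> m\<^sup>2" for m :: nat by (induction m) (auto simp: eval_nat_numeral)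
    then have c2: "(q + d) choose 2 \<le> (q + d)\<^sup>2" .
    have "(q + Suc d) choose 3 = ((q + d) choose 3) + ((q + d) choose 2)" by (simp add: eval_nat_numeral)
    also have "\<dots> \<le> (q choose 3) + (d * (q + d)\<^sup>2 + (q + d)\<^sup>2)" using Suc.IH c2 by linarith
    also have "d * (q + d)\<^sup>2 + (q + d)\<^sup>2 = Suc d * (q + d)\<^sup>2" by simp
    also have "\<dots> \<le> Suc d * (q + Suc d)\<^sup>2" by (intro mult_left_mono power_mono) auto
    finally show ?case by simp
  qed simp
  from this[of "p - q"] show ?thesis using assms by simp
qed

lemma choose_3_lower: "(q choose 3) + d * (q choose 2) \<le> (q + d) choose 3"
proof (induction d)
  case (Suc d)
  have "q choose 2 \<le> (q + d) choose 2" by (induction d) (auto simp: eval_nat_numeral)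
  moreover have "(q + Suc d) choose 3 = ((q + d) choose 3) + ((q + d) choose 2)" by (simp add: eval_nat_numeral)
  ultimately show ?case using Suc.IH by simp
qed simp

text \<open>These three degrees measure the distance from the extremal example with parts
  \<open>A = V - B\<close> and \<open>B\<close>. For \<open>v\<close> in \<open>B\<close>,
  \<open>inner_degree\<close> counts edges inside \<open>B\<close> and \<open>missing_degree\<close>
  non-edges that meet \<open>A\<close>; the example has neither. For \<open>v\<close> in
  \<open>A\<close>, \<open>inner_degree\<close> counts edges of type ABBB and
  \<open>nonlink_degree\<close> the non-edges of that type.\<close>

definition inner_degree :: "'a set set \<Rightarrow> 'a set \<Rightarrow> 'a \<Rightarrow> nat" where
  "inner_degree E B v = card {T \<in> link E v. T \<subseteq> B}"

definition missing_degree :: "'a set \<Rightarrow> 'a set set \<Rightarrow> 'a set \<Rightarrow> 'a \<Rightarrow> nat" where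
  "missing_degree V E B v = card {T. T \<subseteq> V - {v} \<and> card T = 3 \<and> \<not> T \<subseteq> B \<and> T \<notin> link E v}"

definition nonlink_degree :: "'a set set \<Rightarrow> 'a set \<Rightarrow> 'a \<Rightarrow> nat" where
  "nonlink_degree E B v = card {T. T \<subseteq> B \<and> card T = 3 \<and> T \<notin> link E v}"

lemma link_subset':
  assumes "uniform_hypergraph 4 V E"
  shows "link E v \<subseteq> {T. T \<subseteq> V - {v} \<and> card T = 3}"
  using link_subset[OF assms, of v] by (auto simp: link_def)

text \<open>The triples of \<open>V - {v}\<close> are split into those inside \<open>B\<close>, the
  missing ones, and the members of the link not inside \<open>B\<close>. With the degree hypothesis
  this becomes the inequality \<open>key\<close>, the form in which the extremal case uses the exact
  bound: non-edges at \<open>v\<close> and excess size of \<open>B\<close> are both paid for by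
  edges inside \<open>B\<close>.\<close>

lemma missing_eq:
  assumes H: "uniform_hypergraph 4 V E" and v: "v \<in> V" and B: "B \<subseteq> V"
  shows "missing_degree V E B v + (card (B - {v}) choose 3) + vertex_degree E v = (card V - 1 choose 3) + inner_degree E B v"
proof -
  note HD = uniform_hypergraphD[OF H]
  let ?P = "{T. T \<subseteq> V - {v} \<and> card T = 3}" and ?L = "link E v"
  let ?M = "{T. T \<subseteq> V - {v} \<and> card T = 3 \<and> \<not> T \<subseteq> B \<and> T \<notin> ?L}"
  let ?I = "{T. T \<subseteq> B - {v} \<and> card T = 3}"
  have LP: "?L \<subseteq> ?P" by (rule link_subset'[OF H])
  have fP: "finite ?P" using HD(1) by simp
  have fL: "finite ?L" using LP fP by (rule finite_subset)
  have fI: "finite ?I" using HD(1) B finite_subset[OF B] by simp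
  have fM: "finite ?M" by (rule finite_subset[OF _ fP]) blast
  have cP: "card ?P = (card V - 1) choose 3" using HD(1) v by (simp add: n_subsets)
  have cI: "card ?I = card (B - {v}) choose 3" using finite_subset[OF B HD(1)] by (simp add: n_subsets)
  have split: "?P = ?I \<union> (?M \<union> {T \<in> ?L. \<not> T \<subseteq> B})"
    using LP B by (intro equalityI subsetI) blast+
  have "card ?P = card ?I + (card ?M + card {T \<in> ?L. \<not> T \<subseteq> B})"
  proof -
    have "card (?M \<union> {T \<in> ?L. \<not> T \<subseteq> B}) = card ?M + card {T \<in> ?L. \<not> T \<subseteq> B}"
      using fM fL by (intro card_Un_disjoint) auto
    moreover have "card (?I \<union> (?M \<union> {T \<in> ?L. \<not> T \<subseteq> B})) = card ?I + card (?M \<union> {T \<in> ?L. \<not> T \<subseteq> B})"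
      using fI fM fL by (intro card_Un_disjoint) auto
    ultimately show ?thesis using arg_cong[OF split, of card] by linarith
  qed
  moreover have "card ?L = card {T \<in> ?L. T \<subseteq> B} + card {T \<in> ?L. \<not> T \<subseteq> B}"
  proof -
    have "?L = {T \<in> ?L. T \<subseteq> B} \<union> {T \<in> ?L. \<not> T \<subseteq> B}" by blast
    moreover have "card ({T \<in> ?L. T \<subseteq> B} \<union> {T \<in> ?L. \<not> T \<subseteq> B}) = card {T \<in> ?L. T \<subseteq> B} + card {T \<in> ?L. \<not> T \<subseteq> B}"
      using fL by (intro card_Un_disjoint) auto
    ultimately show ?thesis by (simp only:)
  qed
  ultimately show ?thesis unfolding missing_degree_def inner_degree_def card_link[symmetric] cP cI by linarith
qed

lemma nonlink_eq:
  assumes "uniform_hypergraph 4 V E" "finite B" "v \<notin> B"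
  shows "nonlink_degree E B v + inner_degree E B v = card B choose 3"
proof -
  let ?N = "{T. T \<subseteq> B \<and> card T = 3 \<and> T \<notin> link E v}" and ?I = "{T \<in> link E v. T \<subseteq> B}"
  have f: "finite {T. T \<subseteq> B \<and> card T = 3}" using assms(2) by simp
  have "{T. T \<subseteq> B \<and> card T = 3} = ?N \<union> ?I"
    using link_subset[OF assms(1), of v] by (intro equalityI subsetI) blast+
  moreover have "finite ?N" by (rule finite_subset[OF _ f]) blast
  moreover have "finite ?I" by (rule finite_subset[of _ "Pow B"]) (use assms(2) in auto)
  ultimately have "card {T. T \<subseteq> B \<and> card T = 3} = card ?N + card ?I"
    by (simp only:) (rule card_Un_disjoint, auto)
  then show ?thesis using assms(2) by (simp add: nonlink_degree_def inner_degree_def n_subsets)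
qed

text \<open>A non-edge \<open>insert a T\<close> of type ABBB is also a missing triple at any vertex
  of \<open>T\<close>. Picking one vertex \<open>b T\<close> gives an injection, so control over the
  missing triples at \<open>B\<close> carries over to \<open>A\<close>.\<close>

lemma sum_nonlink_le_sum_missing:
  assumes V: "finite V" and B: "B \<subseteq> V" and X: "X \<subseteq> V - B"
  shows "(\<Sum>a\<in>X. nonlink_degree E B a) \<le> (\<Sum>b\<in>B. missing_degree V E B b)"
proof -
  define NL where "NL a = {T. T \<subseteq> B \<and> card T = 3 \<and> T \<notin> link E a}" for a
  define MS where "MS b = {T. T \<subseteq> V - {b} \<and> card T = 3 \<and> \<not> T \<subseteq> B \<and> T \<notin> link E b}" for b
  have fB: "finite B" and fX: "finite X" using B X V by (auto intro: finite_subset)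
  have fNL: "finite (NL a)" for a by (rule finite_subset[of _ "Pow B"]) (use fB in \<open>auto simp: NL_def\<close>)
  have fMS: "finite (MS a)" for a by (rule finite_subset[of _ "Pow V"]) (use V in \<open>auto simp: MS_def\<close>)
  define b where "b T = (SOME b. b \<in> T)" for T :: "'a set"
  have b: "b T \<in> T" if "card T = 3" for T
  proof -
    have "T \<noteq> {}" using that by auto
    then show ?thesis unfolding b_def by (rule some_in_eq[THEN iffD2])
  qed
  define h where "h p = (b (snd p), insert (fst p) (snd p - {b (snd p)}))" for p :: "'a \<times> 'a set"
  have mem: "b T \<in> B" "insert a (T - {b T}) \<in> MS (b T)" if "a \<in> X" "T \<in> NL a" for a T
  proof -
    have T: "T \<subseteq> B" "card T = 3" "T \<notin> link E a" using that(2) by (auto simp: NL_def)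
    have bT: "b T \<in> T" using b[OF T(2)] .
    then show bB: "b T \<in> B" using T(1) by blast
    have a: "a \<notin> B" "a \<in> V" using that(1) X by auto
    have fT: "finite T" using T(1) fB by (rule finite_subset)
    have "card (insert a (T - {b T})) = 3" using a T bT fT by (subst card_insert_disjoint) auto
    moreover have "insert a (T - {b T}) \<notin> link E (b T)"
    proof
      assume "insert a (T - {b T}) \<in> link E (b T)"
      then have "insert (b T) (insert a (T - {b T})) \<in> E" by (simp add: link_def)
      moreover have "insert (b T) (insert a (T - {b T})) = insert a T" using bT by blast
      ultimately have "insert a T \<in> E" by simp
      moreover have "a \<notin> T" using a(1) T(1) by blast
      ultimately show False using T(3) by (simp add: link_def)
    qed
    moreover have "insert a (T - {b T}) \<subseteq> V - {b T}" using a bB T(1) B by blast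
    moreover have "\<not> insert a (T - {b T}) \<subseteq> B" using a(1) by blast
    ultimately show "insert a (T - {b T}) \<in> MS (b T)" unfolding MS_def by (intro CollectI conjI)
  qed
  have "inj_on h (Sigma X NL)"
  proof (rule inj_onI)
    fix p p' assume p: "p \<in> Sigma X NL" "p' \<in> Sigma X NL" "h p = h p'"
    obtain a T a' T' where pp: "p = (a,T)" "p' = (a',T')" by (cases p, cases p')
    have T: "T \<subseteq> B" "card T = 3" "T' \<subseteq> B" "card T' = 3" and a: "a \<notin> B" "a' \<notin> B"
      using p(1,2) X unfolding pp by (auto simp: NL_def)
    have eq: "b T = b T'" "insert a (T - {b T}) = insert a' (T' - {b T'})" using p(3) by (auto simp: h_def pp)
    have "a = a'" using eq(2) a T by blast
    moreover have "T = T'"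
    proof -
      have "a \<notin> T - {b T}" "a \<notin> T' - {b T}" using a(1) T(1,3) by blast+
      moreover have "insert a (T - {b T}) = insert a (T' - {b T})" using eq \<open>a = a'\<close> by simp
      ultimately have "T - {b T} = T' - {b T}" using insert_ident by metis
      then show ?thesis using b[OF T(2)] b[OF T(4)] eq(1) by (metis insert_Diff)
    qed
    ultimately show "p = p'" by (simp add: pp)
  qed
  moreover have "h ` Sigma X NL \<subseteq> Sigma B MS" using mem by (auto simp: h_def)
  moreover have "finite (Sigma B MS)" using fB fMS by auto
  ultimately have "card (Sigma X NL) \<le> card (Sigma B MS)" by (rule card_inj_on_le)
  then show ?thesis using fX fB fNL fMS by (simp add: nonlink_degree_def missing_degree_def NL_def MS_def)
qed

lemma card_pair_image_le:
  assumes "finite C" "finite D"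
  shows "card ((\<lambda>(u,w). g u w) ` (C \<times> D)) \<le> card C * card D"
  using card_image_le[of "C \<times> D" "\<lambda>(u,w). g u w"] assms by (simp add: card_cartesian_product)

text \<open>The hypotheses of \<open>abbb_matching\<close> count ordered triples including
  degenerate ones: every 3-set yields six, and triples with a coincidence add at most
  \<open>3*n^2\<close>.\<close>

lemma ordered_nonlink:
  assumes H: "uniform_hypergraph 4 V E" and B: "B \<subseteq> V" and a: "a \<notin> B"
  shows "card {(u,v,w) \<in> B \<times> B \<times> B. {a,u,v,w} \<notin> E} \<le> 6 * nonlink_degree E B a + 3 * (card V)\<^sup>2"
proof -
  note HD = uniform_hypergraphD[OF H]
  have fB: "finite B" using B HD(1) by (rule finite_subset)
  let ?N = "{T. T \<subseteq> B \<and> card T = 3 \<and> T \<notin> link E a}"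
  have fN: "finite ?N" by (rule finite_subset[of _ "Pow B"]) (use fB in auto)
  have fN3: "finite {(u,v,w). {u,v,w} \<in> ?N}" by (rule finite_subset[of _ "B \<times> B \<times> B"]) (use fB in auto)
  let ?D1 = "(\<lambda>(u,w). (u,u,w)) ` (B \<times> B)" and ?D2 = "(\<lambda>(u,w). (u,w,u)) ` (B \<times> B)" and ?D3 = "(\<lambda>(u,w). (u,w,w)) ` (B \<times> B)"
  have "{(u,v,w) \<in> B \<times> B \<times> B. {a,u,v,w} \<notin> E} \<subseteq> {(u,v,w). {u,v,w} \<in> ?N} \<union> (?D1 \<union> (?D2 \<union> ?D3))"
  proof
    fix t assume t: "t \<in> {(u,v,w) \<in> B \<times> B \<times> B. {a,u,v,w} \<notin> E}"
    obtain u v w where uvw: "t = (u,v,w)" by (cases t)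
    have m: "u \<in> B" "v \<in> B" "w \<in> B" "{a,u,v,w} \<notin> E" using t uvw by auto
    show "t \<in> {(u,v,w). {u,v,w} \<in> ?N} \<union> (?D1 \<union> (?D2 \<union> ?D3))"
    proof (cases "u = v \<or> u = w \<or> v = w")
      case True
      then show ?thesis using m(1-3) unfolding uvw by auto
    next
      case False
      then have "card {u,v,w} = 3" by simp
      moreover have "{u,v,w} \<notin> link E a" using m(4) by (simp add: link_def)
      ultimately show ?thesis using m(1-3) unfolding uvw by simp
    qed
  qed
  then have "card {(u,v,w) \<in> B \<times> B \<times> B. {a,u,v,w} \<notin> E} \<le> card ({(u,v,w). {u,v,w} \<in> ?N} \<union> (?D1 \<union> (?D2 \<union> ?D3)))"
    by (rule card_mono[rotated]) (use fN3 fB in auto)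
  also have "\<dots> \<le> card {(u,v,w). {u,v,w} \<in> ?N} + (card ?D1 + (card ?D2 + card ?D3))"
    by (meson add_left_mono card_Un_le order.trans)
  also have "card {(u,v,w). {u,v,w} \<in> ?N} = 6 * nonlink_degree E B a"
    unfolding nonlink_degree_def by (rule card_ordered_triples[OF fN]) simp
  also have "card ?D1 + (card ?D2 + card ?D3) \<le> 3 * (card B * card B)"
    using card_pair_image_le[OF fB fB, of "\<lambda>u w. (u,u,w)"] card_pair_image_le[OF fB fB, of "\<lambda>u w. (u,w,u)"]
      card_pair_image_le[OF fB fB, of "\<lambda>u w. (u,w,w)"] by linarith
  also have "card B * card B \<le> (card V)\<^sup>2"
    unfolding power2_eq_square using card_mono[OF HD(1) B] by (intro mult_mono) auto
  finally show ?thesis by simp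
qed

lemma ordered_missing:
  assumes H: "uniform_hypergraph 4 V E" and B: "B \<subseteq> V" and b: "b \<in> B" and A: "A = V - B"
  shows "card {(u,v,w) \<in> A \<times> B \<times> B. {b,u,v,w} \<notin> E} \<le> 6 * missing_degree V E B b + 3 * (card V)\<^sup>2"
    and "card {(u,v,w) \<in> A \<times> A \<times> B. {b,u,v,w} \<notin> E} \<le> 6 * missing_degree V E B b + 3 * (card V)\<^sup>2"
proof -
  note HD = uniform_hypergraphD[OF H]
  let ?N = "{T. T \<subseteq> V - {b} \<and> card T = 3 \<and> \<not> T \<subseteq> B \<and> T \<notin> link E b}"
  have fN: "finite ?N" by (rule finite_subset[of _ "Pow V"]) (use HD(1) in auto)
  have fN3: "finite {(u,v,w). {u,v,w} \<in> ?N}" by (rule finite_subset[of _ "V \<times> V \<times> V"]) (use HD(1) in auto)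
  have bV: "b \<in> V" using b B by blast
  have gen: "card {(u,v,w) \<in> A \<times> Y \<times> B. {b,u,v,w} \<notin> E} \<le> 6 * missing_degree V E B b + 3 * (card V)\<^sup>2"
    if Y: "Y \<subseteq> V" "Y \<inter> B = {} \<or> Y \<inter> A = {}" for Y
  proof -
    have AV: "A \<subseteq> V" using A by blast
    \<comment> \<open>Apart from \<open>v = b\<close> and \<open>w = b\<close> only one coincidence
      can occur: \<open>u = v\<close> if \<open>Y\<close> is disjoint from \<open>B\<close>, and
      \<open>v = w\<close> if it is disjoint from \<open>A\<close>. The map \<open>g1\<close> covers
      whichever applies.\<close>
    define g1 g2 g3 :: "'a \<Rightarrow> 'a \<Rightarrow> 'a \<times> 'a \<times> 'a" where "g1 = (\<lambda>u w. if Y \<inter> B = {} then (u,u,w) else (u,w,w))"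
      and "g2 = (\<lambda>u w. (u, w, b))" and "g3 = (\<lambda>u w. (u, b, w))"
    let ?D1 = "(\<lambda>(u,w). g1 u w) ` (V \<times> V)" and ?D2 = "(\<lambda>(u,w). g2 u w) ` (V \<times> V)" and ?D3 = "(\<lambda>(u,w). g3 u w) ` (V \<times> V)"
    have "{(u,v,w) \<in> A \<times> Y \<times> B. {b,u,v,w} \<notin> E} \<subseteq> {(u,v,w). {u,v,w} \<in> ?N} \<union> (?D1 \<union> (?D2 \<union> ?D3))"
    proof
      fix t assume t: "t \<in> {(u,v,w) \<in> A \<times> Y \<times> B. {b,u,v,w} \<notin> E}"
      obtain u v w where uvw: "t = (u,v,w)" by (cases t)
      have m: "u \<in> A" "v \<in> Y" "w \<in> B" "{b,u,v,w} \<notin> E" using t uvw by auto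
      have mV: "u \<in> V" "v \<in> V" "w \<in> V" "u \<notin> B" using m(1-3) A Y(1) B by blast+
      have ub: "u \<noteq> b" "u \<noteq> w" using mV(4) b m(3) by blast+
      consider "v = b" | "w = b" | "u = v" | "v = w" | "v \<noteq> b" "w \<noteq> b" "u \<noteq> v" "v \<noteq> w" by blast
      then show "t \<in> {(u,v,w). {u,v,w} \<in> ?N} \<union> (?D1 \<union> (?D2 \<union> ?D3))"
      proof cases
        case 1
        have "t = (\<lambda>(u,w). g3 u w) (u,w)" by (simp add: uvw 1 g3_def)
        moreover have "(u,w) \<in> V \<times> V" using mV by simp
        ultimately have "t \<in> ?D3" by (rule image_eqI)
        then show ?thesis by blast
      next
        case 2
        have "t = (\<lambda>(u,w). g2 u w) (u,v)" by (simp add: uvw 2 g2_def)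
        moreover have "(u,v) \<in> V \<times> V" using mV by simp
        ultimately have "t \<in> ?D2" by (rule image_eqI)
        then show ?thesis by blast
      next
        case 3
        have "u \<in> Y" using m(2) 3 by simp
        then have "Y \<inter> B = {}" using Y(2) m(1) by blast
        then have "t = (\<lambda>(u,w). g1 u w) (u,w)" by (simp add: uvw 3 g1_def)
        moreover have "(u,w) \<in> V \<times> V" using mV by simp
        ultimately have "t \<in> ?D1" by (rule image_eqI)
        then show ?thesis by blast
      next
        case 4
        then have "Y \<inter> B \<noteq> {}" using m(2,3) by blast
        then have "t = (\<lambda>(u,w). g1 u w) (u,w)" by (simp add: uvw 4 g1_def)
        moreover have "(u,w) \<in> V \<times> V" using mV by simp
        ultimately have "t \<in> ?D1" by (rule image_eqI)
        then show ?thesis by blast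
      next
        case 5
        have "card {u,v,w} = 3" using 5 ub by simp
        moreover have "{u,v,w} \<notin> link E b" using m(4) by (simp add: link_def)
        moreover have "{u,v,w} \<subseteq> V - {b}" "\<not> {u,v,w} \<subseteq> B" using 5 mV ub by blast+
        ultimately show ?thesis unfolding uvw by simp
      qed
    qed
    then have "card {(u,v,w) \<in> A \<times> Y \<times> B. {b,u,v,w} \<notin> E} \<le> card ({(u,v,w). {u,v,w} \<in> ?N} \<union> (?D1 \<union> (?D2 \<union> ?D3)))"
      by (rule card_mono[rotated]) (use fN3 HD(1) in auto)
    also have "\<dots> \<le> card {(u,v,w). {u,v,w} \<in> ?N} + (card ?D1 + (card ?D2 + card ?D3))"
      by (meson add_left_mono card_Un_le order.trans)
    also have "card {(u,v,w). {u,v,w} \<in> ?N} = 6 * missing_degree V E B b"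
      unfolding missing_degree_def by (rule card_ordered_triples[OF fN]) simp
    also have "card ?D1 + (card ?D2 + card ?D3) \<le> 3 * (card V * card V)"
      using card_pair_image_le[OF HD(1) HD(1), of g1] card_pair_image_le[OF HD(1) HD(1), of g2]
        card_pair_image_le[OF HD(1) HD(1), of g3] by linarith
    finally show ?thesis by (simp add: power2_eq_square)
  qed
  show "card {(u,v,w) \<in> A \<times> B \<times> B. {b,u,v,w} \<notin> E} \<le> 6 * missing_degree V E B b + 3 * (card V)\<^sup>2"
    by (rule gen[OF B]) (use A in blast)
  show "card {(u,v,w) \<in> A \<times> A \<times> B. {b,u,v,w} \<notin> E} \<le> 6 * missing_degree V E B b + 3 * (card V)\<^sup>2"
    by (rule gen) (use A in blast)+
qed

text \<open>Either a matching inside B is extended greedily, or all edges inside B meet its few vertices, which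
  contradicts the degree bounds.\<close>

lemma bbbb_matching:
  fixes D :: real
  assumes H: "uniform_hypergraph 4 V E" and B: "B \<subseteq> V" "B \<noteq> {}"
    and lower: "\<And>v. v \<in> B \<Longrightarrow> (r - 1) * q + 1 \<le> inner_degree E B v" and upper: "\<And>v. v \<in> B \<Longrightarrow> inner_degree E B v \<le> D"
    and D: "16 * D \<le> real (card B) * real q" "0 \<le> D"
  shows "\<exists>W\<subseteq>B. matchable E W \<and> card W = 4 * r"
proof -
  note HD = uniform_hypergraphD[OF H]
  have fB: "finite B" using B(1) HD(1) by (rule finite_subset)
  define EB where "EB = {e\<in>E. e \<subseteq> B}"
  have HB: "uniform_hypergraph 4 B EB" using fB HD(4) by (auto simp: EB_def uniform_hypergraph_def)
  have deg: "card {e\<in>EB. v \<in> e} = inner_degree E B v" if v: "v \<in> B" for v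
  proof -
    have "link EB v = {T \<in> link E v. T \<subseteq> B}" using v by (auto simp: link_def EB_def)
    then show ?thesis unfolding inner_degree_def using card_link[of EB v] by (simp add: vertex_degree_def)
  qed
  have "\<exists>W\<subseteq>B. matchable EB W \<and> card W = 4 * k" if "k \<le> r" for k
    using that
  proof (induction k)
    case 0
    show ?case by (intro exI[of _ "{}"]) (simp add: matchable_empty)
  next
    case (Suc k)
    then obtain W where W: "W \<subseteq> B" "matchable EB W" "card W = 4 * k" by auto
    have fW: "finite W" using W(1) fB by (rule finite_subset)
    \<comment> \<open>If all edges inside \<open>B\<close> met \<open>W\<close>, there would be at
      most \<open>4*k*D\<close> of them, whereas the lower degree bound gives at least
      \<open>card B * ((r - 1)*q + 1) / 4\<close>. As \<open>k \<le> r - 1\<close> and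
      \<open>16*D \<le> card B * q\<close>, the \<open>+ 1\<close> makes this contradictory. For
      \<open>r = 1\<close> that \<open>+ 1\<close>, inherited from the degree condition, is all that
      provides an edge.\<close>
    have "\<exists>e\<in>EB. e \<inter> W = {}"
    proof (rule ccontr)
      assume "\<not> (\<exists>e\<in>EB. e \<inter> W = {})"
      then have "EB \<subseteq> (\<Union>v\<in>W. {e\<in>EB. v \<in> e})" by blast
      moreover have "finite (\<Union>v\<in>W. {e\<in>EB. v \<in> e})" using fW HD(2) by (auto simp: EB_def)
      ultimately have "card EB \<le> card (\<Union>v\<in>W. {e\<in>EB. v \<in> e})" by (intro card_mono)
      also have "\<dots> \<le> (\<Sum>v\<in>W. card {e\<in>EB. v \<in> e})" by (rule card_UN_le[OF fW])
      also have "\<dots> = (\<Sum>v\<in>W. inner_degree E B v)" using W(1) deg by (intro sum.cong) auto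
      finally have "real (card EB) \<le> real (\<Sum>v\<in>W. inner_degree E B v)" by (rule of_nat_mono)
      also have "\<dots> = (\<Sum>v\<in>W. real (inner_degree E B v))" by simp
      also have "\<dots> \<le> real (card W) * D" using W(1) upper by (intro sum_bounded_above) auto
      finally have up: "real (card EB) \<le> 4 * real k * D" using W(3) by simp
      have "card B * ((r - 1) * q + 1) = (\<Sum>v\<in>B. (r - 1) * q + 1)" by simp
      also have "\<dots> \<le> (\<Sum>v\<in>B. card {e\<in>EB. v \<in> e})" using lower deg by (intro sum_mono) simp
      also have "\<dots> = 4 * card EB" by (rule sum_degrees[OF HB order.refl])
      finally have "real (card B * ((r - 1) * q + 1)) \<le> real (4 * card EB)" by (rule of_nat_mono)
      then have low: "real (card B) * (real (r - 1) * real q + 1) \<le> 4 * real (card EB)"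
        by (simp only: of_nat_mult of_nat_add of_nat_1 of_nat_numeral)
      have "real k * (16 * D) \<le> real (r - 1) * (real (card B) * real q)"
        by (rule mult_mono) (use Suc.prems D in auto)
      moreover have "0 < real (card B)" using B(2) fB by (simp add: card_gt_0_iff)
      moreover have "4 * (4 * real k * D) = real k * (16 * D)" by simp
      moreover have "real (card B) * (real (r - 1) * real q + 1) = real (r - 1) * (real (card B) * real q) + real (card B)"
        by (simp only: distrib_left mult_1_right mult.left_commute)
      ultimately show False using up low by linarith
    qed
    then obtain e where e: "e \<in> EB" "e \<inter> W = {}" by blast
    have eB: "e \<subseteq> B" "card e = 4" "finite e" using e(1) HD(4,5)[of e] by (auto simp: EB_def)
    have "W \<inter> e = {}" using e(2) by blast
    then have "matchable EB (W \<union> e)" by (rule matchable_Un[OF W(2) matchable_edge[OF e(1)]])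
    moreover have "card (W \<union> e) = 4 * Suc k" using fW eB e(2) W(3) by (subst card_Un_disjoint) auto
    ultimately show ?case using W(1) eB(1) by (intro exI[of _ "W \<union> e"]) simp
  qed
  from this[OF order.refl] show ?thesis using matchable_mono[of EB _ E] by (auto simp: EB_def)
qed

section \<open>Balancing the parts and completing the matching\<close>

lemma exists_triple_avoiding:
  assumes "finite Bad" "real (card Bad) < real (card P) * real (card Q) * real (card R)"
  shows "\<exists>u\<in>P. \<exists>v\<in>Q. \<exists>w\<in>R. (u,v,w) \<notin> Bad"
proof (rule ccontr)
  assume "\<not> ?thesis"
  then have "P \<times> Q \<times> R \<subseteq> Bad" by auto
  then have "card (P \<times> Q \<times> R) \<le> card Bad" by (rule card_mono[OF assms(1)])
  then have "real (card (P \<times> Q \<times> R)) \<le> real (card Bad)" by (rule of_nat_mono)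
  then show False using assms(2) by (simp add: card_cartesian_product mult.assoc)
qed

lemma card_Diff_ge: "finite U \<Longrightarrow> real (card X) - real (card U) \<le> real (card (X - U))"
  using diff_card_le_card_Diff[of U X] by linarith

lemma prod3_ge:
  fixes a b c :: real
  assumes "0 \<le> a" "0 \<le> b" "0 \<le> c" "a \<le> x" "b \<le> y" "c \<le> z"
  shows "a * b * c \<le> x * y * z"
  using assms by (intro mult_mono) auto

text \<open>After correcting the sizes of A and B by a few edges of type BBBB or AABB and covering the atypical
  vertices, all remaining vertices lie in almost all edges of type ABBB.\<close>

lemma extremal_partition:
  fixes n :: real
  assumes H: "uniform_hypergraph 4 V E" and n: "n = real (card V)" and big: "1000000000000000 \<le> n" and dvd: "4 dvd card V"
    and B: "B \<subseteq> V" and A: "A = V - B"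
    and size: "\<bar>real (card B) - 3/4 * n\<bar> \<le> n / 1000000000000"
    and b1: "\<And>v. v \<in> B \<Longrightarrow> inner_degree E B v \<le> n^3 / 500"
    and a1: "\<And>a. a \<in> A \<Longrightarrow> n^3 / 2000 \<le> inner_degree E B a"
    and b2: "card {v\<in>B. n^3 / 1000000000000 < inner_degree E B v} \<le> n / 1000000000000"
    and key: "\<And>v. v \<in> V \<Longrightarrow> missing_degree V E B v + (card (B - {v}) choose 3) + 1 \<le> inner_degree E B v + (3 * card V div 4 choose 3)"
  shows "matchable E V"
proof -
  note HD = uniform_hypergraphD[OF H]
  have fB: "finite B" using B HD(1) by (rule finite_subset)
  have fA: "finite A" using HD(1) by (simp add: A)
  have n0: "0 < n" using big by simp
  have AB: "A \<inter> B = {}" "A \<union> B = V" "A \<subseteq> V" using A B by auto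
  obtain k0 where k0: "card V = 4 * k0" using dvd by blast
  define q where "q = 3 * k0"
  have q: "3 * card V div 4 = q" by (simp add: k0 q_def)
  have rq: "real q = 3/4 * n" by (simp add: q_def n k0)
  have cA: "card A = card V - card B" using A B fB by (simp add: card_Diff_subset)
  have cBV: "card B \<le> card V" using HD(1) B by (rule card_mono)
  have rA: "real (card A) = n - real (card B)" using cA cBV by (simp add: n of_nat_diff)
  have sB: "real (card B) \<le> 3/4 * n + n / 1000000000000" "3/4 * n - n / 1000000000000 \<le> real (card B)" using size by linarith+
  have n3: "0 < n^3" using n0 by simp
  have n2n3: "n\<^sup>2 \<le> n^3 / 1000000000000000"
  proof -
    have "n\<^sup>2 * 1000000000000000 \<le> n\<^sup>2 * n" using big by (intro mult_left_mono) auto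
    also have "\<dots> = n^3" by (simp add: power2_eq_square power3_eq_cube)
    finally show ?thesis by simp
  qed
  \<comment> \<open>Few edges inside \<open>B\<close> at \<open>b\<close> imply few missing triples:
    by \<open>key\<close> the two numbers differ by at most the difference of the binomials, which
    is bounded by the shortfall of \<open>card B - 1\<close> below \<open>q\<close> times
    \<open>q^2\<close>.\<close>
  have miss: "missing_degree V E B b \<le> inner_degree E B b + 2 * n^3 / 1000000000000" if b: "b \<in> B" for b
  proof -
    have k: "missing_degree V E B b + (card B - 1 choose 3) \<le> inner_degree E B b + (q choose 3)"
      using key[of b] b B fB q by auto
    show ?thesis
    proof (cases "q \<le> card B - 1")
      case True
      then obtain d where d: "card B - 1 = q + d" using le_Suc_ex by blast
      have "q choose 3 \<le> (card B - 1 choose 3)" unfolding d using choose_3_lower[of q d] by linarith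
      then have "real (missing_degree V E B b) \<le> inner_degree E B b" using k by linarith
      moreover have "0 \<le> 2 * n^3 / 1000000000000" using n3 by simp
      ultimately show ?thesis by linarith
    next
      case False
      then have "q choose 3 \<le> (card B - 1 choose 3) + (q - (card B - 1)) * q\<^sup>2" by (intro choose_3_upper) simp
      then have "missing_degree V E B b \<le> inner_degree E B b + (q - (card B - 1)) * q\<^sup>2" using k by linarith
      then have "real (missing_degree V E B b) \<le> real (inner_degree E B b + (q - (card B - 1)) * q\<^sup>2)" by (rule of_nat_mono)
      also have "\<dots> = inner_degree E B b + real (q - (card B - 1)) * (real q)\<^sup>2" by simp
      also have "\<dots> \<le> inner_degree E B b + (2 * n / 1000000000000) * n\<^sup>2"
      proof -
        have "real (q - (card B - 1)) = real q - real (card B - 1)" using False by (intro of_nat_diff) simp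
        moreover have "real (card B) - 1 \<le> real (card B - 1)" by linarith
        moreover have "1 \<le> n / 1000000000000" using big by simp
        ultimately have "real (q - (card B - 1)) \<le> 2 * n / 1000000000000" using sB(2) rq by linarith
        moreover have "(real q)\<^sup>2 \<le> n\<^sup>2" using rq n0 by (intro power_mono) auto
        moreover have "0 \<le> 2 * n / 1000000000000" using n0 by simp
        ultimately have "real (q - (card B - 1)) * (real q)\<^sup>2 \<le> (2 * n / 1000000000000) * n\<^sup>2" by (intro mult_mono) auto
        then show ?thesis by simp
      qed
      also have "(2 * n / 1000000000000) * n\<^sup>2 = 2 * n^3 / 1000000000000" by (simp add: power2_eq_square power3_eq_cube)
      finally show ?thesis .
    qed
  qed
  define Zb where "Zb = {v\<in>B. n^3 / 1000000000000 < inner_degree E B v}"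
  have Zb: "Zb \<subseteq> B" "finite Zb" "card Zb \<le> n / 1000000000000" using b2 fB by (auto simp: Zb_def)
  have missB: "missing_degree V E B b \<le> n^3 / 400" if "b \<in> B" for b using miss[OF that] b1[OF that] n3 by simp
  have misst: "missing_degree V E B b \<le> 3 * n^3 / 1000000000000" if "b \<in> B - Zb" for b
    using miss[of b] that by (auto simp: Zb_def)
  \<comment> \<open>A square-root threshold: the missing triples over all of \<open>B\<close> number
    at most \<open>4*n^4/10^12\<close>, so threshold and number of exceptional vertices can both
    have relative size 2/10^6.\<close>
  define Za where "Za = {a\<in>A. 2 * n^3 / 1000000 < nonlink_degree E B a}"
  have Za: "Za \<subseteq> A" "finite Za" using fA by (auto simp: Za_def)
  have cZa: "card Za \<le> 2 * n / 1000000"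
  proof -
    have "card Za * (2 * n^3 / 1000000) = (\<Sum>a\<in>Za. 2 * n^3 / 1000000)" by simp
    also have "\<dots> \<le> (\<Sum>a\<in>Za. real (nonlink_degree E B a))" by (intro sum_mono) (simp add: Za_def)
    also have "\<dots> = real (\<Sum>a\<in>Za. nonlink_degree E B a)" by simp
    also have "\<dots> \<le> real (\<Sum>b\<in>B. missing_degree V E B b)"
      by (intro of_nat_mono sum_nonlink_le_sum_missing HD(1) B) (use Za(1) A in blast)
    also have "\<dots> = (\<Sum>b\<in>B - Zb. real (missing_degree V E B b)) + (\<Sum>b\<in>Zb. real (missing_degree V E B b))"
      using sum.subset_diff[OF Zb(1) fB, of "\<lambda>b. real (missing_degree V E B b)"] by simp
    also have "\<dots> \<le> real (card (B - Zb)) * (3 * n^3 / 1000000000000) + real (card Zb) * (n^3 / 400)"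
      using misst missB Zb(1) by (intro add_mono sum_bounded_above) auto
    also have "\<dots> \<le> n * (3 * n^3 / 1000000000000) + n / 1000000000000 * (n^3 / 400)"
    proof (intro add_mono mult_right_mono Zb(3))
      have "card (B - Zb) \<le> card V" using HD(1) B by (intro card_mono) auto
      then show "real (card (B - Zb)) \<le> n" by (simp add: n)
    qed (use n3 in auto)
    also have "\<dots> \<le> (2 * n / 1000000) * (2 * n^3 / 1000000)" using n0 n3 by simp
    finally show ?thesis by (rule mult_right_le_imp_le) (use n3 in simp)
  qed
  have finT: "finite {(u,v,w) \<in> X \<times> Y \<times> Z. R u v w}" if "X \<subseteq> V" "Y \<subseteq> V" "Z \<subseteq> V" for X Y Z :: "'a set" and R
    by (rule finite_subset[of _ "V \<times> V \<times> V"]) (use that HD(1) in auto)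
  have oB: "real (card {(u,v,w) \<in> A \<times> B \<times> B. {b,u,v,w} \<notin> E}) \<le> 6 * missing_degree V E B b + 3 * n\<^sup>2"
    "real (card {(u,v,w) \<in> A \<times> A \<times> B. {b,u,v,w} \<notin> E}) \<le> 6 * missing_degree V E B b + 3 * n\<^sup>2" if "b \<in> B" for b
    using ordered_missing[OF H B that A, THEN of_nat_mono[where 'a = real]] by (simp_all add: n)
  have oA: "real (card {(u,v,w) \<in> B \<times> B \<times> B. {a,u,v,w} \<notin> E}) \<le> 6 * nonlink_degree E B a + 3 * n\<^sup>2" if "a \<in> A" for a
  proof -
    have "a \<notin> B" using that A by blast
    from ordered_nonlink[OF H B this, THEN of_nat_mono[where 'a = real]] show ?thesis by (simp add: n)
  qed
  \<comment> \<open>Removing an edge inside \<open>B\<close> lowers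
    \<open>card B - 3 * card A\<close> by 4, and removing an AABB edge raises it by 4. This
    difference equals four times \<open>card B - q\<close>, so exactly that many edges of the
    suitable type restore the ratio 3:1.\<close>
  have "\<exists>W0\<subseteq>V. matchable E W0 \<and> card W0 \<le> 4 * n / 1000000000000 \<and> card (B - W0) = 3 * card (A - W0)"
  proof -
    consider "card B = q" | "q < card B" | "card B < q" by linarith
    then show ?thesis
    proof cases
      case 1
      then have "card B = 3 * card A" using cA k0 by (simp add: q_def)
      then show ?thesis using n0 by (intro exI[of _ "{}"]) (simp add: matchable_empty)
    next
      case 2
      define r where "r = card B - q"
      have r: "1 \<le> r" "card B = q + r" using 2 by (auto simp: r_def)
      have "real r \<le> n / 1000000000000" using r(2) sB(1) rq by linarith
      have "\<exists>W\<subseteq>B. matchable E W \<and> card W = 4 * r"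
      proof (rule bbbb_matching[OF H B])
        show "B \<noteq> {}" using r by auto
        \<comment> \<open>Here the exact degree condition pays: \<open>B - {v}\<close> has
          \<open>q + (r - 1)\<close> vertices, and each vertex beyond \<open>q\<close> forces
          another \<open>q choose 2\<close> edges inside \<open>B\<close> at
          \<open>v\<close>.\<close>
        show "(r - 1) * (q choose 2) + 1 \<le> inner_degree E B v" if v: "v \<in> B" for v
        proof -
          have "card (B - {v}) = q + (r - 1)" using v fB r by simp
          then have "(q choose 3) + (r - 1) * (q choose 2) \<le> (card (B - {v}) choose 3)"
            using choose_3_lower[of q "r - 1"] by simp
          moreover have "v \<in> V" using v B by blast
          ultimately show ?thesis using key[of v, unfolded q] by linarith
        qed
        show "real (inner_degree E B v) \<le> n^3 / 500" if "v \<in> B" for v using b1[OF that] .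
        show "16 * (n^3 / 500) \<le> real (card B) * real (q choose 2)"
        proof -
          have "real (q choose 2) = real q * (real q - 1) / 2"
          proof -
            have "even (q * (q - 1))" by (cases q) auto
            then have "real (q choose 2) = real (q * (q - 1)) / 2" unfolding choose_two by (simp add: real_of_nat_div)
            moreover have "1000 \<le> n" using big by simp
            then have "1 \<le> q" using rq by linarith
            ultimately show ?thesis by (simp add: of_nat_diff)
          qed
          also have "\<dots> \<ge> (7/10 * n) * (7/10 * n) / 2"
            using rq big by (intro divide_right_mono mult_mono) auto
          finally have "real (card B) * real (q choose 2) \<ge> (7/10 * n) * ((7/10 * n) * (7/10 * n) / 2)"
            using sB(2) n0 by (intro mult_mono) auto
          moreover have "(7/10 * n) * ((7/10 * n) * (7/10 * n) / 2) = 343/2000 * n^3" by (simp add: power3_eq_cube)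
          ultimately show ?thesis using n3 by linarith
        qed
        show "0 \<le> n^3 / 500" using n3 by simp
      qed
      then obtain W where W: "W \<subseteq> B" "matchable E W" "card W = 4 * r" by blast
      have fW: "finite W" using W(1) fB by (rule finite_subset)
      have "card (B - W) = card B - 4 * r" using W fW by (simp add: card_Diff_subset)
      moreover have "A - W = A" using W(1) AB(1) by blast
      moreover have "4 * r \<le> card B" using W card_mono[OF fB W(1)] by simp
      ultimately have "card (B - W) = 3 * card (A - W)" using cA k0 r(2) cBV by (simp add: q_def)
      moreover have "real (card W) \<le> 4 * n / 1000000000000" using W(3) \<open>real r \<le> n / 1000000000000\<close> by simp
      ultimately show ?thesis using W(1,2) B by (intro exI[of _ W]) auto
    next
      case 3
      define s where "s = q - card B"
      have s: "card B + s = q" using 3 by (simp add: s_def)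
      have sn: "real s \<le> n / 1000000000000" using s sB(2) rq by linarith
      define E2 where "E2 = {e\<in>E. card (e \<inter> A) = 2}"
      have "\<exists>W\<subseteq>V. matchable E2 W \<and> card W = 4 * s"
      proof (rule greedy_many[OF HD(1), where K = "4 * s"])
        show "e \<subseteq> V \<and> card e = 4" if "e \<in> E2" for e using that HD(3,4)[of e] by (simp add: E2_def)
        fix U assume U: "U \<subseteq> V" "card U \<le> 4 * s"
        have fU: "finite U" using U(1) HD(1) by (rule finite_subset)
        have cU: "real (card U) \<le> 4 * n / 1000000000000" using U(2) sn by linarith
        have "real (card B) - real (card (U \<union> Zb)) \<le> real (card (B - (U \<union> Zb)))"
          by (rule card_Diff_ge) (use fU Zb(2) in simp)
        moreover have "real (card (U \<union> Zb)) \<le> real (card U) + real (card Zb)" using card_Un_le[of U Zb] by linarith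
        ultimately have "0 < real (card (B - (U \<union> Zb)))" using cU Zb(3) sB(2) n0 by linarith
        then have "B - (U \<union> Zb) \<noteq> {}" by (metis card.empty less_irrefl of_nat_0)
        then obtain b where b: "b \<in> B" "b \<notin> U" "b \<notin> Zb" by blast
        have m1: "real (missing_degree V E B b) \<le> 3 * n^3 / 1000000000000" using b by (intro misst) simp
        have "real (card {(u,v,w) \<in> A \<times> A \<times> B. {b,u,v,w} \<notin> E}) < real (card (A - U)) * real (card (A - U)) * real (card (B - U))"
        proof -
          have "1/5 * n \<le> real (card (A - U))" using card_Diff_ge[OF fU, of A] cU rA sB(1) n0 by linarith
          moreover have "1/5 * n \<le> real (card (B - U))" using card_Diff_ge[OF fU, of B] cU sB(2) n0 by linarith
          ultimately have "(1/5 * n) * (1/5 * n) * (1/5 * n) \<le> real (card (A - U)) * real (card (A - U)) * real (card (B - U))"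
            using n0 by (intro prod3_ge) auto
          moreover have "(1/5 * n) * (1/5 * n) * (1/5 * n) = n^3 / 125" by (simp add: power3_eq_cube)
          ultimately show ?thesis using oB(2)[OF b(1)] m1 n2n3 n3 by linarith
        qed
        from exists_triple_avoiding[OF finT[OF AB(3) AB(3) B] this] obtain u v w where
          uvw: "u \<in> A - U" "v \<in> A - U" "w \<in> B - U" "(u,v,w) \<notin> {(u,v,w) \<in> A \<times> A \<times> B. {b,u,v,w} \<notin> E}"
          by (elim bexE)
        then have e: "{b,u,v,w} \<in> E" by blast
        have "{b,u,v,w} \<inter> A = {u,v}" using uvw b AB(1) by blast
        moreover have "u \<noteq> v" using HD(4)[OF e] by (auto simp: card_insert_if split: if_splits)
        ultimately have "card ({b,u,v,w} \<inter> A) = 2" by simp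
        then have "{b,u,v,w} \<in> E2" unfolding E2_def using e by (intro CollectI conjI)
        moreover have "{b,u,v,w} \<inter> U = {}" using uvw b by blast
        ultimately show "\<exists>e\<in>E2. e \<inter> U = {}" by blast
      qed simp
      then obtain W where W: "W \<subseteq> V" "matchable E2 W" "card W = 4 * s" by blast
      have fW: "finite W" using W(1) HD(1) by (rule finite_subset)
      have "4 * card (W \<inter> A) = 2 * card W"
        by (rule matchable_card_Int[OF W(2) fW]) (use HD(4) in \<open>auto simp: E2_def\<close>)
      then have cWA: "card (W \<inter> A) = 2 * s" using W(3) by simp
      have "card W = card (W \<inter> A) + card (W \<inter> B)"
      proof -
        have "W = (W \<inter> A) \<union> (W \<inter> B)" using W(1) AB(2) by blast
        moreover have "card ((W \<inter> A) \<union> (W \<inter> B)) = card (W \<inter> A) + card (W \<inter> B)"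
          using fW AB(1) by (intro card_Un_disjoint) auto
        ultimately show ?thesis by simp
      qed
      then have cWB: "card (W \<inter> B) = 2 * s" using cWA W(3) by simp
      have "card (A - W) = card A - 2 * s" "card (B - W) = card B - 2 * s"
        using cWA cWB fW fA fB by (simp_all add: card_Diff_subset_Int Int_commute)
      moreover have "2 * s \<le> card B" using cWB card_mono[OF fB, of "W \<inter> B"] by simp
      moreover have "2 * s \<le> card A" using cWA card_mono[OF fA, of "W \<inter> A"] by simp
      ultimately have "card (B - W) = 3 * card (A - W)" using cA k0 s cBV by (simp add: q_def)
      moreover have "real (card W) \<le> 4 * n / 1000000000000" using W(3) sn by simp
      moreover have "matchable E W" by (rule matchable_mono[OF W(2)]) (simp add: E2_def)
      ultimately show ?thesis using W(1) by (intro exI[of _ W]) auto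
    qed
  qed
  then obtain W0 where W0: "W0 \<subseteq> V" "matchable E W0" "card W0 \<le> 4 * n / 1000000000000" "card (B - W0) = 3 * card (A - W0)" by blast
  \<comment> \<open>ABBB edges keep the ratio 3:1, so the atypical vertices are covered by them. Up
    to \<open>13*n/10^6\<close> vertices are blocked. At a vertex of \<open>A\<close> they destroy
    fewer than the \<open>n^3/2000\<close> edges granted by \<open>a1\<close>; at a vertex of
    \<open>B\<close> the bad ordered triples number little more than \<open>6*n^3/400\<close>, while
    about a tenth of \<open>n^3\<close> avoid the blocked vertices.\<close>
  define E1 where "E1 = {e\<in>E. card (e \<inter> A) = 1}"
  define Z where "Z = Za \<union> Zb"
  have fZ: "finite Z" using Za Zb by (simp add: Z_def)
  have cZ: "real (card Z) \<le> 3 * n / 1000000" using card_Un_le[of Za Zb] cZa Zb(3) n0 unfolding Z_def by linarith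
  define K where "K = card W0 + 4 * card Z"
  have K: "real K \<le> 13 * n / 1000000" using W0(3) cZ n0 unfolding K_def by simp
  have "\<exists>W\<subseteq>V. matchable E1 W \<and> Z \<subseteq> W \<union> W0 \<and> W \<inter> W0 = {} \<and> card W \<le> 4 * card Z"
  proof (rule greedy_cover[OF fZ HD(1)])
    show "e \<subseteq> V \<and> card e = 4" if "e \<in> E1" for e using that HD(3,4)[of e] by (simp add: E1_def)
    show "W0 \<subseteq> V" by (rule W0(1))
    show "card W0 + 4 * card Z \<le> K" by (simp add: K_def)
    fix z U assume z: "z \<in> Z" "z \<notin> U" and U: "U \<subseteq> V" "card U \<le> K"
    have fU: "finite U" using U(1) HD(1) by (rule finite_subset)
    have cU: "real (card U) \<le> 13 * n / 1000000" using U(2) K by linarith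
    show "\<exists>e\<in>E1. z \<in> e \<and> e \<inter> U = {}"
    proof (cases "z \<in> A")
      case True
      let ?I = "{T \<in> link E z. T \<subseteq> B}" and ?Q = "{T. T \<subseteq> V \<and> card T = 3 \<and> T \<inter> U \<noteq> {}}"
      have "real (card ?Q) \<le> real (card U * (card V)\<^sup>2)"
        by (rule of_nat_mono[OF card_3_subsets_meeting[OF HD(1) U(1)]])
      also have "\<dots> = real (card U) * n\<^sup>2" by (simp add: n)
      also have "\<dots> \<le> 13 * n / 1000000 * n\<^sup>2" using cU by (intro mult_right_mono) auto
      also have "\<dots> = 13 * n^3 / 1000000" by (simp add: power2_eq_square power3_eq_cube)
      also have "\<dots> < n^3 / 2000" using n3 by simp
      also have "\<dots> \<le> real (card ?I)" using a1[OF True] by (simp add: inner_degree_def)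
      finally have lt: "real (card ?Q) < real (card ?I)" .
      have "\<not> ?I \<subseteq> ?Q"
      proof
        assume "?I \<subseteq> ?Q"
        moreover have "finite ?Q" by (rule finite_subset[of _ "Pow V"]) (use HD(1) in auto)
        ultimately have "card ?I \<le> card ?Q" by (intro card_mono)
        then show False using lt by linarith
      qed
      then obtain T where T: "T \<in> link E z" "T \<subseteq> B" "T \<notin> ?Q" by blast
      have "T \<in> {T. T \<subseteq> V \<and> card T = 3}" using link_subset[OF H] T(1) by (rule subsetD)
      then have TU: "T \<inter> U = {}" using T(3) by blast
      have "insert z T \<in> E" using T(1) by (simp add: link_def)
      moreover have "insert z T \<inter> A = {z}" using True T(2) AB(1) by blast
      ultimately have "insert z T \<in> E1" by (simp add: E1_def)
      moreover have "insert z T \<inter> U = {}" using TU z(2) by blast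
      ultimately show ?thesis by blast
    next
      case False
      then have zB: "z \<in> B" using z(1) Za(1) Zb(1) by (auto simp: Z_def)
      have "real (card {(u,v,w) \<in> A \<times> B \<times> B. {z,u,v,w} \<notin> E}) < real (card (A - U)) * real (card (B - U)) * real (card (B - U))"
      proof -
        have "1/5 * n \<le> real (card (A - U))" using card_Diff_ge[OF fU, of A] cU rA sB(1) n0 by linarith
        moreover have "7/10 * n \<le> real (card (B - U))" using card_Diff_ge[OF fU, of B] cU sB(2) n0 by linarith
        ultimately have "(1/5 * n) * (7/10 * n) * (7/10 * n) \<le> real (card (A - U)) * real (card (B - U)) * real (card (B - U))"
          using n0 by (intro prod3_ge) auto
        moreover have "(1/5 * n) * (7/10 * n) * (7/10 * n) = 98 / 1000 * n^3" by (simp add: power3_eq_cube)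
        ultimately show ?thesis using oB(1)[OF zB] missB[OF zB] n2n3 n3 by linarith
      qed
      from exists_triple_avoiding[OF finT[OF AB(3) B B] this] obtain u v w where
        uvw: "u \<in> A - U" "v \<in> B - U" "w \<in> B - U" "(u,v,w) \<notin> {(u,v,w) \<in> A \<times> B \<times> B. {z,u,v,w} \<notin> E}"
        by (elim bexE)
      then have e: "{z,u,v,w} \<in> E" by blast
      have "{z,u,v,w} \<inter> A = {u}" using uvw zB AB(1) by blast
      then have "card ({z,u,v,w} \<inter> A) = 1" by simp
      then have "{z,u,v,w} \<in> E1" unfolding E1_def using e by (intro CollectI conjI)
      moreover have "{z,u,v,w} \<inter> U = {}" using uvw z(2) by blast
      ultimately show ?thesis by blast
    qed
  qed
  then obtain W where W: "W \<subseteq> V" "matchable E1 W" "Z \<subseteq> W \<union> W0" "W \<inter> W0 = {}" "card W \<le> 4 * card Z" by blast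
  have fW: "finite W" "finite W0" using W(1) W0(1) HD(1) finite_subset by blast+
  define A2 B2 where "A2 = A - (W0 \<union> W)" and "B2 = B - (W0 \<union> W)"
  have "4 * card (W \<inter> A) = 1 * card W"
    by (rule matchable_card_Int[OF W(2) fW(1)]) (use HD(4) in \<open>auto simp: E1_def\<close>)
  then have cW: "card W = 4 * card (W \<inter> A)" by simp
  have "card W = card (W \<inter> A) + card (W \<inter> B)"
  proof -
    have "W = (W \<inter> A) \<union> (W \<inter> B)" using W(1) AB(2) by blast
    moreover have "card ((W \<inter> A) \<union> (W \<inter> B)) = card (W \<inter> A) + card (W \<inter> B)"
      using fW AB(1) by (intro card_Un_disjoint) auto
    ultimately show ?thesis by simp
  qed
  then have cWB: "card (W \<inter> B) = 3 * card (W \<inter> A)" using cW by simp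
  have split: "card (X - W0) = card (X - (W0 \<union> W)) + card (W \<inter> X)" if "finite X" for X
  proof -
    have "X - W0 = (X - (W0 \<union> W)) \<union> (W \<inter> X)" using W(4) by blast
    moreover have "card ((X - (W0 \<union> W)) \<union> (W \<inter> X)) = card (X - (W0 \<union> W)) + card (W \<inter> X)"
      using that fW by (intro card_Un_disjoint) auto
    ultimately show ?thesis by simp
  qed
  have cB2: "card B2 = 3 * card A2" using split[OF fA] split[OF fB] W0(4) cWB unfolding A2_def B2_def by linarith
  have "real (card A) - real (card (W0 \<union> W)) \<le> real (card A2)" unfolding A2_def by (rule card_Diff_ge) (use fW in simp)
  moreover have "real (card (W0 \<union> W)) \<le> real K" using card_Un_le[of W0 W] W(5) unfolding K_def by linarith
  ultimately have cA2: "1/5 * n \<le> real (card A2)" using K rA sB(1) n0 by linarith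
  have "(1/5 * n)^3 \<le> real (card A2)^3" using cA2 n0 by (intro power_mono) auto
  then have N3: "n^3 / 12500 \<le> real (card A2)^3 / 100" by (simp add: power_mult_distrib power_divide)
  have "matchable E (A2 \<union> B2)"
  proof (rule abbb_matching)
    show "finite A2" "finite B2" using fA fB by (simp_all add: A2_def B2_def)
    show "A2 \<inter> B2 = {}" using AB(1) unfolding A2_def B2_def by blast
    show "card B2 = 3 * card A2" by (rule cB2)
    show "card e = 4" if "e \<in> E" for e using HD(4)[OF that] .
    show "real (card {(u,v,w) \<in> B2 \<times> B2 \<times> B2. {a,u,v,w} \<notin> E}) \<le> real (card A2)^3 / 100" if a: "a \<in> A2" for a
    proof -
      have aA: "a \<in> A" "a \<notin> Za" using a W(3) by (auto simp: A2_def Z_def)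
      have "card {(u,v,w) \<in> B2 \<times> B2 \<times> B2. {a,u,v,w} \<notin> E} \<le> card {(u,v,w) \<in> B \<times> B \<times> B. {a,u,v,w} \<notin> E}"
        by (rule card_mono[OF finT[OF B B B]]) (auto simp: B2_def)
      moreover have "real (nonlink_degree E B a) \<le> 2 * n^3 / 1000000" using aA by (simp add: Za_def)
      ultimately show ?thesis using oA[OF aA(1)] n2n3 n3 N3 by linarith
    qed
    show "real (card {(u,v,w) \<in> A2 \<times> B2 \<times> B2. {b,u,v,w} \<notin> E}) \<le> real (card A2)^3 / 100" if b: "b \<in> B2" for b
    proof -
      have bB: "b \<in> B" "b \<notin> Zb" using b W(3) by (auto simp: B2_def Z_def)
      have "card {(u,v,w) \<in> A2 \<times> B2 \<times> B2. {b,u,v,w} \<notin> E} \<le> card {(u,v,w) \<in> A \<times> B \<times> B. {b,u,v,w} \<notin> E}"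
        by (rule card_mono[OF finT[OF AB(3) B B]]) (auto simp: A2_def B2_def)
      moreover have "real (missing_degree V E B b) \<le> 3 * n^3 / 1000000000000" using bB by (intro misst) simp
      ultimately show ?thesis using oB(1)[OF bB(1)] n2n3 n3 N3 by linarith
    qed
  qed
  moreover have "matchable E (W0 \<union> W)"
    using matchable_Un[OF W0(2) matchable_mono[OF W(2)]] W(4) by (auto simp: E1_def)
  moreover have "(W0 \<union> W) \<inter> (A2 \<union> B2) = {}" unfolding A2_def B2_def by blast
  ultimately have "matchable E ((W0 \<union> W) \<union> (A2 \<union> B2))" by (intro matchable_Un[of E "W0 \<union> W"])
  moreover have "(W0 \<union> W) \<union> (A2 \<union> B2) = V" using AB(2) W(1) W0(1) unfolding A2_def B2_def by blast
  ultimately show ?thesis by simp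
qed

lemma choose_2_real: "real (m choose 2) = real m * (real m - 1) / 2"
  by (induction m) (auto simp: eval_nat_numeral field_simps)

lemma choose_3_real: "real (m choose 3) = real m * (real m - 1) * (real m - 2) / 6"
proof (induction m)
  case (Suc m)
  have "real (Suc m choose 3) = real (m choose 3) + real (m choose 2)" by (simp add: eval_nat_numeral)
  also have "\<dots> = real m * (real m - 1) * (real m - 2) / 6 + real m * (real m - 1) / 2"
    by (simp only: Suc.IH choose_2_real)
  also have "\<dots> = real (Suc m) * (real (Suc m) - 1) * (real (Suc m) - 2) / 6" by (simp add: field_simps)
  finally show ?case .
qed simp

lemma sum_inner:
  assumes H: "uniform_hypergraph 4 V E" and B: "B \<subseteq> V"
  shows "(\<Sum>v\<in>B. inner_degree E B v) = 4 * card {e\<in>E. e \<subseteq> B}"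
proof -
  note HD = uniform_hypergraphD[OF H]
  have fB: "finite B" using B HD(1) by (rule finite_subset)
  define EB where "EB = {e\<in>E. e \<subseteq> B}"
  have HB: "uniform_hypergraph 4 B EB" using fB HD(4) by (auto simp: EB_def uniform_hypergraph_def)
  have deg: "inner_degree E B v = card {e\<in>EB. v \<in> e}" if v: "v \<in> B" for v
  proof -
    have "link EB v = {T \<in> link E v. T \<subseteq> B}" using v by (auto simp: link_def EB_def)
    then show ?thesis unfolding inner_degree_def using card_link[of EB v] by (simp add: vertex_degree_def)
  qed
  have "(\<Sum>v\<in>B. inner_degree E B v) = (\<Sum>v\<in>B. card {e\<in>EB. v \<in> e})" by (intro sum.cong refl deg)
  also have "\<dots> = 4 * card EB" by (rule sum_degrees[OF HB order.refl])
  finally show ?thesis by (simp add: EB_def)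
qed

lemma inner_change:
  assumes H: "uniform_hypergraph 4 V E" and B: "B \<subseteq> V" "B' \<subseteq> V"
  shows "real (inner_degree E B v) \<le> inner_degree E B' v + real (card (B - B')) * (real (card V))\<^sup>2"
proof -
  note HD = uniform_hypergraphD[OF H]
  let ?Q = "{T. T \<subseteq> V \<and> card T = 3 \<and> T \<inter> (B - B') \<noteq> {}}"
  have fl: "finite (link E v)" by (rule finite_subset[OF link_subset[OF H]]) (use HD(1) in simp)
  have "{T \<in> link E v. T \<subseteq> B} \<subseteq> {T \<in> link E v. T \<subseteq> B'} \<union> ?Q" using link_subset[OF H, of v] by blast
  moreover have "finite ({T \<in> link E v. T \<subseteq> B'} \<union> ?Q)" using fl HD(1) by simp
  ultimately have "inner_degree E B v \<le> card ({T \<in> link E v. T \<subseteq> B'} \<union> ?Q)" unfolding inner_degree_def by (intro card_mono)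
  also have "\<dots> \<le> inner_degree E B' v + card ?Q" unfolding inner_degree_def by (rule card_Un_le)
  also have "card ?Q \<le> card (B - B') * (card V)\<^sup>2"
    by (rule card_3_subsets_meeting[OF HD(1)]) (use B in blast)
  finally have "inner_degree E B v \<le> inner_degree E B' v + card (B - B') * (card V)\<^sup>2" by simp
  then have "real (inner_degree E B v) \<le> real (inner_degree E B' v + card (B - B') * (card V)\<^sup>2)" by (rule of_nat_mono)
  then show ?thesis by (simp only: of_nat_add of_nat_mult of_nat_power)
qed

text \<open>The given \<open>B0\<close> is good only on average. It is replaced by the set
  \<open>B\<close> of all vertices with fewer than \<open>n^3/1000\<close> link triples inside
  \<open>B0\<close>. Then every single vertex suits its side, as \<open>extremal_partition\<close>
  demands, and the two sets differ by so few vertices that inner degrees hardly change.\<close>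

lemma extremal_case:
  fixes n :: real
  assumes H: "uniform_hypergraph 4 V E" and n: "n = real (card V)" and big: "1000000000000000000 \<le> n" and dvd: "4 dvd card V"
    and deg: "\<And>v. v \<in> V \<Longrightarrow> (card V - 1 choose 3) + 1 \<le> vertex_degree E v + (3 * card V div 4 choose 3)"
    and B0: "B0 \<subseteq> V" "(3/4 - 1/1000000000000000000000000000000000) * n \<le> card B0" "card {e\<in>E. e \<subseteq> B0} \<le> 1/1000000000000000000000000000000000 * n^4"
  shows "matchable E V"
proof -
  note HD = uniform_hypergraphD[OF H]
  have fB0: "finite B0" using B0(1) HD(1) by (rule finite_subset)
  have n0: "0 < n" using big by simp
  have n3: "0 < n^3" using n0 by simp
  obtain k0 where k0: "card V = 4 * k0" using dvd by blast
  define q where "q = 3 * k0"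
  have q: "3 * card V div 4 = q" by (simp add: k0 q_def)
  have rq: "real q = 3/4 * n" by (simp add: q_def n k0)
  have key: "missing_degree V E C v + (card (C - {v}) choose 3) + 1 \<le> inner_degree E C v + (q choose 3)" if "C \<subseteq> V" "v \<in> V" for C v
    using missing_eq[OF H that(2,1)] deg[OF that(2), unfolded q] by linarith
  have nn: "n * n^3 = n^4" "n * n\<^sup>2 = n^3" by (simp_all add: eval_nat_numeral)
  \<comment> \<open>Again a square-root threshold: inner degrees over \<open>B0\<close> add up to at
    most \<open>4*n^4/10^33\<close>, which is below the square of 1/10^16 times \<open>n^4\<close>.
    This is where 10^33 comes from.\<close>
  define Exc where "Exc = {v\<in>B0. n^3 / 10000000000000000 < inner_degree E B0 v}"
  have Exc: "Exc \<subseteq> B0" "finite Exc" using fB0 by (auto simp: Exc_def)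
  have cExc: "card Exc \<le> n / 10000000000000000"
  proof -
    have "card Exc * (n^3 / 10000000000000000) = (\<Sum>v\<in>Exc. n^3 / 10000000000000000)" by simp
    also have "\<dots> \<le> (\<Sum>v\<in>Exc. real (inner_degree E B0 v))" by (intro sum_mono) (simp add: Exc_def)
    also have "\<dots> \<le> (\<Sum>v\<in>B0. real (inner_degree E B0 v))" by (intro sum_mono2 fB0 Exc) simp
    also have "\<dots> = real (\<Sum>v\<in>B0. inner_degree E B0 v)" by simp
    also have "\<dots> = 4 * card {e\<in>E. e \<subseteq> B0}" unfolding sum_inner[OF H B0(1)] by simp
    also have "\<dots> \<le> 4 * (1/1000000000000000000000000000000000 * n^4)" using B0(3) by simp
    also have "\<dots> \<le> (n / 10000000000000000) * (n^3 / 10000000000000000)" unfolding nn(1)[symmetric] using n0 n3 by simp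
    finally show ?thesis by (rule mult_right_le_imp_le) (use n3 in simp)
  qed
  have miss: "real (missing_degree V E B0 b) \<le> inner_degree E B0 b + 2 * n^3 / 10000000000000000" if b: "b \<in> B0" for b
  proof -
    have bV: "b \<in> V" using b B0(1) by blast
    have "card (B0 - {b}) = card B0 - 1" using b fB0 by simp
    then have k: "missing_degree V E B0 b + (card B0 - 1 choose 3) \<le> inner_degree E B0 b + (q choose 3)"
      using key[OF B0(1) bV] by simp
    show ?thesis
    proof (cases "q \<le> card B0 - 1")
      case True
      then obtain d where d: "card B0 - 1 = q + d" using le_Suc_ex by blast
      have "q choose 3 \<le> (card B0 - 1 choose 3)" unfolding d using choose_3_lower[of q d] by linarith
      then have "real (missing_degree V E B0 b) \<le> inner_degree E B0 b" using k by linarith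
      moreover have "0 \<le> 2 * n^3 / 10000000000000000" using n3 by simp
      ultimately show ?thesis by linarith
    next
      case False
      then have "q choose 3 \<le> (card B0 - 1 choose 3) + (q - (card B0 - 1)) * q\<^sup>2" by (intro choose_3_upper) simp
      then have "missing_degree V E B0 b \<le> inner_degree E B0 b + (q - (card B0 - 1)) * q\<^sup>2" using k by linarith
      then have "real (missing_degree V E B0 b) \<le> real (inner_degree E B0 b + (q - (card B0 - 1)) * q\<^sup>2)" by (rule of_nat_mono)
      also have "\<dots> = inner_degree E B0 b + real (q - (card B0 - 1)) * (real q)\<^sup>2" by simp
      also have "\<dots> \<le> inner_degree E B0 b + (2 * n / 10000000000000000) * n\<^sup>2"
      proof -
        define cc dd where "cc = real (card B0 - 1)" and "dd = real (q - (card B0 - 1))"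
        have "dd = real q - cc" unfolding cc_def dd_def using False by (intro of_nat_diff) simp
        moreover have "real (card B0) - 1 \<le> cc" unfolding cc_def by linarith
        moreover have "1 \<le> n / 10000000000000000" using big by simp
        moreover have "3/4 * n - n / 1000000000000000000000000000000000 \<le> real (card B0)" using B0(2) by (simp add: left_diff_distrib)
        moreover have "n / 1000000000000000000000000000000000 \<le> n / 10000000000000000" using n0 by simp
        ultimately have "dd \<le> n / 10000000000000000 + n / 10000000000000000" unfolding rq by linarith
        then have "real (q - (card B0 - 1)) \<le> 2 * n / 10000000000000000" unfolding dd_def by simp
        moreover have "(real q)\<^sup>2 \<le> n\<^sup>2" using rq n0 by (intro power_mono) auto
        moreover have "0 \<le> 2 * n / 10000000000000000" using n0 by simp
        ultimately have "real (q - (card B0 - 1)) * (real q)\<^sup>2 \<le> (2 * n / 10000000000000000) * n\<^sup>2" by (intro mult_mono) auto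
        then show ?thesis by simp
      qed
      also have "(2 * n / 10000000000000000) * n\<^sup>2 = 2 * n^3 / 10000000000000000" by (simp add: power2_eq_square power3_eq_cube)
      finally show ?thesis .
    qed
  qed
  have misst: "real (missing_degree V E B0 b) \<le> 3 * n^3 / 10000000000000000" if "b \<in> B0 - Exc" for b
    using miss[of b] that by (auto simp: Exc_def)
  have missall: "real (missing_degree V E B0 b) \<le> n^3" for b
  proof -
    have "missing_degree V E B0 b \<le> card {T. T \<subseteq> V \<and> card T = 3}"
      unfolding missing_degree_def using HD(1) by (intro card_mono) auto
    then show ?thesis using card_3_subsets_le[OF HD(1)] n3 unfolding n by linarith
  qed
  have sumMiss: "real (\<Sum>b\<in>B0. missing_degree V E B0 b) \<le> 4 * n^4 / 10000000000000000"
  proof -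
    have "real (\<Sum>b\<in>B0. missing_degree V E B0 b) = (\<Sum>b\<in>B0 - Exc. real (missing_degree V E B0 b)) + (\<Sum>b\<in>Exc. real (missing_degree V E B0 b))"
      using sum.subset_diff[OF Exc(1) fB0, of "\<lambda>b. real (missing_degree V E B0 b)"] by simp
    also have "\<dots> \<le> real (card (B0 - Exc)) * (3 * n^3 / 10000000000000000) + real (card Exc) * n^3"
      using misst missall by (intro add_mono sum_bounded_above)
    also have "\<dots> \<le> n * (3 * n^3 / 10000000000000000) + n / 10000000000000000 * n^3"
    proof (intro add_mono mult_right_mono cExc)
      have "card (B0 - Exc) \<le> card V" using HD(1) B0(1) by (intro card_mono) auto
      then show "real (card (B0 - Exc)) \<le> n" by (simp add: n)
    qed (use n3 in auto)
    also have "\<dots> = 4 * n^4 / 10000000000000000" unfolding nn(1)[symmetric] by simp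
    finally show ?thesis .
  qed
  define B where "B = {v\<in>V. inner_degree E B0 v < n^3 / 1000}"
  have BV: "B \<subseteq> V" by (auto simp: B_def)
  have fB: "finite B" using BV HD(1) by (rule finite_subset)
  have lowB0: "74/100 * n \<le> real (card B0)" using B0(2) n0 by (simp add: algebra_simps)
  \<comment> \<open>A vertex of \<open>B\<close> outside \<open>B0\<close> has hardly any link
    triples in \<open>B0\<close>, hence at least \<open>n^3/20\<close> non-edges there. By
    \<open>sum_nonlink_le_sum_missing\<close> all such non-edges together are bounded by
    \<open>sumMiss\<close>.\<close>
  have cX: "card (B - B0) \<le> 100 * n / 10000000000000000"
  proof -
    have nl: "n^3 / 20 \<le> nonlink_degree E B0 a" if a: "a \<in> B - B0" for a
    proof -
      have "(73/100 * n) * (73/100 * n) * (73/100 * n) / 6 \<le> real (card B0) * (real (card B0) - 1) * (real (card B0) - 2) / 6"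
        using lowB0 big by (intro divide_right_mono prod3_ge) auto
      also have "\<dots> = real (card B0 choose 3)" by (rule choose_3_real[symmetric])
      also have "\<dots> = real (nonlink_degree E B0 a) + real (inner_degree E B0 a)"
        using nonlink_eq[OF H fB0, of a] a by (metis DiffD2 of_nat_add)
      finally have "(73/100 * n) * (73/100 * n) * (73/100 * n) / 6 \<le> real (nonlink_degree E B0 a) + real (inner_degree E B0 a)" .
      moreover have "(73/100 * n) * (73/100 * n) * (73/100 * n) / 6 = 389017 / 6000000 * n^3" by (simp add: power3_eq_cube)
      moreover have "real (inner_degree E B0 a) < n^3 / 1000" using a by (simp add: B_def)
      ultimately show ?thesis using n3 by linarith
    qed
    have "card (B - B0) * (n^3 / 20) = (\<Sum>a\<in>B - B0. n^3 / 20)" by simp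
    also have "\<dots> \<le> (\<Sum>a\<in>B - B0. real (nonlink_degree E B0 a))" by (intro sum_mono nl)
    also have "\<dots> = real (\<Sum>a\<in>B - B0. nonlink_degree E B0 a)" by simp
    also have "\<dots> \<le> real (\<Sum>b\<in>B0. missing_degree V E B0 b)"
      by (intro of_nat_mono sum_nonlink_le_sum_missing HD(1) B0(1)) (use BV in blast)
    also have "\<dots> \<le> 4 * n^4 / 10000000000000000" by (rule sumMiss)
    also have "\<dots> \<le> (100 * n / 10000000000000000) * (n^3 / 20)" unfolding nn(1)[symmetric] using n0 n3 by simp
    finally show ?thesis by (rule mult_right_le_imp_le) (use n3 in simp)
  qed
  have B0B: "B0 - B \<subseteq> Exc"
  proof
    fix v assume v: "v \<in> B0 - B"
    then have "n^3 / 1000 \<le> inner_degree E B0 v" using B0(1) by (auto simp: B_def)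
    then have "n^3 / 10000000000000000 < inner_degree E B0 v" using n3 by linarith
    moreover have "v \<in> B0" using v by blast
    ultimately show "v \<in> Exc" unfolding Exc_def by (intro CollectI conjI)
  qed
  then have "card (B0 - B) \<le> card Exc" using Exc(2) by (intro card_mono)
  then have cY: "card (B0 - B) \<le> n / 10000000000000000" using cExc by linarith
  have up: "real (inner_degree E B v) \<le> inner_degree E B0 v + 100 * n^3 / 10000000000000000" for v
  proof -
    have "real (card (B - B0)) * n\<^sup>2 \<le> 100 * n / 10000000000000000 * n\<^sup>2" using cX by (intro mult_right_mono) auto
    then show ?thesis using inner_change[OF H BV B0(1), of v] unfolding n[symmetric] by (simp add: power2_eq_square power3_eq_cube)
  qed
  have down: "real (inner_degree E B0 v) \<le> inner_degree E B v + n^3 / 10000000000000000" for v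
  proof -
    have "real (card (B0 - B)) * n\<^sup>2 \<le> n / 10000000000000000 * n\<^sup>2" using cY by (intro mult_right_mono) auto
    then show ?thesis using inner_change[OF H B0(1) BV, of v] unfolding n[symmetric] by (simp add: power2_eq_square power3_eq_cube)
  qed
  define Z where "Z = (B - B0) \<union> Exc"
  have fZ: "finite Z" using fB Exc(2) by (simp add: Z_def)
  have cZ: "real (card Z) \<le> 101 * n / 10000000000000000" using card_Un_le[of "B - B0" Exc] cX cExc unfolding Z_def by linarith
  have typical: "real (inner_degree E B v) \<le> 101 * n^3 / 10000000000000000" if "v \<in> B - Z" for v
  proof -
    have "real (inner_degree E B0 v) \<le> n^3 / 10000000000000000" using that by (auto simp: Z_def Exc_def)
    then show ?thesis using up[of v] by linarith
  qed
  have lower: "3/4 * n - n / 1000000000000 \<le> real (card B)"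
  proof -
    have "B0 \<subseteq> B \<union> (B0 - B)" by blast
    then have "card B0 \<le> card (B \<union> (B0 - B))" using fB fB0 by (intro card_mono) auto
    also have "\<dots> \<le> card B + card (B0 - B)" by (rule card_Un_le)
    finally have "real (card B0) \<le> real (card B) + real (card (B0 - B))" by linarith
    moreover have "(3/4 - 1/1000000000000000000000000000000000) * n = 3/4 * n - n / 1000000000000000000000000000000000" by (simp add: algebra_simps)
    ultimately show ?thesis using B0(2) cY n0 by linarith
  qed
  \<comment> \<open>The upper bound on \<open>card B\<close> comes from the degree condition at one
    typical vertex: if \<open>card B - 1 = q + d\<close>, that vertex lies in at least
    \<open>d * (q choose 2)\<close> edges inside \<open>B\<close>, but a typical vertex lies in very
    few.\<close>
  have upper: "real (card B) \<le> 3/4 * n + n / 1000000000000"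
  proof -
    have "0 < real (card (B - Z))" using card_Diff_ge[OF fZ, of B] cZ lower n0 by linarith
    then have "B - Z \<noteq> {}" by (metis card.empty less_irrefl of_nat_0)
    then obtain v where v: "v \<in> B - Z" by blast
    have "v \<in> V" using v BV by blast
    moreover have "card (B - {v}) = card B - 1" using v fB by simp
    ultimately have k: "(card B - 1 choose 3) \<le> inner_degree E B v + (q choose 3)" using key[OF BV, of v] by simp
    show ?thesis
    proof (cases "card B \<le> q + 1")
      case True
      moreover have "1 \<le> n / 1000000000000" using big by simp
      ultimately show ?thesis using rq by linarith
    next
      case False
      then have "q \<le> card B - 1" by linarith
      then obtain d where d: "card B - 1 = q + d" using le_Suc_ex by blast
      have "d * (q choose 2) \<le> inner_degree E B v" using k choose_3_lower[of q d] unfolding d by linarith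
      then have "real (d * (q choose 2)) \<le> real (inner_degree E B v)" by (rule of_nat_mono)
      also have "\<dots> \<le> 101 * n^3 / 10000000000000000" by (rule typical[OF v])
      finally have A: "real d * real (q choose 2) \<le> 101 * n^3 / 10000000000000000" by simp
      have "(7/10 * n) * (7/10 * n) / 2 \<le> real (q choose 2)"
        unfolding choose_2_real rq using big by (intro divide_right_mono mult_mono) auto
      then have "real d * ((7/10 * n) * (7/10 * n) / 2) \<le> real d * real (q choose 2)" by (intro mult_left_mono) auto
      then have "real d * ((7/10 * n) * (7/10 * n) / 2) \<le> 101 * n^3 / 10000000000000000" using A by linarith
      then have "real d * (49/200 * n\<^sup>2) \<le> (101 * n / 10000000000000000) * n\<^sup>2" by (simp add: power2_eq_square power3_eq_cube)
      moreover have "0 < n\<^sup>2" using n0 by simp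
      ultimately have "real d * (49/200) \<le> 101 * n / 10000000000000000" by (simp add: mult.assoc[symmetric])
      moreover have "real (card B) = real q + real d + 1" using d False by linarith
      moreover have "1 \<le> n / 10000000000000" using big by simp
      ultimately show ?thesis using rq n0 by linarith
    qed
  qed
  show ?thesis
  proof (rule extremal_partition[OF H n _ dvd BV refl])
    show "1000000000000000 \<le> n" using big by simp
    show "\<bar>real (card B) - 3/4 * n\<bar> \<le> n / 1000000000000" using lower upper by linarith
    show "real (inner_degree E B v) \<le> n^3 / 500" if "v \<in> B" for v
    proof -
      have "real (inner_degree E B0 v) < n^3 / 1000" using that by (simp add: B_def)
      then show ?thesis using up[of v] n3 by linarith
    qed
    show "n^3 / 2000 \<le> real (inner_degree E B a)" if "a \<in> V - B" for a
    proof -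
      have "n^3 / 1000 \<le> real (inner_degree E B0 a)" using that by (auto simp: B_def)
      then show ?thesis using down[of a] n3 by linarith
    qed
    show "real (card {v\<in>B. n^3 / 1000000000000 < inner_degree E B v}) \<le> n / 1000000000000"
    proof -
      have "{v\<in>B. n^3 / 1000000000000 < inner_degree E B v} \<subseteq> Z"
      proof
        fix v assume v: "v \<in> {v\<in>B. n^3 / 1000000000000 < inner_degree E B v}"
        show "v \<in> Z"
        proof (rule ccontr)
          assume "v \<notin> Z"
          then have "real (inner_degree E B v) \<le> 101 * n^3 / 10000000000000000" using v by (intro typical) simp
          moreover have "n^3 / 1000000000000 < inner_degree E B v" using v by simp
          ultimately show False using n3 by linarith
        qed
      qed
      then have "card {v\<in>B. n^3 / 1000000000000 < inner_degree E B v} \<le> card Z" using fZ by (intro card_mono)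
      then show ?thesis using cZ n0 by linarith
    qed
    show "missing_degree V E B v + (card (B - {v}) choose 3) + 1 \<le> inner_degree E B v + (3 * card V div 4 choose 3)" if "v \<in> V" for v
      unfolding q by (rule key[OF BV that])
  qed
qed

section \<open>Assembling absorption, almost perfect matchings and the extremal case\<close>

lemma matchable_dvd_card:
  assumes "matchable E W" "finite W" "\<And>e. e \<in> E \<Longrightarrow> card e = k"
  shows "k dvd card W"
proof -
  obtain M where M: "M \<subseteq> E" "pairwise disjnt M" "\<Union>M = W"
    using assms(1) by (auto simp: matchable_def perfect_matching_def)
  have fe: "finite e" if "e \<in> M" for e using that M(3) assms(2) by (meson Sup_upper finite_subset)
  have "card (\<Union>M) = (\<Sum>e\<in>M. card e)"
    using M(2) fe by (intro card_Union_disjoint) (auto simp: pairwise_def disjnt_def disjoint_def)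
  also have "\<dots> = (\<Sum>e\<in>M. k)" using assms(3) M(1) by (intro sum.cong) auto
  finally show ?thesis using M(3) by simp
qed

text \<open>The asymptotic form of the degree condition: 37/64 = 1 - (3/4)^3, and \<open>n^2\<close>
  absorbs the lower-order terms of the binomials.\<close>

lemma vertex_degree_lower:
  assumes "(card V - 1 choose 3) + 1 \<le> d + (3 * card V div 4 choose 3)" "4 dvd card V" "n = real (card V)" "4 \<le> n"
  shows "37/64 * n^3 / 6 - n\<^sup>2 \<le> real d"
proof -
  obtain k where k: "card V = 4 * k" using assms(2) by blast
  have "3 * card V div 4 = 3 * k" by (simp add: k)
  moreover have rk: "real (3 * k) = 3/4 * n" using assms(3) by (simp add: k)
  ultimately have B: "real (3 * card V div 4 choose 3) = (3/4 * n) * (3/4 * n - 1) * (3/4 * n - 2) / 6"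
    by (simp only: choose_3_real)
  have r1: "real (card V - 1) = n - 1" using assms(3,4) by linarith
  have "real (card V - 1 choose 3) = (n - 1) * (n - 2) * (n - 3) / 6" unfolding choose_3_real r1 by simp
  moreover have "real (card V - 1 choose 3) + 1 \<le> real d + real (3 * card V div 4 choose 3)"
    using of_nat_mono[OF assms(1), where 'a = real] by (simp only: of_nat_add of_nat_1)
  ultimately have "(n - 1) * (n - 2) * (n - 3) / 6 \<le> real d + (3/4 * n) * (3/4 * n - 1) * (3/4 * n - 2) / 6"
    using B by linarith
  moreover have "(n - 1) * (n - 2) * (n - 3) / 6 = n^3/6 - n\<^sup>2 + 11/6 * n - 1"
    by (simp add: power2_eq_square power3_eq_cube field_simps)
  moreover have "(3/4 * n) * (3/4 * n - 1) * (3/4 * n - 2) / 6 = 27/64 * n^3 / 6 - 27/16 * n\<^sup>2 / 6 + 3/2 * n / 6"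
    by (simp add: power2_eq_square power3_eq_cube field_simps)
  moreover have "0 \<le> n\<^sup>2" by simp
  ultimately show ?thesis using assms(4) by linarith
qed

text \<open>The absorbing set \<open>W\<close> is removed before the dichotomy is applied. Its size
  \<open>\<beta>*n\<close> must harm neither the degrees in the rest, hence
  \<open>\<beta> \<le> \<gamma>/12\<close>, nor an extremal set found there, hence
  \<open>\<beta> \<le> \<eta>/2\<close> and the use of \<open>\<eta>/2\<close> in the dichotomy. The
  tolerance of the almost perfect matching is the capacity \<open>\<beta>'\<close> of
  \<open>W\<close>.\<close>

theorem theorem1:
  shows "\<exists>n\<^sub>0::nat. \<forall>n\<ge>n\<^sub>0. \<forall>(V :: 'a set) (E :: 'a set set).
    uniform_hypergraph 4 V E \<longrightarrow> card V = n \<longrightarrow> 4 dvd n \<longrightarrow>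
    int (min_vertex_degree V E) \<ge> int ((n - 1) choose 3) - int ((3 * n div 4) choose 3) + 1 \<longrightarrow>
    (\<exists>M. perfect_matching V E M)"
proof -
  define \<eta> :: real where "\<eta> = 1/1000000000000000000000000000000000"
  have \<eta>: "0 < \<eta>" "0 < \<eta>/2" by (simp_all add: \<eta>_def)
  from almost_perfect_or_extremal[OF \<eta>(2), where 'a = 'a] obtain \<gamma>0 where \<gamma>0: "0 < \<gamma>0" and
    ap: "\<forall>\<zeta>. 0 < \<zeta> \<and> \<zeta> \<le> 1 \<longrightarrow> (\<exists>n\<^sub>0::nat. \<forall>(V :: 'a set) E. uniform_hypergraph 4 V E \<longrightarrow> n\<^sub>0 \<le> card V \<longrightarrow>
    (\<forall>v\<in>V. (37/64 - \<gamma>0) * real (card V)^3 / 6 \<le> vertex_degree E v) \<longrightarrow>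
    (\<exists>B\<subseteq>V. (3/4 - \<eta>/2) * card V \<le> card B \<and> card {e\<in>E. e \<subseteq> B} \<le> \<eta>/2 * real (card V)^4) \<or>
    (\<exists>M\<subseteq>E. pairwise disjnt M \<and> card (V - \<Union>M) \<le> \<zeta> * real (card V)))"
    by (elim exE conjE)
  \<comment> \<open>The cap 1/64 keeps \<open>37/64 - \<gamma>\<close> nonnegative, so that the
    degree requirement for the smaller set \<open>V'\<close> follows from the one with
    \<open>n\<close> in place of \<open>n'\<close>.\<close>
  define \<gamma> where "\<gamma> = min \<gamma>0 (1/64)"
  have \<gamma>: "0 < \<gamma>" "\<gamma> \<le> \<gamma>0" "\<gamma> \<le> 1/64" using \<gamma>0 by (simp_all add: \<gamma>_def)
  define \<beta> where "\<beta> = min (1/400) (min (\<gamma>/12) (\<eta>/2))"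
  have \<beta>: "0 < \<beta>" "\<beta> \<le> 1/400" "\<beta> \<le> \<gamma>/12" "\<beta> \<le> \<eta>/2" using \<gamma> \<eta> by (simp_all add: \<beta>_def)
  from absorbing_set[OF \<beta>(1,2), where 'a = 'a] obtain \<beta>' n1 where \<beta>': "0 < \<beta>'" "\<beta>' \<le> 1" and
    ab: "\<forall>(V :: 'a set) E. uniform_hypergraph 4 V E \<longrightarrow> n1 \<le> card V \<longrightarrow>
    (\<forall>v\<in>V. 9/16 * real (card V)^3 / 6 \<le> vertex_degree E v) \<longrightarrow>
    (\<exists>W\<subseteq>V. card W \<le> \<beta> * real (card V) \<and>
      (\<forall>L. L \<subseteq> V - W \<and> card L \<le> \<beta>' * real (card V) \<and> 4 dvd card L \<longrightarrow> matchable E (W \<union> L)))"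
    by (elim exE conjE)
  from ap[THEN spec, of \<beta>', THEN mp, OF conjI[OF \<beta>']] obtain n2 :: nat where
    ap': "\<forall>(V :: 'a set) E. uniform_hypergraph 4 V E \<longrightarrow> n2 \<le> card V \<longrightarrow>
    (\<forall>v\<in>V. (37/64 - \<gamma>0) * real (card V)^3 / 6 \<le> vertex_degree E v) \<longrightarrow>
    (\<exists>B\<subseteq>V. (3/4 - \<eta>/2) * card V \<le> card B \<and> card {e\<in>E. e \<subseteq> B} \<le> \<eta>/2 * real (card V)^4) \<or>
    (\<exists>M\<subseteq>E. pairwise disjnt M \<and> card (V - \<Union>M) \<le> \<beta>' * real (card V))"
    by (elim exE)
  \<comment> \<open>The factor 2 before \<open>n2\<close> allows for \<open>V'\<close>, which has at
    least \<open>n/2\<close> vertices; \<open>12/\<gamma>\<close> makes \<open>n^2\<close> at most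
    \<open>\<gamma>/12*n^3\<close>, as large as the loss caused by \<open>W\<close> may be.\<close>
  define n\<^sub>0 where "n\<^sub>0 = max (1000000000000000000) (max n1 (max (2 * n2) (nat \<lceil>12 / \<gamma>\<rceil>)))"
  have main: "matchable E V" if H: "uniform_hypergraph 4 V E" and cV: "n\<^sub>0 \<le> card V" and dvd: "4 dvd card V"
    and deg: "\<And>v. v \<in> V \<Longrightarrow> (card V - 1 choose 3) + 1 \<le> vertex_degree E v + (3 * card V div 4 choose 3)"
    for V :: "'a set" and E
  proof -
    note HD = uniform_hypergraphD[OF H]
    define n where "n = real (card V)"
    have "1000000000000000000 \<le> card V" "n1 \<le> card V" "2 * n2 \<le> card V" "nat \<lceil>12 / \<gamma>\<rceil> \<le> card V"
      using cV unfolding n\<^sub>0_def by simp_all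
    note cV' = this
    have "real (1000000000000000000) \<le> n" unfolding n_def by (rule of_nat_mono[OF cV'(1)])
    then have nbig: "1000000000000000000 \<le> n" by simp
    have n\<gamma>: "12 / \<gamma> \<le> n" unfolding n_def using cV'(4) by linarith
    have n0: "0 < n" using nbig by simp
    have n3: "0 < n^3" using n0 by simp
    have n4: "4 \<le> n" using nbig by simp
    have dl: "37/64 * n^3 / 6 - n\<^sup>2 \<le> real (vertex_degree E v)" if "v \<in> V" for v
      by (rule vertex_degree_lower[OF deg[OF that] dvd n_def n4])
    have sq: "n\<^sup>2 \<le> n^3 / 1000"
    proof -
      have "n\<^sup>2 * 1000 \<le> n\<^sup>2 * n" using nbig by (intro mult_left_mono) auto
      then show ?thesis by (simp add: power2_eq_square power3_eq_cube)
    qed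
    have "\<forall>v\<in>V. 9/16 * real (card V)^3 / 6 \<le> vertex_degree E v"
    proof
      fix v assume "v \<in> V"
      from dl[OF this] sq n3 show "9/16 * real (card V)^3 / 6 \<le> vertex_degree E v"
        unfolding n_def[symmetric] by linarith
    qed
    from ab[THEN spec, THEN spec, THEN mp, OF H, THEN mp, OF cV'(2), THEN mp, OF this] obtain W where
      W0: "W \<subseteq> V" "card W \<le> \<beta> * real (card V)"
        "\<forall>L. L \<subseteq> V - W \<and> card L \<le> \<beta>' * real (card V) \<and> 4 dvd card L \<longrightarrow> matchable E (W \<union> L)"
      by (elim exE conjE)
    have W: "W \<subseteq> V" "card W \<le> \<beta> * n" using W0(1,2) by (simp_all add: n_def)
    have absorb: "matchable E (W \<union> L)" if "L \<subseteq> V - W" "card L \<le> \<beta>' * n" "4 dvd card L" for L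
      by (rule W0(3)[THEN spec, THEN mp]) (use that in \<open>simp add: n_def\<close>)
    have fW: "finite W" using W(1) HD(1) by (rule finite_subset)
    define V' where "V' = V - W"
    define E' where "E' = {e\<in>E. e \<subseteq> V'}"
    have fV': "finite V'" using HD(1) by (simp add: V'_def)
    have H': "uniform_hypergraph 4 V' E'" using fV' HD(4) by (auto simp: E'_def uniform_hypergraph_def)
    define n' where "n' = real (card V')"
    have "card V' = card V - card W" unfolding V'_def using W(1) fW by (simp add: card_Diff_subset)
    moreover have cWV: "card W \<le> card V" using HD(1) W(1) by (rule card_mono)
    ultimately have n': "n' = n - real (card W)" by (simp add: n'_def n_def of_nat_diff)
    have \<beta>n: "\<beta> * n \<le> 1/400 * n" using \<beta>(2) n0 by (intro mult_right_mono) auto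
    have n'n: "n' \<le> n" "n / 2 \<le> n'" "n - \<beta> * n \<le> n'" using n' W(2) \<beta>n n0 by linarith+
    have n'0: "0 < n'" using n'n n0 by linarith
    have "n2 \<le> card V'" using cV'(3) n'n(2) unfolding n_def n'_def by linarith
    have "(37/64 - \<gamma>0) * real (card V')^3 / 6 \<le> vertex_degree E' v" if v: "v \<in> V'" for v
    proof -
      have vV: "v \<in> V" using v by (simp add: V'_def)
      have fl: "finite (link E v)" "finite (link E' v)"
        by (rule finite_subset[OF link_subset[OF H]] finite_subset[OF link_subset[OF H']], use HD(1) fV' in simp)+
      let ?Q = "{T. T \<subseteq> V \<and> card T = 3 \<and> T \<inter> W \<noteq> {}}"
      have "link E v \<subseteq> link E' v \<union> ?Q"
      proof
        fix T assume T: "T \<in> link E v"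
        have TV: "T \<subseteq> V" "card T = 3" using subsetD[OF link_subset[OF H] T] by auto
        show "T \<in> link E' v \<union> ?Q"
        proof (cases "T \<inter> W = {}")
          case True
          then have "insert v T \<subseteq> V'" using v TV(1) unfolding V'_def by blast
          then have "T \<in> link E' v" using T by (simp add: link_def E'_def)
          then show ?thesis by blast
        next
          case False
          then show ?thesis using TV by blast
        qed
      qed
      then have "card (link E v) \<le> card (link E' v \<union> ?Q)" using fl HD(1) by (intro card_mono) auto
      also have "\<dots> \<le> card (link E' v) + card ?Q" by (rule card_Un_le)
      also have "card ?Q \<le> card W * (card V)\<^sup>2" by (rule card_3_subsets_meeting[OF HD(1) W(1)])
      finally have "vertex_degree E v \<le> vertex_degree E' v + card W * (card V)\<^sup>2" by (simp add: card_link)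
      then have "real (vertex_degree E v) \<le> real (vertex_degree E' v + card W * (card V)\<^sup>2)" by (rule of_nat_mono)
      also have "\<dots> = real (vertex_degree E' v) + real (card W) * n\<^sup>2" by (simp add: n_def)
      also have "real (card W) * n\<^sup>2 \<le> (\<beta> * n) * n\<^sup>2" using W(2) by (intro mult_right_mono) auto
      also have "(\<beta> * n) * n\<^sup>2 = \<beta> * n^3" by (simp add: power2_eq_square power3_eq_cube)
      also have "\<beta> * n^3 \<le> \<gamma>/12 * n^3" using \<beta>(3) n3 by (intro mult_right_mono) auto
      finally have d1: "37/64 * n^3 / 6 - n\<^sup>2 - \<gamma>/12 * n^3 \<le> real (vertex_degree E' v)" using dl[OF vV] by linarith
      have "12 \<le> \<gamma> * n" using n\<gamma> \<gamma>(1) by (simp add: pos_divide_le_eq mult.commute)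
      then have "12 * n\<^sup>2 \<le> (\<gamma> * n) * n\<^sup>2" by (intro mult_right_mono) auto
      also have "\<dots> = \<gamma> * n^3" by (simp add: power2_eq_square power3_eq_cube)
      finally have "n\<^sup>2 \<le> \<gamma>/12 * n^3" by simp
      then have d2: "37/64 * n^3 / 6 - \<gamma>/6 * n^3 \<le> real (vertex_degree E' v)" using d1 by linarith
      have "(37/64 - \<gamma>0) * n'^3 / 6 \<le> (37/64 - \<gamma>) * n'^3 / 6"
        using \<gamma>(2) n'0 by (intro divide_right_mono mult_right_mono) auto
      also have "\<dots> \<le> (37/64 - \<gamma>) * n^3 / 6"
        using \<gamma>(3) n'0 n'n(1) by (intro divide_right_mono mult_left_mono power_mono) auto
      also have "\<dots> = 37/64 * n^3 / 6 - \<gamma>/6 * n^3" by (simp add: left_diff_distrib diff_divide_distrib)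
      finally show ?thesis using d2 unfolding n'_def by linarith
    qed
    then have "\<forall>v\<in>V'. (37/64 - \<gamma>0) * real (card V')^3 / 6 \<le> vertex_degree E' v" by blast
    from ap'[THEN spec, THEN spec, THEN mp, OF H', THEN mp, OF \<open>n2 \<le> card V'\<close>, THEN mp, OF this]
    show "matchable E V"
    proof (elim disjE)
      assume "\<exists>B\<subseteq>V'. (3/4 - \<eta>/2) * card V' \<le> card B \<and> card {e\<in>E'. e \<subseteq> B} \<le> \<eta>/2 * real (card V')^4"
      then obtain B where B: "B \<subseteq> V'" "(3/4 - \<eta>/2) * n' \<le> card B" "card {e\<in>E'. e \<subseteq> B} \<le> \<eta>/2 * n'^4"
        unfolding n'_def by (elim exE conjE)
      have "{e\<in>E'. e \<subseteq> B} = {e\<in>E. e \<subseteq> B}" using B(1) by (auto simp: E'_def)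
      then have "real (card {e\<in>E. e \<subseteq> B}) \<le> \<eta>/2 * n'^4" using B(3) by simp
      also have "\<dots> \<le> \<eta> * n^4" using \<eta> n'n n'0 by (intro mult_mono power_mono) auto
      finally have eB: "real (card {e\<in>E. e \<subseteq> B}) \<le> 1/1000000000000000000000000000000000 * n^4" by (simp only: \<eta>_def)
      have "(3/4 - \<eta>/2) * (n - \<beta> * n) \<le> (3/4 - \<eta>/2) * n'"
        using n'n(3) by (intro mult_left_mono) (simp_all add: \<eta>_def)
      moreover have "(3/4 - \<eta>) * n \<le> (3/4 - \<eta>/2) * (n - \<beta> * n)"
      proof -
        have "(3/4 - \<eta>/2) * \<beta> \<le> 1 * (\<eta>/2)" using \<beta> \<eta> by (intro mult_mono) auto
        then have "3/4 - \<eta> \<le> (3/4 - \<eta>/2) * (1 - \<beta>)" by (simp add: right_diff_distrib)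
        then have "(3/4 - \<eta>) * n \<le> (3/4 - \<eta>/2) * (1 - \<beta>) * n" using n0 by (intro mult_right_mono) auto
        then show ?thesis by (simp add: algebra_simps)
      qed
      ultimately have "(3/4 - \<eta>) * n \<le> card B" using B(2) by linarith
      then have cB: "(3/4 - 1/1000000000000000000000000000000000) * n \<le> card B" by (simp only: \<eta>_def)
      have BV: "B \<subseteq> V" using B(1) by (auto simp: V'_def)
      show ?thesis by (rule extremal_case[OF H n_def nbig dvd _ BV cB eB]) (rule deg)
    next
      assume "\<exists>M\<subseteq>E'. pairwise disjnt M \<and> card (V' - \<Union>M) \<le> \<beta>' * real (card V')"
      then obtain M where M: "M \<subseteq> E'" "pairwise disjnt M" "card (V' - \<Union>M) \<le> \<beta>' * n'"
        unfolding n'_def by (elim exE conjE)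
      define L where "L = V' - \<Union>M"
      have ME: "matchable E (\<Union>M)" by (rule matchable_Union[OF _ M(2)]) (use M(1) in \<open>auto simp: E'_def\<close>)
      have MV: "\<Union>M \<subseteq> V'" using M(1) by (auto simp: E'_def)
      have fM: "finite (\<Union>M)" using MV fV' by (rule finite_subset)
      \<comment> \<open>Absorbing the empty set shows that \<open>W\<close> itself is matchable. So
        4 divides its size, and hence the size of the leftover \<open>L\<close>.\<close>
      have "matchable E (W \<union> {})" by (rule absorb) (use \<beta>' n0 in auto)
      then have "4 dvd card W" using matchable_dvd_card[OF _ fW, of E 4] HD(4) by simp
      moreover have "4 dvd card (\<Union>M)" using matchable_dvd_card[OF ME fM, of 4] HD(4) by simp
      moreover have "card V = card W + (card (\<Union>M) + card L)"
      proof -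
        have "V = W \<union> (\<Union>M \<union> L)" using W(1) MV unfolding L_def V'_def by blast
        moreover have "card (\<Union>M \<union> L) = card (\<Union>M) + card L"
          by (rule card_Un_disjoint[OF fM]) (use fV' in \<open>auto simp: L_def\<close>)
        moreover have "card (W \<union> (\<Union>M \<union> L)) = card W + card (\<Union>M \<union> L)"
          by (rule card_Un_disjoint[OF fW]) (use fM fV' MV in \<open>auto simp: L_def V'_def\<close>)
        ultimately show ?thesis by simp
      qed
      ultimately have "4 dvd card L" using dvd by (metis dvd_add_right_iff)
      moreover have "\<beta>' * n' \<le> \<beta>' * n" using \<beta>' n'n(1) by (intro mult_left_mono) auto
      then have "card L \<le> \<beta>' * n" using M(3) unfolding L_def by linarith
      moreover have "L \<subseteq> V - W" by (auto simp: L_def V'_def)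
      ultimately have "matchable E (W \<union> L)" by (intro absorb)
      moreover have "(W \<union> L) \<inter> \<Union>M = {}" using MV unfolding L_def V'_def by blast
      ultimately have "matchable E ((W \<union> L) \<union> \<Union>M)" using ME by (intro matchable_Un[of E "W \<union> L"])
      moreover have "(W \<union> L) \<union> \<Union>M = V" using W(1) MV unfolding L_def V'_def by blast
      ultimately show ?thesis by simp
    qed
  qed
  show ?thesis
  proof (rule exI[of _ n\<^sub>0], intro allI impI)
    fix n and V :: "'a set" and E
    assume n: "n\<^sub>0 \<le> n" and H: "uniform_hypergraph 4 V E" and cV: "card V = n" and dvd: "4 dvd n"
      and md: "int (min_vertex_degree V E) \<ge> int ((n - 1) choose 3) - int ((3 * n div 4) choose 3) + 1"
    have "(card V - 1 choose 3) + 1 \<le> vertex_degree E v + (3 * card V div 4 choose 3)" if "v \<in> V" for v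
    proof -
      have "min_vertex_degree V E \<le> vertex_degree E v"
        unfolding min_vertex_degree_def using uniform_hypergraphD(1)[OF H] that by (intro Min_le) auto
      then show ?thesis using md unfolding cV by linarith
    qed
    then have "matchable E V" using n dvd unfolding cV[symmetric] by (intro main[OF H])
    then show "\<exists>M. perfect_matching V E M" by (simp add: matchable_def)
  qed
qed

end
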